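(* Let $a_n,b_m,c_k,d_l$ be real-valued functions of $n,m,k,l\in\mathbb{Z}$ respectively, and let $p_i,\alpha_i,\beta_i$ ($i\ge1$) be constants. For $(x,t,y)\in\mathbb{R}^3$, $(m,n,k,l)\in\mathbb{Z}^4$, $N\in\mathbb{Z}_{\ge0}$ put $$\tau_n^m(k,l,N)=\exp\left[-\left(x+\sum_{n'}^{n-1}a_{n'}+\sum_{m'}^{m-1}b_{m'}+\sum_{k'}^{k-1}c_{k'}+\sum_{l'}^{l-1}\frac1{d_{l'}}\right)y\right]\det\left(f_{j-1}^{(i)}\right)_{i,j=1,\dots,N},\qquad f_s^{(i)}=e^{\eta_i}+e^{\mu_i},$$ $$e^{\eta_i}=\alpha_ip_i^s\prod_{n'}^{n-1}(1-a_{n'}p_i)^{-1}\prod_{m'}^{m-1}(1-b_{m'}p_i)^{-1}\prod_{k'}^{k-1}(1-c_{k'}p_i)^{-1}\prod_{l'}^{l-1}\left(1-\frac{d_{l'}}{p_i}\right)^{-1}e^{p_ix-4p_i^3t+\frac1{p_i}y},$$ $$e^{\mu_i}=\beta_i(-p_i)^s\prod_{n'}^{n-1}(1+a_{n'}p_i)^{-1}\prod_{m'}^{m-1}(1+b_{m'}p_i)^{-1}\prod_{k'}^{k-1}(1+c_{k'}p_i)^{-1}\prod_{l'}^{l-1}\left(1+\frac{d_{l'}}{p_i}\right)^{-1}e^{-p_ix+4p_i^3t-\frac1{p_i}y}.$$ For each determinant size $N$ that occurs, the parameters are chosen in one of the following two ways: (soliton) $p_i,\alpha_i\in\mathbb{R}$,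 $\beta_i\in\sqrt{-1}\,\mathbb{R}$ for $i=1,\dots,N$; or (breather) $N=2M$, $p_i,\alpha_i,\beta_i\in\mathbb{C}$, $p_{2j}=p_{2j-1}^*$, $\alpha_{2j}=\alpha_{2j-1}^*$, $\beta_{2j}=-\beta_{2j-1}^*$ for $j=1,\dots,M$. Put (suppressing unshifted arguments) $$\Theta_n^m=\frac{2}{\sqrt{-1}}\log\frac{\tau_n^m}{\tau^{*m}_n},\qquad \gamma_n^m=\begin{bmatrix}-\frac12\left(\log\tau_n^m\tau^{*m}_n\right)_y\\[1mm] \frac1{2\sqrt{-1}}\left(\log\frac{\tau_n^m}{\tau^{*m}_n}\right)_y\end{bmatrix},$$ and write $\theta(x,t)$, $\gamma(x,t)$ for $\Theta_n^m$, $\gamma_n^m$ regarded as functions of $(x,t)$ with the other variables fixed. Then, with the four types of Bäcklund transform (I), (II), (III), (IV) defined in the context: (1) For any $k\in\mathbb{Z}$, $\widetilde\gamma(x,t)=\gamma(x,t;k+1)$ is a Bäcklund transform of type (I) of $\gamma(x,t)=\gamma(x,t;k)$ with $\lambda=\frac1{c_k}$ (where $\theta=\theta(x,t;k)$, $\widetilde\theta=\theta(x,t;k+1)$). (2) For any $k\in\mathbb{Z}$, $\widetilde\gamma_n^m=\gamma_n^m(k+1)$ is a Bäcklund transform of type (II) of $\gamma_n^m=\gamma_n^m(k)$ with $\lambda=\frac1{c_k}$ (where $\Theta_n^m=\Theta_n^m(k)$, $\widetilde\Theta_n^m=\Theta_n^m(k+1)$). (3) For any $N\in\mathbb{Z}_{\ge0}$,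 $\widetilde\gamma(x,t)=\gamma(x,t;N+1)$ is a Bäcklund transform of type (I) of $\gamma(x,t)=\gamma(x,t;N)$ with $\lambda=-p_{N+1}$ (where $\theta=\theta(x,t;N)$, $\widetilde\theta=\theta(x,t;N+1)$). (4) For any $N\in\mathbb{Z}_{\ge0}$, $\widetilde\gamma_n^m=\gamma_n^m(N+1)$ is a Bäcklund transform of type (II) of $\gamma_n^m=\gamma_n^m(N)$ with $\lambda=-p_{N+1}$ (where $\Theta_n^m=\Theta_n^m(N)$, $\widetilde\Theta_n^m=\Theta_n^m(N+1)$). (5) For any $l\in\mathbb{Z}$, $\overline\gamma(x,t)=\gamma(x,t;l+1)$ is a Bäcklund transform of type (III) of $\gamma(x,t)=\gamma(x,t;l)$ with $\lambda=d_l$ (where $\theta=\theta(x,t;l)$, $\overline\theta=\theta(x,t;l+1)$). (6) For any $l\in\mathbb{Z}$, $\overline\gamma{}_n^m=\gamma_n^m(l+1)$ is a Bäcklund transform of type (IV) of $\gamma_n^m=\gamma_n^m(l)$ with $\lambda=d_l$ (where $\Theta_n^m=\Theta_n^m(l)$, $\overline\Theta{}_n^m=\Theta_n^m(l+1)$).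
   Context: ${}^*$ denotes complex conjugation; tildes and bars are names of new objects. $'=\partial/\partial x$, $R(\phi)=\begin{pmatrix}\cos\phi&-\sin\phi\\ \sin\phi&\cos\phi\end{pmatrix}$, $S=\begin{bmatrix}1&0\\0&-1\end{bmatrix}$. For $N=0$ the determinant is $1$. $\sum_{n'}^{n-1}$ and $\prod_{n'}^{n-1}$ are indefinite sums and products: sums and products from a fixed base point, extended to all $n\in\mathbb{Z}$ so that raising $n$ by $1$ adds the term (resp. multiplies by the factor) with index $n$; similarly for $m,k,l$. All formulas are understood where the expressions in them are defined. Definitions of Bäcklund transforms with a non-zero constant $\lambda$: (I) $\widetilde\gamma$, with angle function $\widetilde\theta$, is a Bäcklund transform of $\gamma$, with angle function $\theta$, if $\frac{\partial}{\partial x}\left(\frac{\widetilde\theta+\theta}{2}\right)=2\lambda\sin\frac{\widetilde\theta-\theta}{2}$ and $\frac{\partial}{\partial t}\left(\frac{\widetilde\theta+\theta}{2}\right)=-\lambda\{(\theta_x)^2+8\lambda^2\}\sin\frac{\widetilde\theta-\theta}{2}+2\lambda\theta_{xx}\cos\frac{\widetilde\theta-\theta}{2}+4\lambda^2\theta_x$, and $$\widetilde\gamma=\gamma+\frac1\lambda R\left(\frac{\widetilde\theta-\theta}{2}\right)\gamma'.$$ (II) $\widetilde\gamma_n^m$, with potential function $\widetilde\Theta_n^m$, is a Bäcklund transform of $\gamma_n^m$, with potential function $\Theta_n^m$, if $\tan\left(\frac{\widetilde\Theta_{n+1}^m-\Theta_n^m}{4}\right)=\frac{\frac1\lambda+a_n}{\frac1\lambda-a_n}\tan\left(\frac{\widetilde\Theta_n^m-\Theta_{n+1}^m}{4}\right)$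 and $\tan\left(\frac{\widetilde\Theta_n^{m+1}-\Theta_n^m}{4}\right)=\frac{\frac1\lambda+b_m}{\frac1\lambda-b_m}\tan\left(\frac{\widetilde\Theta_n^m-\Theta_n^{m+1}}{4}\right)$, and $$\widetilde\gamma_n^m=\gamma_n^m+\frac1\lambda R\left(\frac{\widetilde\Theta_n^m-\Theta_{n+1}^m}{2}\right)\frac{\gamma_{n+1}^m-\gamma_n^m}{a_n}.$$ (III) $\overline\gamma$, with angle function $\overline\theta$, is a Bäcklund transform of $\gamma$, with angle function $\theta$, if $\frac{\partial}{\partial x}\left(\frac{\overline\theta-\theta}{2}\right)=2\lambda\sin\frac{\overline\theta+\theta}{2}$ and $\frac{\partial}{\partial t}\left(\frac{\overline\theta-\theta}{2}\right)=-\lambda\{(\theta_x)^2+8\lambda^2\}\sin\frac{\overline\theta+\theta}{2}-2\lambda\theta_{xx}\cos\frac{\overline\theta+\theta}{2}-4\lambda^2\theta_x$, and $$\overline\gamma=S\left[\gamma+\frac1\lambda R\left(-\frac{\overline\theta+\theta}{2}\right)\gamma'\right].$$ (IV) $\overline\gamma{}_n^m$, with potential function $\overline\Theta{}_n^m$, is a Bäcklund transform of $\gamma_n^m$, with potential function $\Theta_n^m$, if $\tan\left(\frac{\overline\Theta{}_{n+1}^m+\Theta_n^m}{4}\right)=\frac{\frac1\lambda+a_n}{\frac1\lambda-a_n}\tan\left(\frac{\overline\Theta{}_n^m+\Theta_{n+1}^m}{4}\right)$ and $\tan\left(\frac{\overline\Theta{}_n^{m+1}+\Theta_n^m}{4}\right)=\frac{\frac1\lambda+b_m}{\frac1\lambda-b_m}\tan\left(\frac{\overline\Theta{}_n^m+\Theta_n^{m+1}}{4}\right)$,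 and $$\overline\gamma{}_n^m=S\left[\gamma_n^m+\frac1\lambda R\left(-\frac{\overline\Theta{}_n^m+\Theta_{n+1}^m}{2}\right)\frac{\gamma_{n+1}^m-\gamma_n^m}{a_n}\right].$$ *)

theory Defs
  imports "HOL-Analysis.Analysis" "Jordan_Normal_Form.Determinant"
begin

section \<open>Indefinite sums and products\<close>

text \<open>\<open>indef_sum n0 f n\<close> and \<open>indef_prod n0 f n\<close> are the indefinite sum and product with upper
  limit \<open>n - 1\<close> and base point \<open>n0\<close>. The terms that enter them are those with index in
  \<open>index_range n0 n\<close>.\<close>

definition indef_sum :: "int \<Rightarrow> (int \<Rightarrow> real) \<Rightarrow> int \<Rightarrow> real" where
  "indef_sum n0 f n = (if n0 \<le> n then (\<Sum>i\<in>{n0..<n}. f i) else - (\<Sum>i\<in>{n..<n0}. f i))"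

definition indef_prod :: "int \<Rightarrow> (int \<Rightarrow> complex) \<Rightarrow> int \<Rightarrow> complex" where
  "indef_prod n0 f n =
     (if n0 \<le> n then (\<Prod>i\<in>{n0..<n}. f i) else inverse (\<Prod>i\<in>{n..<n0}. f i))"

definition index_range :: "int \<Rightarrow> int \<Rightarrow> int set" where
  "index_range n0 n = {min n0 n..<max n0 n}"

lemma indef_sum_step: "indef_sum n0 f (n + 1) = indef_sum n0 f n + f n"
proof (cases "n0 \<le> n")
  case True
  then have "{n0..<n + 1} = insert n {n0..<n}" by auto
  with True show ?thesis by (simp add: indef_sum_def)
next
  case False
  then have "{n..<n0} = insert n {n + 1..<n0}" by auto
  with False show ?thesis by (auto simp: indef_sum_def)
qed

lemma indef_prod_step:
  assumes "f n \<noteq> 0"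
  shows "indef_prod n0 f (n + 1) = indef_prod n0 f n * f n"
proof (cases "n0 \<le> n")
  case True
  then have "{n0..<n + 1} = insert n {n0..<n}" by auto
  with True show ?thesis by (simp add: indef_prod_def)
next
  case False
  then have "{n..<n0} = insert n {n + 1..<n0}" by auto
  with False assms show ?thesis by (auto simp: indef_prod_def)
qed


section \<open>The tau function\<close>

record tau_params =
  a_seq :: "int \<Rightarrow> real"
  b_seq :: "int \<Rightarrow> real"
  c_seq :: "int \<Rightarrow> real"
  d_seq :: "int \<Rightarrow> real"
  base_n :: int
  base_m :: int
  base_k :: int
  base_l :: int
  p_par :: "nat \<Rightarrow> complex"
  alpha_par :: "nat \<Rightarrow> complex"
  beta_par :: "nat \<Rightarrow> complex"

definition exp_eta ::
  "tau_params \<Rightarrow> nat \<Rightarrow> nat \<Rightarrow> real \<Rightarrow> real \<Rightarrow> real \<Rightarrow> int \<Rightarrow> int \<Rightarrow> int \<Rightarrow> int \<Rightarrow> complex" where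
  "exp_eta P i s x t y n m k l =
     alpha_par P i * p_par P i ^ s
     * indef_prod (base_n P) (\<lambda>j. inverse (1 - of_real (a_seq P j) * p_par P i)) n
     * indef_prod (base_m P) (\<lambda>j. inverse (1 - of_real (b_seq P j) * p_par P i)) m
     * indef_prod (base_k P) (\<lambda>j. inverse (1 - of_real (c_seq P j) * p_par P i)) k
     * indef_prod (base_l P) (\<lambda>j. inverse (1 - of_real (d_seq P j) / p_par P i)) l
     * exp (p_par P i * of_real x - 4 * p_par P i ^ 3 * of_real t + 1 / p_par P i * of_real y)"

definition exp_mu ::
  "tau_params \<Rightarrow> nat \<Rightarrow> nat \<Rightarrow> real \<Rightarrow> real \<Rightarrow> real \<Rightarrow> int \<Rightarrow> int \<Rightarrow> int \<Rightarrow> int \<Rightarrow> complex" where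
  "exp_mu P i s x t y n m k l =
     beta_par P i * (- p_par P i) ^ s
     * indef_prod (base_n P) (\<lambda>j. inverse (1 + of_real (a_seq P j) * p_par P i)) n
     * indef_prod (base_m P) (\<lambda>j. inverse (1 + of_real (b_seq P j) * p_par P i)) m
     * indef_prod (base_k P) (\<lambda>j. inverse (1 + of_real (c_seq P j) * p_par P i)) k
     * indef_prod (base_l P) (\<lambda>j. inverse (1 + of_real (d_seq P j) / p_par P i)) l
     * exp (- p_par P i * of_real x + 4 * p_par P i ^ 3 * of_real t - 1 / p_par P i * of_real y)"

definition f_entry ::
  "tau_params \<Rightarrow> nat \<Rightarrow> nat \<Rightarrow> real \<Rightarrow> real \<Rightarrow> real \<Rightarrow> int \<Rightarrow> int \<Rightarrow> int \<Rightarrow> int \<Rightarrow> complex" where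
  "f_entry P i s x t y n m k l = exp_eta P i s x t y n m k l + exp_mu P i s x t y n m k l"

text \<open>Matrix positions are counted from 0, so the entry at \<open>(i, j)\<close> belongs to the parameters with
  index \<open>Suc i\<close> and has \<open>s = j\<close>.\<close>

definition tau ::
  "tau_params \<Rightarrow> real \<Rightarrow> real \<Rightarrow> real \<Rightarrow> int \<Rightarrow> int \<Rightarrow> int \<Rightarrow> int \<Rightarrow> nat \<Rightarrow> complex" where
  "tau P x t y n m k l N =
     of_real (exp (- (x + indef_sum (base_n P) (a_seq P) n + indef_sum (base_m P) (b_seq P) m
                        + indef_sum (base_k P) (c_seq P) k
                        + indef_sum (base_l P) (\<lambda>j. 1 / d_seq P j) l) * y))
     * Determinant.det (Matrix.mat N N (\<lambda>(i, j). f_entry P (Suc i) j x t y n m k l))"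

text \<open>Every quotient that occurs in \<open>tau P x t y n m k l N\<close> has a non-zero denominator.\<close>

definition tau_defined :: "tau_params \<Rightarrow> int \<Rightarrow> int \<Rightarrow> int \<Rightarrow> int \<Rightarrow> nat \<Rightarrow> bool" where
  "tau_defined P n m k l N \<longleftrightarrow>
     (\<forall>j\<in>index_range (base_l P) l. d_seq P j \<noteq> 0) \<and>
     (\<forall>i\<in>{1..N}. p_par P i \<noteq> 0 \<and>
        (\<forall>j\<in>index_range (base_n P) n.
           1 - of_real (a_seq P j) * p_par P i \<noteq> 0 \<and> 1 + of_real (a_seq P j) * p_par P i \<noteq> 0) \<and>
        (\<forall>j\<in>index_range (base_m P) m.
           1 - of_real (b_seq P j) * p_par P i \<noteq> 0 \<and> 1 + of_real (b_seq P j) * p_par P i \<noteq> 0) \<and>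
        (\<forall>j\<in>index_range (base_k P) k.
           1 - of_real (c_seq P j) * p_par P i \<noteq> 0 \<and> 1 + of_real (c_seq P j) * p_par P i \<noteq> 0) \<and>
        (\<forall>j\<in>index_range (base_l P) l.
           1 - of_real (d_seq P j) / p_par P i \<noteq> 0 \<and> 1 + of_real (d_seq P j) / p_par P i \<noteq> 0))"

definition soliton_params :: "tau_params \<Rightarrow> nat \<Rightarrow> bool" where
  "soliton_params P N \<longleftrightarrow>
     (\<forall>i\<in>{1..N}. p_par P i \<in> \<real> \<and> alpha_par P i \<in> \<real> \<and>
        (\<exists>r::real. beta_par P i = \<i> * of_real r))"

definition breather_params :: "tau_params \<Rightarrow> nat \<Rightarrow> bool" where
  "breather_params P N \<longleftrightarrow>
     (\<exists>M. N = 2 * M \<and>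
        (\<forall>j\<in>{1..M}. p_par P (2 * j) = cnj (p_par P (2 * j - 1)) \<and>
           alpha_par P (2 * j) = cnj (alpha_par P (2 * j - 1)) \<and>
           beta_par P (2 * j) = - cnj (beta_par P (2 * j - 1))))"

definition admissible_params :: "tau_params \<Rightarrow> nat \<Rightarrow> bool" where
  "admissible_params P N \<longleftrightarrow> soliton_params P N \<or> breather_params P N"

text \<open>If two consecutive determinant sizes occur, one of them is odd, hence of soliton type. This
  makes the new spectral parameter real.\<close>

lemma p_par_Suc_real:
  assumes "admissible_params P N" "admissible_params P (Suc N)"
  shows "p_par P (Suc N) \<in> \<real>"
proof (cases "soliton_params P (Suc N)")
  case True
  then show ?thesis by (simp add: soliton_params_def)
next
  case False
  with assms(2) obtain M where M: "Suc N = 2 * M"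
    and p: "\<forall>j\<in>{1..M}. p_par P (2 * j) = cnj (p_par P (2 * j - 1))"
    by (auto simp: admissible_params_def breather_params_def)
  have M1: "M \<in> {1..M}" and N1: "N \<in> {1..N}" and odd: "odd N" and N2: "2 * M - 1 = N"
    using M by (cases M; simp; presburger)+
  from odd assms(1) have "soliton_params P N"
    by (auto simp: admissible_params_def breather_params_def)
  with N1 have "p_par P N \<in> \<real>" by (auto simp: soliton_params_def)
  moreover have "p_par P (Suc N) = cnj (p_par P N)" using p M1 M N2 by metis
  ultimately show ?thesis by (metis Reals_cnj_iff)
qed


section \<open>Logarithms, potential function and curve\<close>

text \<open>\<open>log_deriv g y\<close> is \<open>(log g)\<^sub>y\<close>. The logarithm is multivalued; the derivative at
  \<open>y\<close> is taken of a branch that is defined near \<open>y\<close>.\<close>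

definition log_deriv :: "(real \<Rightarrow> complex) \<Rightarrow> real \<Rightarrow> complex" where
  "log_deriv g y = (THE D. \<exists>L. (\<forall>\<^sub>F s in nhds y. exp (L s) = g s) \<and>
                              (L has_vector_derivative D) (at y))"

lemma log_deriv_eq:
  assumes g: "(g has_vector_derivative g') (at y)" and nz: "g y \<noteq> 0"
  shows "log_deriv g y = g' / g y"
  unfolding log_deriv_def
proof (rule the_equality)
  have "isCont g y"
    using g has_vector_derivative_continuous by blast
  then have "(g \<longlongrightarrow> g y) (nhds y)"
    by (simp add: continuous_at tendsto_at_iff_tendsto_nhds)
  then have ev: "\<forall>\<^sub>F s in nhds y. g s \<noteq> 0"
    using nz by (rule tendsto_imp_eventually_ne)
  let ?L = "\<lambda>s. Ln (g s / g y) + Ln (g y)"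
  have "\<forall>\<^sub>F s in nhds y. exp (?L s) = g s"
    using ev by eventually_elim (use nz in \<open>simp add: exp_add\<close>)
  moreover have "((\<lambda>s. Ln (g s / g y)) has_vector_derivative (g' / g y) * 1) (at y)"
  proof -
    have 1: "((\<lambda>s. g s / g y) has_vector_derivative g' / g y) (at y)"
      using has_vector_derivative_divide[OF g] .
    have 2: "(Ln has_field_derivative 1) (at (g y / g y))"
      using nz by (auto intro!: derivative_eq_intros)
    show ?thesis
      using field_vector_diff_chain_at[OF 1 2] by (simp add: o_def)
  qed
  then have "(?L has_vector_derivative g' / g y) (at y)"
    by (auto intro!: derivative_eq_intros)
  ultimately show "\<exists>L. (\<forall>\<^sub>F s in nhds y. exp (L s) = g s) \<and>
                       (L has_vector_derivative g' / g y) (at y)"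
    by (intro exI[of _ ?L] conjI)
next
  fix D
  assume "\<exists>L. (\<forall>\<^sub>F s in nhds y. exp (L s) = g s) \<and> (L has_vector_derivative D) (at y)"
  then obtain L where L: "\<forall>\<^sub>F s in nhds y. exp (L s) = g s"
    and D: "(L has_vector_derivative D) (at y)" by blast
  have "((\<lambda>s. exp (L s)) has_vector_derivative D * exp (L y)) (at y)"
    using field_vector_diff_chain_at[OF D DERIV_exp] by (simp add: o_def)
  moreover have Ly: "exp (L y) = g y"
    using L by (rule eventually_nhds_x_imp_x)
  ultimately have "(g has_vector_derivative D * g y) (at y)"
    using has_vector_derivative_cong_ev[of UNIV "\<lambda>s. exp (L s)" g y] L by simp
  with g have "D * g y = g'"
    using vector_derivative_unique_at by blast
  with nz show "D = g' / g y" by (simp add: field_simps)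
qed

text \<open>\<open>r\<close> is one of the values of \<open>(2 / \<i>) log (z / z\<^sup>*)\<close>, which are real and differ by
  multiples of \<open>4\<pi>\<close>.\<close>

definition potential_value :: "complex \<Rightarrow> real \<Rightarrow> bool" where
  "potential_value z r \<longleftrightarrow> z \<noteq> 0 \<and> (\<exists>w. exp w = z / cnj z \<and> of_real r = 2 / \<i> * w)"

text \<open>On the lattice any choice of values is a potential function on a set \<open>D\<close> of sites
  \<open>(n, m)\<close>. In the continuous variables \<open>(x, t)\<close> the values must form a continuous branch on a
  set \<open>U\<close>.\<close>

definition potential_function ::
  "tau_params \<Rightarrow> real \<Rightarrow> real \<Rightarrow> real \<Rightarrow> int \<Rightarrow> int \<Rightarrow> nat \<Rightarrow> (int \<times> int) set
     \<Rightarrow> (int \<Rightarrow> int \<Rightarrow> real) \<Rightarrow> bool" where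
  "potential_function P x t y k l N D \<Theta> \<longleftrightarrow>
     (\<forall>(n, m)\<in>D. tau_defined P n m k l N \<and> potential_value (tau P x t y n m k l N) (\<Theta> n m))"

definition angle_function ::
  "tau_params \<Rightarrow> real \<Rightarrow> int \<Rightarrow> int \<Rightarrow> int \<Rightarrow> int \<Rightarrow> nat \<Rightarrow> (real \<times> real) set
     \<Rightarrow> (real \<Rightarrow> real \<Rightarrow> real) \<Rightarrow> bool" where
  "angle_function P y n m k l N U \<theta> \<longleftrightarrow>
     tau_defined P n m k l N \<and> continuous_on U (\<lambda>(x, t). \<theta> x t) \<and>
     (\<forall>(x, t)\<in>U. potential_value (tau P x t y n m k l N) (\<theta> x t))"

text \<open>Both components are real already before the real part is taken.\<close>

definition gamma ::
  "tau_params \<Rightarrow> real \<Rightarrow> real \<Rightarrow> real \<Rightarrow> int \<Rightarrow> int \<Rightarrow> int \<Rightarrow> int \<Rightarrow> nat \<Rightarrow> real^2" where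
  "gamma P x t y n m k l N = vector
     [Re (- (1 / 2) * log_deriv (\<lambda>s. tau P x t s n m k l N * cnj (tau P x t s n m k l N)) y),
      Re (1 / (2 * \<i>) * log_deriv (\<lambda>s. tau P x t s n m k l N / cnj (tau P x t s n m k l N)) y)]"


section \<open>Baecklund transforms\<close>

definition rotation :: "real \<Rightarrow> real^2^2" where
  "rotation \<phi> = vector [vector [cos \<phi>, - sin \<phi>], vector [sin \<phi>, cos \<phi>]]"

definition reflection :: "real^2^2" where
  "reflection = vector [vector [1, 0], vector [0, -1]]"

text \<open>The curves and angle functions of types I and III live on a set \<open>U\<close> of points \<open>(x, t)\<close>.
  The differentiability clauses express that the derivatives on the right-hand sides exist.\<close>

definition baecklund_I ::
  "(real \<times> real) set \<Rightarrow> real \<Rightarrow> (real \<Rightarrow> real \<Rightarrow> real) \<Rightarrow> (real \<Rightarrow> real \<Rightarrow> real^2)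
     \<Rightarrow> (real \<Rightarrow> real \<Rightarrow> real) \<Rightarrow> (real \<Rightarrow> real \<Rightarrow> real^2) \<Rightarrow> bool" where
  "baecklund_I U lam \<theta> \<gamma> \<theta>' \<gamma>' \<longleftrightarrow> lam \<noteq> 0 \<and> (\<forall>(x, t)\<in>U.
     (\<lambda>s. \<theta> s t) differentiable at x \<and>
     deriv (\<lambda>s. \<theta> s t) differentiable at x \<and>
     (\<lambda>s. \<gamma> s t) differentiable at x \<and>
     ((\<lambda>s. (\<theta>' s t + \<theta> s t) / 2) has_real_derivative
        2 * lam * sin ((\<theta>' x t - \<theta> x t) / 2)) (at x) \<and>
     ((\<lambda>s. (\<theta>' x s + \<theta> x s) / 2) has_real_derivative
        - lam * ((deriv (\<lambda>s. \<theta> s t) x)\<^sup>2 + 8 * lam\<^sup>2) * sin ((\<theta>' x t - \<theta> x t) / 2)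
        + 2 * lam * deriv (deriv (\<lambda>s. \<theta> s t)) x * cos ((\<theta>' x t - \<theta> x t) / 2)
        + 4 * lam\<^sup>2 * deriv (\<lambda>s. \<theta> s t) x) (at t) \<and>
     \<gamma>' x t = \<gamma> x t
        + (1 / lam) *\<^sub>R (rotation ((\<theta>' x t - \<theta> x t) / 2) *v vector_derivative (\<lambda>s. \<gamma> s t) (at x)))"

definition baecklund_III ::
  "(real \<times> real) set \<Rightarrow> real \<Rightarrow> (real \<Rightarrow> real \<Rightarrow> real) \<Rightarrow> (real \<Rightarrow> real \<Rightarrow> real^2)
     \<Rightarrow> (real \<Rightarrow> real \<Rightarrow> real) \<Rightarrow> (real \<Rightarrow> real \<Rightarrow> real^2) \<Rightarrow> bool" where
  "baecklund_III U lam \<theta> \<gamma> \<theta>' \<gamma>' \<longleftrightarrow> lam \<noteq> 0 \<and> (\<forall>(x, t)\<in>U.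
     (\<lambda>s. \<theta> s t) differentiable at x \<and>
     deriv (\<lambda>s. \<theta> s t) differentiable at x \<and>
     (\<lambda>s. \<gamma> s t) differentiable at x \<and>
     ((\<lambda>s. (\<theta>' s t - \<theta> s t) / 2) has_real_derivative
        2 * lam * sin ((\<theta>' x t + \<theta> x t) / 2)) (at x) \<and>
     ((\<lambda>s. (\<theta>' x s - \<theta> x s) / 2) has_real_derivative
        - lam * ((deriv (\<lambda>s. \<theta> s t) x)\<^sup>2 + 8 * lam\<^sup>2) * sin ((\<theta>' x t + \<theta> x t) / 2)
        - 2 * lam * deriv (deriv (\<lambda>s. \<theta> s t)) x * cos ((\<theta>' x t + \<theta> x t) / 2)
        - 4 * lam\<^sup>2 * deriv (\<lambda>s. \<theta> s t) x) (at t) \<and>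
     \<gamma>' x t = reflection *v (\<gamma> x t
        + (1 / lam) *\<^sub>R (rotation (- (\<theta>' x t + \<theta> x t) / 2) *v vector_derivative (\<lambda>s. \<gamma> s t) (at x))))"

text \<open>In types II and IV, \<open>\<Theta>, \<gamma>\<close> are defined on the sites in \<open>D\<close> and \<open>\<Theta>', \<gamma>'\<close>
  on those in \<open>D'\<close>. Each equation is required at the sites where all its terms are defined:
  \<open>cos \<phi> \<noteq> 0\<close> says that \<open>tan \<phi>\<close> is, and \<open>1 / lam \<noteq> a n\<close>, \<open>a n \<noteq> 0\<close> that the quotients are.\<close>

definition baecklund_II ::
  "(int \<Rightarrow> real) \<Rightarrow> (int \<Rightarrow> real) \<Rightarrow> (int \<times> int) set \<Rightarrow> (int \<times> int) set \<Rightarrow> real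
     \<Rightarrow> (int \<Rightarrow> int \<Rightarrow> real) \<Rightarrow> (int \<Rightarrow> int \<Rightarrow> real^2)
     \<Rightarrow> (int \<Rightarrow> int \<Rightarrow> real) \<Rightarrow> (int \<Rightarrow> int \<Rightarrow> real^2) \<Rightarrow> bool" where
  "baecklund_II a b D D' lam \<Theta> \<gamma> \<Theta>' \<gamma>' \<longleftrightarrow> lam \<noteq> 0 \<and> (\<forall>n m. (n, m) \<in> D \<inter> D' \<longrightarrow>
     ((n + 1, m) \<in> D \<inter> D' \<and> 1 / lam \<noteq> a n \<and>
        cos ((\<Theta>' (n + 1) m - \<Theta> n m) / 4) \<noteq> 0 \<and> cos ((\<Theta>' n m - \<Theta> (n + 1) m) / 4) \<noteq> 0 \<longrightarrow>
      tan ((\<Theta>' (n + 1) m - \<Theta> n m) / 4)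
        = (1 / lam + a n) / (1 / lam - a n) * tan ((\<Theta>' n m - \<Theta> (n + 1) m) / 4)) \<and>
     ((n, m + 1) \<in> D \<inter> D' \<and> 1 / lam \<noteq> b m \<and>
        cos ((\<Theta>' n (m + 1) - \<Theta> n m) / 4) \<noteq> 0 \<and> cos ((\<Theta>' n m - \<Theta> n (m + 1)) / 4) \<noteq> 0 \<longrightarrow>
      tan ((\<Theta>' n (m + 1) - \<Theta> n m) / 4)
        = (1 / lam + b m) / (1 / lam - b m) * tan ((\<Theta>' n m - \<Theta> n (m + 1)) / 4)) \<and>
     ((n + 1, m) \<in> D \<and> a n \<noteq> 0 \<longrightarrow>
      \<gamma>' n m = \<gamma> n m
        + (1 / lam) *\<^sub>R (rotation ((\<Theta>' n m - \<Theta> (n + 1) m) / 2) *v ((\<gamma> (n + 1) m - \<gamma> n m) /\<^sub>R a n))))"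

definition baecklund_IV ::
  "(int \<Rightarrow> real) \<Rightarrow> (int \<Rightarrow> real) \<Rightarrow> (int \<times> int) set \<Rightarrow> (int \<times> int) set \<Rightarrow> real
     \<Rightarrow> (int \<Rightarrow> int \<Rightarrow> real) \<Rightarrow> (int \<Rightarrow> int \<Rightarrow> real^2)
     \<Rightarrow> (int \<Rightarrow> int \<Rightarrow> real) \<Rightarrow> (int \<Rightarrow> int \<Rightarrow> real^2) \<Rightarrow> bool" where
  "baecklund_IV a b D D' lam \<Theta> \<gamma> \<Theta>' \<gamma>' \<longleftrightarrow> lam \<noteq> 0 \<and> (\<forall>n m. (n, m) \<in> D \<inter> D' \<longrightarrow>
     ((n + 1, m) \<in> D \<inter> D' \<and> 1 / lam \<noteq> a n \<and>
        cos ((\<Theta>' (n + 1) m + \<Theta> n m) / 4) \<noteq> 0 \<and> cos ((\<Theta>' n m + \<Theta> (n + 1) m) / 4) \<noteq> 0 \<longrightarrow>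
      tan ((\<Theta>' (n + 1) m + \<Theta> n m) / 4)
        = (1 / lam + a n) / (1 / lam - a n) * tan ((\<Theta>' n m + \<Theta> (n + 1) m) / 4)) \<and>
     ((n, m + 1) \<in> D \<inter> D' \<and> 1 / lam \<noteq> b m \<and>
        cos ((\<Theta>' n (m + 1) + \<Theta> n m) / 4) \<noteq> 0 \<and> cos ((\<Theta>' n m + \<Theta> n (m + 1)) / 4) \<noteq> 0 \<longrightarrow>
      tan ((\<Theta>' n (m + 1) + \<Theta> n m) / 4)
        = (1 / lam + b m) / (1 / lam - b m) * tan ((\<Theta>' n m + \<Theta> n (m + 1)) / 4)) \<and>
     ((n + 1, m) \<in> D \<and> a n \<noteq> 0 \<longrightarrow>
      \<gamma>' n m = reflection *v (\<gamma> n m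
        + (1 / lam) *\<^sub>R (rotation (- (\<Theta>' n m + \<Theta> (n + 1) m) / 2) *v ((\<gamma> (n + 1) m - \<gamma> n m) /\<^sub>R a n)))))"

end

theory Submission
  imports Defs
begin

text \<open>
  Write \<open>\<tau> = E D\<close> with \<open>E\<close> the exponential prefactor and \<open>D\<close> the determinant with rows
  \<open>A\<^sub>i p\<^sub>i\<^sup>j + B\<^sub>i (- p\<^sub>i)\<^sup>j\<close>. Complex conjugation of \<open>\<tau>\<close> amounts, up to a sign, to replacing \<open>B\<close> by \<open>- B\<close>,
  which gives \<open>D\<^sup>*\<close>. If \<open>D \<noteq> 0\<close>, there is a unique monic polynomial \<open>Q\<close> of degree \<open>N\<close> with
  \<open>A\<^sub>i Q(p\<^sub>i) + B\<^sub>i Q(- p\<^sub>i) = 0\<close> for all \<open>i\<close>, and similarly \<open>Q\<^sup>*\<close> for \<open>D\<^sup>*\<close>; the space of all polynomials with this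
  property is generated by \<open>Q\<close> and \<open>z Q\<^sup>*\<close> over the polynomials in \<open>z\<^sup>2\<close>. By Jacobi's formula the logarithmic derivatives of \<open>D\<close>
  in \<open>x\<close>, \<open>t\<close> and \<open>y\<close> are polynomials, respectively a quotient, in the coefficients of \<open>Q\<close> and \<open>Q\<^sup>*\<close>.

  Adding a row with real parameter \<open>p\<close> replaces \<open>Q\<close> by \<open>z Q\<^sup>* - r Q\<close> with \<open>r = p exp (- \<i> (\<theta>' - \<theta>) / 2)\<close>,
  and with this the equations of type I for \<open>\<lambda> = - p\<close> become identities between coefficients.
  A shift of \<open>k\<close> with \<open>\<lambda> = 1 / c\<^sub>k\<close> adds, up to real factors, the row of powers of \<open>p = - 1 / c\<^sub>k\<close>, and a shift
  of \<open>l\<close> does the same with \<open>p = - d\<^sub>l\<close> followed by complex conjugation, which turns types I and II into III and IV.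
  On the lattice, shifts of \<open>n\<close> and \<open>m\<close> evaluate \<open>Q\<close> at \<open>- 1 / a\<^sub>n\<close> and \<open>- 1 / b\<^sub>m\<close>, and a three-term
  identity between evaluations gives types II and IV.
\<close>

section \<open>Casorati determinants and their annihilating polynomials\<close>

text \<open>Multiplication by \<open>z\<close> exchanges the polynomials killed by the rows of
  \<open>(A, B)\<close> with those killed by the rows of \<open>(A, - B)\<close>; only
  \<open>z^2\<close> preserves either family. This is why a determinant and its conjugate are always
  treated together. The polynomials replace a separate bilinear identity for each equation. The
  three coefficients below the leading one carry \<theta>_x, \<theta>_xx and \<theta>_t; the two
  lowest ones carry the curve and its tangent. Since \<open>r\<close> has the modulus of
  \<open>p\<close>, it satisfies \<open>r rs = p^2\<close> with its conjugate \<open>rs\<close>, and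
  this makes the result a polynomial identity. In a shift of \<open>k\<close> or \<open>l\<close>
  the size stays the same and no new parameter is present. The artificial row has coefficients
  \<open>(1, 0)\<close>: one real, the other imaginary, hence compatible with the conjugation
  symmetry. Its exponential in \<open>y\<close> accounts for the change of the prefactor, and the
  real factors that depend on \<open>x\<close> and \<open>t\<close> affect neither the phase nor the
  derivative in \<open>y\<close>. So one continuous and one discrete theorem about bordering serve
  all six statements.\<close>

definition cmat :: "nat \<Rightarrow> (nat \<Rightarrow> complex) \<Rightarrow> (nat \<Rightarrow> complex) \<Rightarrow> (nat \<Rightarrow> complex) \<Rightarrow> complex mat" where
  "cmat N p A B = Matrix.mat N N (\<lambda>(i, j). A i * p i ^ j + B i * (- p i) ^ j)"

definition cdet :: "nat \<Rightarrow> (nat \<Rightarrow> complex) \<Rightarrow> (nat \<Rightarrow> complex) \<Rightarrow> (nat \<Rightarrow> complex) \<Rightarrow> complex" where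
  "cdet N p A B = Determinant.det (cmat N p A B)"

text \<open>The linear functional on polynomials that a row represents: the entries of the row are
  its values on the powers of \<open>z\<close>.\<close>

definition pairing :: "complex \<Rightarrow> complex \<Rightarrow> complex \<Rightarrow> complex poly \<Rightarrow> complex" where
  "pairing p A B R = A * poly R p + B * poly R (- p)"

definition annihilator ::
  "nat \<Rightarrow> (nat \<Rightarrow> complex) \<Rightarrow> (nat \<Rightarrow> complex) \<Rightarrow> (nat \<Rightarrow> complex) \<Rightarrow> complex poly \<Rightarrow> bool" where
  "annihilator N p A B Q \<longleftrightarrow> coeff Q N = 1 \<and> (\<forall>j>N. coeff Q j = 0) \<and>
     (\<forall>i<N. pairing (p i) (A i) (B i) Q = 0)"

text \<open>The coefficient of \<open>z ^ (N - i)\<close>, which is 0 for \<open>i > N\<close> in spite of truncated subtraction.\<close>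

definition top_coeff :: "nat \<Rightarrow> complex poly \<Rightarrow> nat \<Rightarrow> complex" where
  "top_coeff N Q i = (if i \<le> N then coeff Q (N - i) else 0)"

lemma pairing_add: "pairing p A B (R + S) = pairing p A B R + pairing p A B S"
  and pairing_diff: "pairing p A B (R - S) = pairing p A B R - pairing p A B S"
  and pairing_uminus: "pairing p A B (- R) = - pairing p A B R"
  and pairing_smult: "pairing p A B (Polynomial.smult c R) = c * pairing p A B R"
  and pairing_0: "pairing p A B 0 = 0"
  and pairing_monom: "pairing p A B (monom 1 j) = A * p ^ j + B * (- p) ^ j"
  and pairing_pCons0: "pairing p A B (pCons 0 R) = p * pairing p A (- B) R"
  by (simp_all add: pairing_def poly_monom algebra_simps)

lemmas pairing_simps =
  pairing_add pairing_diff pairing_uminus pairing_smult pairing_0 pairing_monom pairing_pCons0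

lemma poly_sum_below:
  fixes R :: "'a :: comm_ring_1 poly"
  assumes "\<forall>j\<ge>N. coeff R j = 0"
  shows "poly R z = (\<Sum>j<N. coeff R j * z ^ j)"
proof -
  have "R = (\<Sum>j<N. monom (coeff R j) j)"
    using assms by (intro poly_eqI) (auto simp: coeff_sum coeff_monom if_distrib not_less cong: if_cong)
  then have "poly R z = poly (\<Sum>j<N. monom (coeff R j) j) z" by simp
  then show ?thesis by (simp add: poly_sum poly_monom)
qed

lemma pairing_sum_below:
  assumes "\<forall>j\<ge>N. coeff R j = 0"
  shows "pairing p A B R = (\<Sum>j<N. coeff R j * (A * p ^ j + B * (- p) ^ j))"
  unfolding pairing_def poly_sum_below[OF assms]
  by (simp add: sum_distrib_left sum.distrib[symmetric] algebra_simps)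

lemma cmat_carrier [simp]: "cmat N p A B \<in> carrier_mat N N"
  by (simp add: cmat_def)

lemma det_cmat: "Determinant.det (cmat N p A B) = cdet N p A B"
  by (simp add: cdet_def)

text \<open>On polynomials of degree below \<open>N\<close> the matrix evaluates all row functionals
  at once. Thus a non-zero determinant means that these functionals form a basis of the dual
  space.\<close>

lemma cmat_mult_coeffs:
  assumes "\<forall>j\<ge>N. coeff R j = 0"
  shows "cmat N p A B *\<^sub>v Matrix.vec N (coeff R) = Matrix.vec N (\<lambda>i. pairing (p i) (A i) (B i) R)"
proof (rule eq_vecI)
  fix i assume "i < dim_vec (Matrix.vec N (\<lambda>i. pairing (p i) (A i) (B i) R))"
  then show "vec_index (cmat N p A B *\<^sub>v Matrix.vec N (coeff R)) i
      = vec_index (Matrix.vec N (\<lambda>i. pairing (p i) (A i) (B i) R)) i"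
    by (simp add: cmat_def scalar_prod_def pairing_sum_below[OF assms] atLeast0LessThan mult.commute)
qed (simp add: cmat_def)

lemma pairing_nondegenerate:
  assumes "cdet N p A B \<noteq> 0" and R: "\<forall>j\<ge>N. coeff R j = 0"
    and null: "\<And>i. i < N \<Longrightarrow> pairing (p i) (A i) (B i) R = 0"
  shows "R = 0"
proof -
  have "cmat N p A B *\<^sub>v Matrix.vec N (coeff R) = 0\<^sub>v N"
    unfolding cmat_mult_coeffs[OF R] using null by (intro eq_vecI) auto
  moreover have "Determinant.det (cmat N p A B) \<noteq> 0" using assms(1) by (simp add: det_cmat)
  ultimately have "Matrix.vec N (coeff R) = 0\<^sub>v N"
    using det_0_iff_vec_prod_zero_field[OF cmat_carrier, of N p A B] vec_carrier by blast
  then have "vec_index (Matrix.vec N (coeff R)) j = vec_index (0\<^sub>v N) j" for j by simp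
  then have "coeff R j = 0" if "j < N" for j using that by (metis index_vec index_zero_vec(1))
  with R show ?thesis by (intro poly_eqI) (metis coeff_0 not_less)
qed

lemma pairing_solve:
  assumes "cdet N p A B \<noteq> 0"
  shows "\<exists>R. (\<forall>j\<ge>N. coeff R j = 0) \<and> (\<forall>i<N. pairing (p i) (A i) (B i) R = b i)"
proof -
  let ?M = "cmat N p A B" and ?d = "cdet N p A B"
  define v where "v = (1 / ?d) \<cdot>\<^sub>v (adj_mat ?M *\<^sub>v Matrix.vec N b)"
  have adj: "adj_mat ?M \<in> carrier_mat N N" "?M * adj_mat ?M = ?d \<cdot>\<^sub>m 1\<^sub>m N"
    using adj_mat[OF cmat_carrier[of N p A B]] by (auto simp: det_cmat)
  have vc: "v \<in> carrier_vec N" using adj by (auto simp: v_def)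
  have "?M *\<^sub>v v = (1 / ?d) \<cdot>\<^sub>v (?M *\<^sub>v (adj_mat ?M *\<^sub>v Matrix.vec N b))"
    unfolding v_def using adj by (subst mult_mat_vec[of _ N N]) auto
  also have "?M *\<^sub>v (adj_mat ?M *\<^sub>v Matrix.vec N b) = (?M * adj_mat ?M) *\<^sub>v Matrix.vec N b"
    using adj by (subst assoc_mult_mat_vec[of _ N N _ N]) auto
  also have "\<dots> = ?d \<cdot>\<^sub>v Matrix.vec N b"
    unfolding adj(2) by (rule eq_vecI) (auto simp: row_smult)
  also have "(1 / ?d) \<cdot>\<^sub>v (?d \<cdot>\<^sub>v Matrix.vec N b) = Matrix.vec N b"
    using assms by (intro eq_vecI) auto
  finally have Mv: "?M *\<^sub>v v = Matrix.vec N b" .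
  define R where "R = (\<Sum>j<N. monom (vec_index v j) j)"
  have cR: "coeff R j = (if j < N then vec_index v j else 0)" for j
    by (auto simp: R_def coeff_sum coeff_monom if_distrib cong: if_cong)
  then have R: "\<forall>j\<ge>N. coeff R j = 0" by simp
  have "Matrix.vec N (coeff R) = v" using vc cR by (intro eq_vecI) auto
  with cmat_mult_coeffs[OF R, of p A B] Mv
  have "Matrix.vec N (\<lambda>i. pairing (p i) (A i) (B i) R) = Matrix.vec N b" by simp
  then have *: "vec_index (Matrix.vec N (\<lambda>i. pairing (p i) (A i) (B i) R)) i = vec_index (Matrix.vec N b) i" for i
    by simp
  have "pairing (p i) (A i) (B i) R = b i" if "i < N" for i
    using *[of i] that by simp
  with R show ?thesis by blast
qed

lemma annihilator_exists:
  assumes "cdet N p A B \<noteq> 0"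
  obtains Q where "annihilator N p A B Q"
proof -
  obtain R where R: "\<forall>j\<ge>N. coeff R j = 0"
    and null: "\<forall>i<N. pairing (p i) (A i) (B i) R = - (A i * p i ^ N + B i * (- p i) ^ N)"
    using pairing_solve[OF assms, where b = "\<lambda>i. - (A i * p i ^ N + B i * (- p i) ^ N)"] by blast
  have "annihilator N p A B (monom 1 N + R)"
    using R null by (simp add: annihilator_def pairing_simps)
  then show ?thesis by (rule that)
qed

lemma annihilator_unique:
  assumes "cdet N p A B \<noteq> 0" "annihilator N p A B Q" "annihilator N p A B R"
  shows "Q = R"
proof -
  have "Q - R = 0"
  proof (rule pairing_nondegenerate[OF assms(1)])
    show "\<forall>j\<ge>N. coeff (Q - R) j = 0"
    proof (intro allI impI)
      fix j assume "N \<le> j"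
      then show "coeff (Q - R) j = 0"
        using assms(2,3) by (cases "j = N") (auto simp: annihilator_def)
    qed
    show "pairing (p i) (A i) (B i) (Q - R) = 0" if "i < N" for i
      using that assms(2,3) by (simp add: annihilator_def pairing_simps)
  qed
  then show ?thesis by simp
qed

lemma uminus_uminus_fun: "- (- B) = (B :: 'a \<Rightarrow> 'b :: group_add)"
  by (simp add: fun_eq_iff)

section \<open>Bordered determinants and values of the annihilator\<close>

lemma cdet_cong:
  assumes "\<And>i. i < N \<Longrightarrow> p i = p' i" "\<And>i. i < N \<Longrightarrow> A i = A' i" "\<And>i. i < N \<Longrightarrow> B i = B' i"
  shows "cdet N p A B = cdet N p' A' B'"
  unfolding cdet_def cmat_def using assms by (intro arg_cong[of _ _ Determinant.det] eq_matI) auto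

lemma cdet_permutations:
  "cdet N p A B = (\<Sum>\<pi> | \<pi> permutes {0..<N}.
     signof \<pi> * (\<Prod>i=0..<N. A i * p i ^ \<pi> i + B i * (- p i) ^ \<pi> i))"
proof -
  have "Matrix.mat N N (\<lambda>(i, j). A i * p i ^ j + B i * (- p i) ^ j) $$ (i, \<pi> i)
      = A i * p i ^ \<pi> i + B i * (- p i) ^ \<pi> i" if "\<pi> permutes {0..<N}" "i < N" for i \<pi>
    using that permutes_in_image[OF that(1), of i] by simp
  then show ?thesis
    unfolding cdet_def cmat_def by (subst det_def'[of _ N]) (auto intro!: sum.cong prod.cong)
qed

lemma cdet_scale_rows:
  "cdet N p (\<lambda>i. c i * A i) (\<lambda>i. c i * B i) = (\<Prod>i<N. c i) * cdet N p A B"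
proof -
  have "(\<Prod>i=0..<N. c i * A i * p i ^ \<pi> i + c i * B i * (- p i) ^ \<pi> i)
      = (\<Prod>i=0..<N. c i) * (\<Prod>i=0..<N. A i * p i ^ \<pi> i + B i * (- p i) ^ \<pi> i)" for \<pi>
    unfolding prod.distrib[symmetric] by (simp add: distrib_left mult.assoc)
  then show ?thesis
    unfolding cdet_permutations
    by (simp add: sum_distrib_left mult.left_commute atLeast0LessThan)
qed

text \<open>Multiplying the last column by the coefficients of the annihilator clears all its entries
  but the last.\<close>

lemma cdet_bordered:
  assumes Q: "annihilator N p A B Q"
  shows "cdet (Suc N) (p(N := pe)) (A(N := al)) (B(N := be)) = cdet N p A B * pairing pe al be Q"
proof -
  let ?p = "p(N := pe)" and ?A = "A(N := al)" and ?B = "B(N := be)"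
  let ?M = "cmat (Suc N) ?p ?A ?B"
  let ?v = "Matrix.vec (Suc N) (coeff Q)"
  have Q': "\<forall>j\<ge>Suc N. coeff Q j = 0" using Q by (auto simp: annihilator_def)
  have Mv: "?M *\<^sub>v ?v = Matrix.vec (Suc N) (\<lambda>i. if i = N then pairing pe al be Q else 0)"
    unfolding cmat_mult_coeffs[OF Q'] using Q by (intro eq_vecI) (auto simp: annihilator_def)
  have "Determinant.det (replace_col ?M (?M *\<^sub>v ?v) N) = vec_index ?v N * Determinant.det ?M"
    by (rule cramer_lemma_mat[OF cmat_carrier]) auto
  \<comment> \<open>The last entry of \<open>?v\<close> is the leading coefficient 1 of
    \<open>Q\<close>, so the factor in Cramer's rule disappears.\<close>
  then have 1: "cdet (Suc N) ?p ?A ?B = Determinant.det (replace_col ?M (?M *\<^sub>v ?v) N)"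
    using Q by (simp add: det_cmat annihilator_def)
  have "replace_col ?M (?M *\<^sub>v ?v) N = four_block_mat (cmat N p A B) (0\<^sub>m N 1)
      (Matrix.mat 1 N (\<lambda>(i, j). al * pe ^ j + be * (- pe) ^ j)) (Matrix.mat 1 1 (\<lambda>_. pairing pe al be Q))"
    unfolding replace_col_def Mv
    by (intro eq_matI) (auto simp: cmat_def four_block_mat_def less_Suc_eq)
  moreover have "Determinant.det \<dots> = Determinant.det (cmat N p A B)
      * Determinant.det (Matrix.mat 1 1 (\<lambda>_. pairing pe al be Q))"
    by (rule det_four_block_mat_upper_right_zero_col) auto
  ultimately show ?thesis
    unfolding 1 by (simp add: det_single det_cmat)
qed

text \<open>Both \<open>Q\<close> and \<open>z Qs\<close> are annihilated by the old rows, the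
  latter because multiplication by \<open>z\<close> flips the sign of \<open>B\<close>. The multiple
  of \<open>Q\<close> is chosen so that the new row vanishes as well, and \<open>z Qs\<close> makes
  the result monic of degree \<open>Suc N\<close>.\<close>

lemma annihilator_bordered:
  assumes Q: "annihilator N p A B Q" and Qs: "annihilator N p A (- B) Qs"
    and h: "pairing pe al be Q \<noteq> 0"
  shows "annihilator (Suc N) (p(N := pe)) (A(N := al)) (B(N := be))
    (pCons 0 Qs - Polynomial.smult (pe * pairing pe al (- be) Qs / pairing pe al be Q) Q)"
  using assms by (auto simp: annihilator_def pairing_simps less_Suc_eq coeff_pCons split: nat.split)

text \<open>Subtracting \<open>w\<close> times each column from the next one turns the row of powers of \<open>w\<close> into
  \<open>(1, 0, ..., 0)\<close>.\<close>

lemma cdet_christoffel: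
  "cdet (Suc N) (p(N := w)) (A(N := 1)) (B(N := 0))
    = (-1) ^ N * cdet N p (\<lambda>i. A i * (p i - w)) (\<lambda>i. B i * (- p i - w))"
proof -
  let ?M = "cmat (Suc N) (p(N := w)) (A(N := 1)) (B(N := 0))"
  let ?U = "Matrix.mat (Suc N) (Suc N) (\<lambda>(i, j). if i = j then 1 else if Suc i = j then - w else 0)"
  let ?P = "?M * ?U"
  have U: "?U \<in> carrier_mat (Suc N) (Suc N)" by simp
  have "Determinant.det ?U = prod_list (diag_mat ?U)"
    by (rule det_upper_triangular[OF _ U]) (auto simp: upper_triangular_def)
  also have "diag_mat ?U = map (\<lambda>_. 1) [0..<Suc N]"
    unfolding diag_mat_def by (rule map_cong) auto
  also have "prod_list \<dots> = (1::complex)" by (induction N) auto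
  finally have P: "Determinant.det ?P = cdet (Suc N) (p(N := w)) (A(N := 1)) (B(N := 0))"
    using det_mult[OF cmat_carrier U] by (simp add: det_cmat)
  have ent: "?P $$ (i, j) = (if j = 0 then ?M $$ (i, 0) else ?M $$ (i, j) - w * ?M $$ (i, j - 1))"
    if "i < Suc N" "j < Suc N" for i j
  proof -
    have "?P $$ (i, j) = (\<Sum>k<Suc N. ?M $$ (i, k) * (if k = j then 1 else if Suc k = j then - w else 0))"
      using that by (simp add: cmat_def scalar_prod_def atLeast0LessThan)
    also have "\<dots> = (\<Sum>k<Suc N. (if k = j then ?M $$ (i, k) else 0)
        + (if Suc k = j then - w * ?M $$ (i, k) else 0))"
      by (rule sum.cong) auto
    also have "\<dots> = ?M $$ (i, j) + (\<Sum>k<Suc N. if Suc k = j then - w * ?M $$ (i, k) else 0)"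
      using that by (simp add: sum.distrib del: sum.lessThan_Suc)
    also have "(\<Sum>k<Suc N. if Suc k = j then - w * ?M $$ (i, k) else 0)
        = (if j = 0 then 0 else - w * ?M $$ (i, j - 1))"
    proof (cases j)
      case (Suc j')
      then show ?thesis using that by (simp del: sum.lessThan_Suc)
    qed simp
    finally show ?thesis by (cases "j = 0") (simp_all del: fun_upd_apply)
  qed
  have Pc: "?P \<in> carrier_mat (Suc N) (Suc N)" by (rule mult_carrier_mat[OF cmat_carrier U])
  \<comment> \<open>The last row of \<open>?P\<close> is now \<open>(1, 0, ..., 0)\<close>, so a
    single cofactor survives; its position \<open>(N, 0)\<close> yields the sign
    \<open>(-1) ^ N\<close>.\<close>
  have "Determinant.det ?P = (\<Sum>j<Suc N. ?P $$ (N, j) * cofactor ?P N j)"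
    by (rule laplace_expansion_row[OF Pc]) simp
  also have "\<dots> = (\<Sum>j<Suc N. if j = 0 then cofactor ?P N 0 else 0)"
  proof (rule sum.cong[OF refl])
    fix j assume j: "j \<in> {..<Suc N}"
    then show "?P $$ (N, j) * cofactor ?P N j = (if j = 0 then cofactor ?P N 0 else 0)"
      using ent[of N j] by (cases j) (simp_all add: cmat_def)
  qed
  also have "\<dots> = cofactor ?P N 0" by simp
  also have "mat_delete ?P N 0 = cmat N p (\<lambda>i. A i * (p i - w)) (\<lambda>i. B i * (- p i - w))"
  proof (rule eq_matI, goal_cases)
    case (1 i j)
    then have ij: "i < N" "j < N" by (auto simp: cmat_def)
    have "mat_delete ?P N 0 $$ (i, j) = ?P $$ (i, Suc j)"
      using ij Pc by (simp add: mat_delete_def cmat_def)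
    also have "\<dots> = ?M $$ (i, Suc j) - w * ?M $$ (i, j)" using ent[of i "Suc j"] ij by simp
    finally show ?case using ij by (simp add: cmat_def algebra_simps)
  qed (use Pc in \<open>auto simp: cmat_def mat_delete_def\<close>)
  then have "cofactor ?P N 0 = (-1) ^ N * cdet N p (\<lambda>i. A i * (p i - w)) (\<lambda>i. B i * (- p i - w))"
    by (simp add: cofactor_def det_cmat)
  finally show ?thesis using P by simp
qed

text \<open>Both sides compute the determinant bordered by the powers of \<open>w\<close>: column
  operations give the factors \<open>p i - w\<close> and \<open>- p i - w\<close>, while elimination
  with the annihilator gives \<open>poly Q w\<close>. This is Christoffel's formula in finite
  form.\<close>

lemma cdet_factor:
  assumes Q: "annihilator N p A B Q"
  shows "cdet N p (\<lambda>i. A i * (p i - w)) (\<lambda>i. B i * (- p i - w)) = (-1) ^ N * cdet N p A B * poly Q w"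
proof -
  have "(-1) ^ N * cdet N p (\<lambda>i. A i * (p i - w)) (\<lambda>i. B i * (- p i - w)) = cdet N p A B * poly Q w"
    using cdet_christoffel[of N p w A B] cdet_bordered[OF Q, of w 1 0] by (simp add: pairing_def)
  then have "(-1) ^ N * ((-1) ^ N * cdet N p (\<lambda>i. A i * (p i - w)) (\<lambda>i. B i * (- p i - w)))
    = (-1) ^ N * (cdet N p A B * poly Q w)" by simp
  then show ?thesis by (simp add: mult.assoc[symmetric] power_mult_distrib[symmetric])
qed

text \<open>At \<open>w = 0\<close> the factors become \<open>p i\<close> and \<open>- p i\<close>:
  they rescale each row and flip the sign of \<open>B\<close>, which produces the starred
  determinant.\<close>

lemma annihilator_at_0:
  assumes Q: "annihilator N p A B Q"
  shows "(\<Prod>i<N. p i) * cdet N p A (- B) = (-1) ^ N * cdet N p A B * coeff Q 0"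
proof -
  have "(\<Prod>i<N. p i) * cdet N p A (- B) = cdet N p (\<lambda>i. p i * A i) (\<lambda>i. p i * (- B) i)"
    by (rule cdet_scale_rows[symmetric])
  also have "\<dots> = cdet N p (\<lambda>i. A i * (p i - 0)) (\<lambda>i. B i * (- p i - 0))"
    by (rule cdet_cong) auto
  also have "\<dots> = (-1) ^ N * cdet N p A B * coeff Q 0"
    using cdet_factor[OF Q, of 0] by (simp add: poly_0_coeff_0)
  finally show ?thesis .
qed

text \<open>The identity at 0, used for \<open>B\<close> and for \<open>- B\<close>, contains the
  same product of the \<open>p i\<close> and the same sign. Both cancel in the quotient and leave
  the square of a ratio of determinants, which will become a pure phase.\<close>

lemma annihilator_const_ratio:
  assumes Q: "annihilator N p A B Q" and Qs: "annihilator N p A (- B) Qs"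
    and p: "\<And>i. i < N \<Longrightarrow> p i \<noteq> 0"
    and D: "cdet N p A B \<noteq> 0" and Ds: "cdet N p A (- B) \<noteq> 0"
  shows "coeff Q 0 \<noteq> 0" "coeff Qs 0 \<noteq> 0"
    "coeff Q 0 / coeff Qs 0 = (cdet N p A (- B) / cdet N p A B)\<^sup>2"
proof -
  have P: "(\<Prod>i<N. p i) \<noteq> 0" using p by auto
  note e = annihilator_at_0[OF Q]
  have es: "(\<Prod>i<N. p i) * cdet N p A B = (-1) ^ N * cdet N p A (- B) * coeff Qs 0"
    using annihilator_at_0[OF Qs] by (simp only: uminus_uminus_fun)
  show nz: "coeff Q 0 \<noteq> 0"
    using e P Ds by (intro notI) simp
  show nzs: "coeff Qs 0 \<noteq> 0"
    using es P D by (intro notI) simp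
  let ?P = "\<Prod>i<N. p i" and ?s = "(-1) ^ N :: complex"
  let ?D = "cdet N p A B" and ?Ds = "cdet N p A (- B)"
  have "?P * (?s * (?Ds\<^sup>2 * coeff Qs 0)) = (?P * ?Ds) * (?s * ?Ds * coeff Qs 0)"
    by (simp add: power2_eq_square)
  also have "\<dots> = ?P * (?s * (?D\<^sup>2 * coeff Q 0))"
    unfolding es[symmetric] unfolding e by (simp add: power2_eq_square)
  finally have "?Ds\<^sup>2 * coeff Qs 0 = ?D\<^sup>2 * coeff Q 0" using P by simp
  then show "coeff Q 0 / coeff Qs 0 = (?Ds / ?D)\<^sup>2"
    using nzs D by (simp add: power_divide frac_eq_eq mult.commute)
qed

text \<open>Row factors \<open>1 + a * p i\<close>, \<open>1 - a * p i\<close> amount to evaluating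
  the annihilator at \<open>w = - 1 / a\<close>. The annihilator of the bordered system is
  \<open>z Qs - r Q\<close>; evaluated at \<open>w\<close>, its two terms become the two summands on
  the right.\<close>

lemma cdet_three_term:
  fixes a :: complex
  assumes D: "cdet N p A B \<noteq> 0" and Ds: "cdet N p A (- B) \<noteq> 0"
    and X: "cdet (Suc N) (p(N := pe)) (A(N := al)) (B(N := be)) \<noteq> 0"
  defines "A1 \<equiv> \<lambda>i. A i * (1 + a * p i)" and "B1 \<equiv> \<lambda>i. B i * (1 - a * p i)"
  shows "cdet (Suc N) (p(N := pe)) (A1(N := al * (1 + a * pe))) (B1(N := be * (1 - a * pe))) * cdet N p A (- B)
    = cdet (Suc N) (p(N := pe)) (A(N := al)) (B(N := be)) * cdet N p A1 (- B1)
      + a * pe * cdet (Suc N) (p(N := pe)) (A(N := al)) ((- B)(N := - be)) * cdet N p A1 B1"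
\<comment> \<open>The point \<open>- 1 / a\<close> is meaningful only for
  \<open>a \<noteq> 0\<close>; for \<open>a = 0\<close> the row factors are 1 and the last summand
  vanishes.\<close>
proof (cases "a = 0")
  case True
  then show ?thesis by (simp add: A1_def B1_def)
next
  case False
  obtain Q where Q: "annihilator N p A B Q" using annihilator_exists[OF D] .
  obtain Qs where Qs: "annihilator N p A (- B) Qs" using annihilator_exists[OF Ds] .
  let ?p = "p(N := pe)" and ?A = "A(N := al)" and ?B = "B(N := be)"
  define h where "h = pairing pe al be Q"
  define hs where "hs = pairing pe al (- be) Qs"
  have bord: "cdet (Suc N) ?p ?A ?B = cdet N p A B * h"
    unfolding h_def by (rule cdet_bordered[OF Q])
  have bords: "cdet (Suc N) ?p ?A ((- B)(N := - be)) = cdet N p A (- B) * hs"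
    unfolding hs_def by (rule cdet_bordered[OF Qs])
  have h: "h \<noteq> 0" using X bord by auto
  define w where "w = - 1 / a"
  have aw: "a * w = - 1" using False by (simp add: w_def)
  then have awz: "a * (w * z) = - z" for z by (simp add: mult.assoc[symmetric])
  have shift: "cdet M q (\<lambda>i. A' i * (1 + a * q i)) (\<lambda>i. B' i * (1 - a * q i))
      = (- a) ^ M * cdet M q A' B' * poly R w" if "annihilator M q A' B' R" for M q A' B' R
  proof -
    have "cdet M q (\<lambda>i. A' i * (1 + a * q i)) (\<lambda>i. B' i * (1 - a * q i))
       = cdet M q (\<lambda>i. a * (A' i * (q i - w))) (\<lambda>i. a * (B' i * (- q i - w)))"
      by (intro cdet_cong) (auto simp: algebra_simps awz)
    also have "\<dots> = a ^ M * cdet M q (\<lambda>i. A' i * (q i - w)) (\<lambda>i. B' i * (- q i - w))"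
      by (simp add: cdet_scale_rows)
    also have "\<dots> = (- a) ^ M * cdet M q A' B' * poly R w"
      unfolding cdet_factor[OF that] by (simp add: power_minus[of a])
    finally show ?thesis .
  qed
  have 1: "cdet N p A1 B1 = (- a) ^ N * cdet N p A B * poly Q w"
    unfolding A1_def B1_def by (rule shift[OF Q])
  have 2: "cdet N p A1 (- B1) = (- a) ^ N * cdet N p A (- B) * poly Qs w"
    using shift[OF Qs] by (simp add: A1_def B1_def fun_Compl_def)
  have "cdet (Suc N) ?p (A1(N := al * (1 + a * pe))) (B1(N := be * (1 - a * pe)))
     = cdet (Suc N) ?p (\<lambda>i. ?A i * (1 + a * ?p i)) (\<lambda>i. ?B i * (1 - a * ?p i))"
    by (rule cdet_cong) (auto simp: A1_def B1_def)
  also have "\<dots> = (- a) ^ Suc N * (cdet N p A B * h) * poly (pCons 0 Qs - Polynomial.smult (pe * hs / h) Q) w"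
    using shift[OF annihilator_bordered[OF Q Qs]] h bord by (simp add: h_def hs_def)
  also have "\<dots> = (- a) ^ N * cdet N p A B * (- (a * w) * poly Qs w * h + a * pe * hs * poly Q w)"
    using h by (simp add: algebra_simps)
  finally have 3: "cdet (Suc N) ?p (A1(N := al * (1 + a * pe))) (B1(N := be * (1 - a * pe)))
     = (- a) ^ N * cdet N p A B * (poly Qs w * h + a * pe * hs * poly Q w)"
    by (simp add: aw)
  show ?thesis unfolding 1 2 3 bord bords by (simp add: algebra_simps)
qed

section \<open>Logarithmic derivatives\<close>

lemma has_vector_derivative_transform_ev:
  assumes "(f has_vector_derivative D) (at x)" "\<forall>\<^sub>F s in nhds x. f s = g s"
  shows "(g has_vector_derivative D) (at x)"
  using assms has_vector_derivative_cong_ev[of UNIV f g x D] eventually_nhds_x_imp_x[OF assms(2)]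
  by simp

lemma has_vector_derivative_quotient:
  fixes f g :: "real \<Rightarrow> 'a :: real_normed_field"
  assumes "(f has_vector_derivative f') (at x)" "(g has_vector_derivative g') (at x)" "g x \<noteq> 0"
  shows "((\<lambda>s. f s / g s) has_vector_derivative (f' * g x - f x * g') / (g x * g x)) (at x)"
  using has_derivative_divide'[OF assms(1,2)[unfolded has_vector_derivative_def] assms(3)]
  by (simp add: has_vector_derivative_def divide_inverse flip: scaleR_diff_right)

lemma has_vector_derivative_eventually_nonzero:
  fixes f :: "real \<Rightarrow> 'a :: real_normed_field"
  assumes "(f has_vector_derivative f') (at x)" "f x \<noteq> 0"
  shows "\<forall>\<^sub>F s in nhds x. f s \<noteq> 0"
proof -
  have "isCont f x" using assms(1) has_vector_derivative_continuous by blast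
  then have "(f \<longlongrightarrow> f x) (nhds x)" by (simp add: continuous_at tendsto_at_iff_tendsto_nhds)
  then show ?thesis using assms(2) by (rule tendsto_imp_eventually_ne)
qed

section \<open>Jacobi's formula and the derivatives in x, t and y\<close>

lemma det_has_vector_derivative:
  fixes m :: "real \<Rightarrow> nat \<Rightarrow> nat \<Rightarrow> complex"
  assumes "\<And>i j. i < N \<Longrightarrow> j < N \<Longrightarrow> ((\<lambda>s. m s i j) has_vector_derivative m' i j) (at x)"
  shows "((\<lambda>s. Determinant.det (Matrix.mat N N (\<lambda>(i, j). m s i j))) has_vector_derivative
    (\<Sum>k<N. Determinant.det (Matrix.mat N N (\<lambda>(i, j). if j = k then m' i j else m x i j)))) (at x)"
proof -
  let ?\<Pi> = "{\<pi>. \<pi> permutes {0..<N}}"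
  have det: "Determinant.det (Matrix.mat N N (\<lambda>(i, j). f i j))
      = (\<Sum>\<pi>\<in>?\<Pi>. signof \<pi> * (\<Prod>j<N. f (\<pi> j) j))" for f :: "nat \<Rightarrow> nat \<Rightarrow> complex"
  proof -
    have "Matrix.mat N N (\<lambda>(i, j). f i j) $$ (\<pi> j, j) = f (\<pi> j) j"
      if "\<pi> permutes {0..<N}" "j < N" for j \<pi>
      using that permutes_in_image[OF that(1), of j] by simp
    then show ?thesis by (subst det_col[of _ N]) (auto intro!: sum.cong prod.cong)
  qed
  have prod: "((\<lambda>s. \<Prod>j<N. m s (\<pi> j) j) has_vector_derivative
      (\<Sum>k<N. \<Prod>j<N. if j = k then m' (\<pi> j) j else m x (\<pi> j) j)) (at x)" if "\<pi> \<in> ?\<Pi>" for \<pi>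
  proof -
    have lt: "\<pi> j < N" if "j < N" for j
      using \<open>\<pi> \<in> ?\<Pi>\<close> permutes_in_image[of \<pi> "{0..<N}" j] that by simp
    have "((\<lambda>s. \<Prod>j<N. m s (\<pi> j) j) has_derivative
       (\<lambda>y. \<Sum>k<N. (y *\<^sub>R m' (\<pi> k) k) * (\<Prod>j\<in>{..<N} - {k}. m x (\<pi> j) j))) (at x)"
      using assms lt by (intro has_derivative_prod) (auto simp: has_vector_derivative_def)
    moreover have "(\<Prod>j<N. if j = k then m' (\<pi> j) j else m x (\<pi> j) j)
        = m' (\<pi> k) k * (\<Prod>j\<in>{..<N} - {k}. m x (\<pi> j) j)" if "k < N" for k
      using that by (subst prod.remove[of _ k]) (auto intro!: prod.cong)
    ultimately show ?thesis
      by (simp add: has_vector_derivative_def scaleR_sum_right)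
  qed
  have "((\<lambda>s. \<Sum>\<pi>\<in>?\<Pi>. signof \<pi> * (\<Prod>j<N. m s (\<pi> j) j)) has_vector_derivative
      (\<Sum>\<pi>\<in>?\<Pi>. signof \<pi> * (\<Sum>k<N. \<Prod>j<N. if j = k then m' (\<pi> j) j else m x (\<pi> j) j))) (at x)"
    by (intro has_vector_derivative_sum has_vector_derivative_mult_right prod)
  moreover have "(\<Sum>\<pi>\<in>?\<Pi>. signof \<pi> * (\<Sum>k<N. \<Prod>j<N. if j = k then m' (\<pi> j) j else m x (\<pi> j) j))
      = (\<Sum>k<N. \<Sum>\<pi>\<in>?\<Pi>. signof \<pi> * (\<Prod>j<N. if j = k then m' (\<pi> j) j else m x (\<pi> j) j))"
    unfolding sum_distrib_left by (rule sum.swap)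
  ultimately show ?thesis unfolding det by simp
qed

text \<open>Jacobi's formula: if differentiating the rows replaces the column of \<open>z ^ j\<close> by that of \<open>R j\<close>, then
  Cramer's rule turns the logarithmic derivative into a trace.\<close>

lemma cdet_has_derivative:
  assumes A: "\<And>i. i < N \<Longrightarrow> ((\<lambda>s. A s i) has_vector_derivative A' i) (at x)"
    and B: "\<And>i. i < N \<Longrightarrow> ((\<lambda>s. B s i) has_vector_derivative B' i) (at x)"
    and R: "\<And>j. j < N \<Longrightarrow> \<forall>k\<ge>N. coeff (R j) k = 0"
    and pair: "\<And>i j. i < N \<Longrightarrow> j < N \<Longrightarrow>
      A' i * p i ^ j + B' i * (- p i) ^ j = pairing (p i) (A x i) (B x i) (R j)"
  shows "((\<lambda>s. cdet N p (A s) (B s)) has_vector_derivative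
    cdet N p (A x) (B x) * (\<Sum>k<N. coeff (R k) k)) (at x)"
proof -
  have "((\<lambda>s. cdet N p (A s) (B s)) has_vector_derivative
    (\<Sum>k<N. Determinant.det (Matrix.mat N N (\<lambda>(i, j). if j = k
       then A' i * p i ^ j + B' i * (- p i) ^ j else A x i * p i ^ j + B x i * (- p i) ^ j)))) (at x)"
    unfolding cdet_def cmat_def
    by (rule det_has_vector_derivative) (auto intro!: derivative_eq_intros A B)
  moreover have "Determinant.det (Matrix.mat N N (\<lambda>(i, j). if j = k
       then A' i * p i ^ j + B' i * (- p i) ^ j else A x i * p i ^ j + B x i * (- p i) ^ j))
    = coeff (R k) k * cdet N p (A x) (B x)" if k: "k < N" for k
  proof -
    let ?M = "cmat N p (A x) (B x)"
    have "Matrix.mat N N (\<lambda>(i, j). if j = k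
       then A' i * p i ^ j + B' i * (- p i) ^ j else A x i * p i ^ j + B x i * (- p i) ^ j)
      = replace_col ?M (?M *\<^sub>v Matrix.vec N (coeff (R k))) k"
      unfolding cmat_mult_coeffs[OF R[OF k]] replace_col_def
      using pair[OF _ k] by (intro eq_matI) (auto simp: cmat_def)
    then show ?thesis
      using cramer_lemma_mat[OF cmat_carrier vec_carrier k, of p "A x" "B x" "coeff (R k)"] k
      by (simp add: det_cmat)
  qed
  ultimately show ?thesis by (simp add: sum_distrib_left mult.commute)
qed

lemma annihilator_coeffs:
  assumes "annihilator N p A B Q"
  shows "coeff Q N = 1" "j > N \<Longrightarrow> coeff Q j = 0" "i < N \<Longrightarrow> pairing (p i) (A i) (B i) Q = 0"
  using assms by (auto simp: annihilator_def)

text \<open>Differentiation turns the column of \<open>z ^ j\<close> into that of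
  \<open>z ^ Suc j\<close>. Only the last column leaves the range of degrees below \<open>N\<close>,
  and reducing it by \<open>Q\<close> puts minus the subleading coefficient on the diagonal.\<close>

lemma cdet_deriv_x:
  assumes A: "\<And>i. i < N \<Longrightarrow> ((\<lambda>s. A s i) has_vector_derivative p i * A x i) (at x)"
    and B: "\<And>i. i < N \<Longrightarrow> ((\<lambda>s. B s i) has_vector_derivative - p i * B x i) (at x)"
    and Q: "annihilator N p (A x) (B x) Q"
  shows "((\<lambda>s. cdet N p (A s) (B s)) has_vector_derivative
    cdet N p (A x) (B x) * (- top_coeff N Q 1)) (at x)"
proof -
  define R where "R j = monom 1 (Suc j) - (if Suc j = N then Q else 0)" for j
  have "((\<lambda>s. cdet N p (A s) (B s)) has_vector_derivative
    cdet N p (A x) (B x) * (\<Sum>k<N. coeff (R k) k)) (at x)"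
  proof (rule cdet_has_derivative[OF A B])
    show "\<forall>k\<ge>N. coeff (R j) k = 0" if "j < N" for j
      using annihilator_coeffs[OF Q] that by (auto simp: R_def le_less)
    show "p i * A x i * p i ^ j + - p i * B x i * (- p i) ^ j = pairing (p i) (A x i) (B x i) (R j)"
      if "i < N" for i j
      using annihilator_coeffs(3)[OF Q that] by (simp add: R_def pairing_simps)
  qed
  moreover have "(\<Sum>k<N. coeff (R k) k) = - top_coeff N Q 1"
    by (cases N) (auto simp: R_def top_coeff_def)
  ultimately show ?thesis by simp
qed

text \<open>The trace of multiplication by \<open>z\<^sup>3\<close> on the polynomials modulo the annihilated ones.\<close>

definition trace_t :: "nat \<Rightarrow> complex poly \<Rightarrow> complex poly \<Rightarrow> complex" where
  "trace_t N Q Qs = - 2 * top_coeff N Q 3 - top_coeff N Qs 3 + top_coeff N Qs 1 * top_coeff N Q 2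
     + top_coeff N Q 1 * top_coeff N Qs 2 + top_coeff N Q 1 * top_coeff N Q 2
     - (top_coeff N Q 1)\<^sup>2 * top_coeff N Qs 1"

text \<open>The column of \<open>z ^ j\<close> becomes that of \<open>z ^ (j + 3)\<close> times -4.
  Three columns exceed the admissible degree and are reduced by \<open>Q\<close>,
  \<open>z Qs\<close> and \<open>z^2 Q\<close>, the annihilated polynomials of degree
  \<open>N\<close>, \<open>N + 1\<close>, \<open>N + 2\<close>. This brings \<open>Qs\<close> into
  the trace.\<close>

lemma cdet_deriv_t:
  assumes A: "\<And>i. i < N \<Longrightarrow> ((\<lambda>s. A s i) has_vector_derivative - 4 * p i ^ 3 * A x i) (at x)"
    and B: "\<And>i. i < N \<Longrightarrow> ((\<lambda>s. B s i) has_vector_derivative 4 * p i ^ 3 * B x i) (at x)"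
    and Q: "annihilator N p (A x) (B x) Q" and Qs: "annihilator N p (A x) (- B x) Qs"
  shows "((\<lambda>s. cdet N p (A s) (B s)) has_vector_derivative
    cdet N p (A x) (B x) * (- 4 * trace_t N Q Qs)) (at x)"
proof -
  define zQs where "zQs = pCons 0 Qs"
  define zzQ where "zzQ = pCons 0 (pCons 0 Q)"
  define q where "q = top_coeff N Q"
  define qs where "qs = top_coeff N Qs"
  \<comment> \<open>Each \<open>C j\<close> is the annihilated polynomial whose part of degree at
    least \<open>N\<close> is exactly \<open>z ^ (j + 3)\<close>. The multiples \<open>qs 1\<close>,
    \<open>q 1\<close> and \<open>q 2 - q 1 * qs 1\<close> cancel the coefficients between that
    power and degree \<open>N\<close>, including degree \<open>N\<close> itself.\<close>
  define C where "C j = (if j + 3 = N then Q else if j + 2 = N then zQs - Polynomial.smult (qs 1) Q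
      else if j + 1 = N then zzQ - Polynomial.smult (q 1) zQs - Polynomial.smult (q 2 - q 1 * qs 1) Q else 0)" for j
  define R where "R j = Polynomial.smult (- 4) (monom 1 (j + 3) - C j)" for j
  note cQ = annihilator_coeffs[OF Q] and cQs = annihilator_coeffs[OF Qs]
  have "((\<lambda>s. cdet N p (A s) (B s)) has_vector_derivative
    cdet N p (A x) (B x) * (\<Sum>k<N. coeff (R k) k)) (at x)"
  proof (rule cdet_has_derivative[OF A B])
    have null: "pairing (p i) (A x i) (B x i) (C j) = 0" if "i < N" for i j
      using cQ(3)[OF that] cQs(3)[OF that] by (auto simp: C_def zQs_def zzQ_def pairing_simps)
    show "- 4 * p i ^ 3 * A x i * p i ^ j + 4 * p i ^ 3 * B x i * (- p i) ^ j
        = pairing (p i) (A x i) (B x i) (R j)" if "i < N" for i j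
      using null[OF that] by (simp add: R_def pairing_simps power_add algebra_simps)
    show "\<forall>k\<ge>N. coeff (R j) k = 0" if "j < N" for j
    proof (intro allI impI)
      fix k assume k: "N \<le> k"
      consider "j + 3 < N" | "j + 3 = N" | "j + 2 = N" | "j + 1 = N" using \<open>j < N\<close> by linarith
      then show "coeff (R j) k = 0"
      proof cases
        case 1
        then show ?thesis using k by (simp add: R_def C_def)
      next
        case 2
        then show ?thesis using k cQ by (cases "k = N") (auto simp: R_def C_def)
      next
        case 3
        then obtain M where M: "N = Suc M" by (cases N) auto
        consider "k = N" | "k = Suc N" | "k > Suc N" using k by linarith
        then show ?thesis
          by cases (use 3 M cQ cQs in \<open>auto simp: R_def C_def zQs_def qs_def top_coeff_def coeff_pCons
            split: nat.splits\<close>)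
      next
        case 4
        then obtain M where M: "N = Suc M" by (cases N) auto
        consider "k = N" | "k = Suc N" | "k = Suc (Suc N)" | "k > Suc (Suc N)" using k by linarith
        then show ?thesis
          by cases (use 4 M cQ cQs in \<open>auto simp: R_def C_def zQs_def zzQ_def q_def qs_def
            top_coeff_def coeff_pCons numeral_2_eq_2 split: nat.splits\<close>)
      qed
    qed
  qed
  moreover have "(\<Sum>k<N. coeff (R k) k) = - 4 * trace_t N Q Qs"
  proof -
    have diag: "coeff (R k) k = 4 * coeff (C k) k" for k by (simp add: R_def)
    \<comment> \<open>For \<open>N < 3\<close> some of the three exceptional columns do not exist.
      The formula persists because \<open>top_coeff\<close> is 0 for coefficients that are not
      there.\<close>
    consider "N = 0" | "N = 1" | "N = 2" | M where "N = Suc (Suc (Suc M))"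
      by (metis One_nat_def Suc_1 not0_implies_Suc)
    then show ?thesis
    proof cases
      case 1
      then show ?thesis by (simp add: trace_t_def top_coeff_def)
    next
      case 2
      then show ?thesis unfolding diag
        by (simp add: C_def trace_t_def top_coeff_def zQs_def zzQ_def q_def qs_def power2_eq_square algebra_simps)
    next
      case 3
      then show ?thesis unfolding diag
        by (simp add: numeral_2_eq_2 C_def trace_t_def top_coeff_def zQs_def zzQ_def q_def qs_def
          power2_eq_square algebra_simps)
    next
      case 4
      have "(\<Sum>k<M. coeff (R k) k) = 0" by (rule sum.neutral) (simp add: diag C_def 4)
      then show ?thesis
        by (simp add: 4 diag C_def trace_t_def top_coeff_def zQs_def zzQ_def q_def qs_def
          power2_eq_square algebra_simps numeral_2_eq_2 numeral_3_eq_3)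
    qed
  qed
  ultimately show ?thesis by simp
qed

text \<open>Differentiation lowers the power of \<open>z\<close> by one, so only
  \<open>z ^ 0\<close> needs a substitute for \<open>1 / z\<close>. Writing
  \<open>Qs = c + z S\<close>, division by \<open>z\<close> turns the annihilation by the rows of
  \<open>(A, - B)\<close> into the equivalence of \<open>1 / z\<close> with \<open>- S / c\<close>
  for the rows of \<open>(A, B)\<close>. The trace is the constant term of this polynomial.\<close>

lemma cdet_deriv_y:
  assumes A: "\<And>i. i < N \<Longrightarrow> ((\<lambda>s. A s i) has_vector_derivative 1 / p i * A x i) (at x)"
    and B: "\<And>i. i < N \<Longrightarrow> ((\<lambda>s. B s i) has_vector_derivative - 1 / p i * B x i) (at x)"
    and p: "\<And>i. i < N \<Longrightarrow> p i \<noteq> 0"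
    and Qs: "annihilator N p (A x) (- B x) Qs" and nz: "coeff Qs 0 \<noteq> 0"
  shows "((\<lambda>s. cdet N p (A s) (B s)) has_vector_derivative
    cdet N p (A x) (B x) * (- coeff Qs 1 / coeff Qs 0)) (at x)"
proof -
  obtain c S where S: "Qs = pCons c S" by (cases Qs)
  with nz have c: "c \<noteq> 0" by simp
  note cQs = annihilator_coeffs[OF Qs]
  define R where "R j = (if j = 0 then Polynomial.smult (- 1 / c) S else monom 1 (j - 1))" for j
  have "((\<lambda>s. cdet N p (A s) (B s)) has_vector_derivative
    cdet N p (A x) (B x) * (\<Sum>k<N. coeff (R k) k)) (at x)"
  proof (rule cdet_has_derivative[OF A B])
    show "\<forall>k\<ge>N. coeff (R j) k = 0" if "j < N" for j
      using cQs(2)[of "Suc _"] that by (auto simp: R_def S)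
    show "1 / p i * A x i * p i ^ j + - 1 / p i * B x i * (- p i) ^ j
        = pairing (p i) (A x i) (B x i) (R j)" if i: "i < N" for i j
    proof (cases j)
      case 0
      have "(A x i - B x i) * c + p i * pairing (p i) (A x i) (B x i) S = 0"
        using cQs(3)[OF i] by (simp add: S pairing_def algebra_simps)
      then have "pairing (p i) (A x i) (B x i) S = - (A x i - B x i) * c / p i"
        using p[OF i] by (simp add: field_simps eq_neg_iff_add_eq_0)
      then show ?thesis using 0 c by (simp add: R_def pairing_simps diff_divide_distrib)
    next
      case (Suc j')
      then show ?thesis using p[OF i] by (simp add: R_def pairing_simps)
    qed
  qed
  moreover have "(\<Sum>k<N. coeff (R k) k) = - coeff Qs 1 / coeff Qs 0"
  proof (cases N)
    case 0
    then show ?thesis using cQs(2)[of 1] by simp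
  next
    case (Suc M)
    have "(\<Sum>k<N. coeff (R k) k) = coeff (R 0) 0 + (\<Sum>k<M. coeff (R (Suc k)) (Suc k))"
      unfolding Suc by (rule sum.lessThan_Suc_shift)
    also have "\<dots> = - coeff Qs 1 / coeff Qs 0" by (simp add: R_def S)
    finally show ?thesis .
  qed
  ultimately show ?thesis by simp
qed

text \<open>Differentiating the condition that \<open>Q\<close> is annihilated shows that its
  derivative plus \<open>z Q\<close> is annihilated too. So the derivative agrees with
  \<open>z (Qs - Q)\<close> up to annihilated polynomials, and having degree below \<open>N\<close>
  it is fixed by subtracting the right multiple of \<open>Q\<close>.\<close>

lemma annihilator_deriv_x:
  assumes A: "\<And>i. i < N \<Longrightarrow> ((\<lambda>s. A s i) has_vector_derivative p i * A x i) (at x)"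
    and B: "\<And>i. i < N \<Longrightarrow> ((\<lambda>s. B s i) has_vector_derivative - p i * B x i) (at x)"
    and D: "cdet N p (A x) (B x) \<noteq> 0"
    and Q: "\<forall>\<^sub>F s in nhds x. annihilator N p (A s) (B s) (Q s)"
    and Qs: "annihilator N p (A x) (- B x) Qs"
  shows "((\<lambda>s. coeff (Q s) j) has_vector_derivative
    coeff (pCons 0 (Qs - Q x) + Polynomial.smult (top_coeff N (Q x) 1 - top_coeff N Qs 1) (Q x)) j) (at x)"
proof -
  let ?D = "\<lambda>s. cdet N p (A s) (B s)"
  have Qx: "annihilator N p (A x) (B x) (Q x)" using Q by (rule eventually_nhds_x_imp_x)
  have D': "(?D has_vector_derivative ?D x * - top_coeff N (Q x) 1) (at x)"
    by (rule cdet_deriv_x[OF A B Qx])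
  then have ev: "\<forall>\<^sub>F s in nhds x. ?D s \<noteq> 0"
    using D by (rule has_vector_derivative_eventually_nonzero)
  \<comment> \<open>Differentiability is established before the value is known: by Cramer's rule
    each lower coefficient is a quotient of determinants with differentiable entries.\<close>
  have low: "\<exists>c. ((\<lambda>s. coeff (Q s) j) has_vector_derivative c) (at x)" if j: "j < N" for j
  proof -
    let ?m = "\<lambda>s i k. if k = j then - (A s i * p i ^ N + B s i * (- p i) ^ N)
        else A s i * p i ^ k + B s i * (- p i) ^ k"
    let ?E = "\<lambda>s. Determinant.det (Matrix.mat N N (\<lambda>(i, k). ?m s i k))"
    let ?m' = "\<lambda>i k. if k = j then - (p i * A x i * p i ^ N + - p i * B x i * (- p i) ^ N)
        else p i * A x i * p i ^ k + - p i * B x i * (- p i) ^ k"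
    have "((\<lambda>s. ?m s i k) has_vector_derivative ?m' i k) (at x)" if "i < N" for i k
      using that by (auto intro!: derivative_eq_intros A B)
    then obtain e where e: "(?E has_vector_derivative e) (at x)"
      using det_has_vector_derivative[of N ?m ?m' x] by blast
    have "\<forall>\<^sub>F s in nhds x. ?E s / ?D s = coeff (Q s) j"
      using ev Q
    proof eventually_elim
      case (elim s)
      let ?R = "Q s - monom 1 N" and ?M = "cmat N p (A s) (B s)"
      note c = annihilator_coeffs[OF elim(2)]
      have R: "\<forall>k\<ge>N. coeff ?R k = 0" using c by (auto simp: le_less)
      have "Matrix.mat N N (\<lambda>(i, k). ?m s i k) = replace_col ?M (?M *\<^sub>v Matrix.vec N (coeff ?R)) j"
        unfolding cmat_mult_coeffs[OF R] replace_col_def using c(3)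
        by (intro eq_matI) (auto simp: cmat_def pairing_simps)
      then have "?E s = coeff (Q s) j * ?D s"
        using cramer_lemma_mat[OF cmat_carrier vec_carrier j, of p "A s" "B s" "coeff ?R"] j
        by (simp add: det_cmat)
      then show ?case using elim by simp
    qed
    moreover have "((\<lambda>s. ?E s / ?D s) has_vector_derivative
       (e * ?D x - ?E x * (?D x * - top_coeff N (Q x) 1)) / (?D x * ?D x)) (at x)"
      using e D' D by (rule has_vector_derivative_quotient)
    ultimately show ?thesis
      by (blast intro: has_vector_derivative_transform_ev)
  qed
  obtain c where c: "\<And>j. j < N \<Longrightarrow> ((\<lambda>s. coeff (Q s) j) has_vector_derivative c j) (at x)"
    using low by metis
  define R where "R = (\<Sum>j<N. monom (c j) j)"
  have cR: "coeff R j = (if j < N then c j else 0)" for j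
    by (auto simp: R_def coeff_sum if_distrib cong: if_cong)
  have der: "((\<lambda>s. coeff (Q s) j) has_vector_derivative coeff R j) (at x)" for j
  proof (cases "j < N")
    case True
    then show ?thesis using c by (simp add: cR)
  next
    case False
    have "\<forall>\<^sub>F s in nhds x. (if j = N then 1 else 0) = coeff (Q s) j"
      using Q by eventually_elim (use False in \<open>auto simp: annihilator_def\<close>)
    then have "((\<lambda>s. coeff (Q s) j) has_vector_derivative 0) (at x)"
      by (rule has_vector_derivative_transform_ev[OF has_vector_derivative_const])
    then show ?thesis using False by (simp add: cR)
  qed
  \<comment> \<open>The coefficient of degree \<open>N\<close> in \<open>z (Q - Qs)\<close> is the
    difference of the subleading coefficients; the multiple of \<open>Q\<close> removes it, so that
    nondegeneracy applies.\<close>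
  have "R + pCons 0 (Q x - Qs) - Polynomial.smult (top_coeff N (Q x) 1 - top_coeff N Qs 1) (Q x) = 0"
  proof (rule pairing_nondegenerate[OF D])
    note cQ = annihilator_coeffs[OF Qx] and cQs = annihilator_coeffs[OF Qs]
    show "\<forall>j\<ge>N. coeff (R + pCons 0 (Q x - Qs)
        - Polynomial.smult (top_coeff N (Q x) 1 - top_coeff N Qs 1) (Q x)) j = 0"
    proof (intro allI impI)
      fix j assume "N \<le> j"
      then consider "j = N" | "j = Suc N" | "j > Suc N" by linarith
      then show "coeff (R + pCons 0 (Q x - Qs)
          - Polynomial.smult (top_coeff N (Q x) 1 - top_coeff N Qs 1) (Q x)) j = 0"
        by cases (use cQ cQs in \<open>auto simp: cR top_coeff_def coeff_pCons split: nat.splits\<close>)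
    qed
    fix i assume i: "i < N"
    let ?e = "\<lambda>s j. A s i * p i ^ j + B s i * (- p i) ^ j"
    have entry: "((\<lambda>s. ?e s j) has_vector_derivative
        p i * A x i * p i ^ j + - p i * B x i * (- p i) ^ j) (at x)" for j
      using A[OF i] B[OF i] by (auto intro!: derivative_eq_intros)
    have "((\<lambda>s. \<Sum>j<Suc N. coeff (Q s) j * ?e s j) has_vector_derivative
      (\<Sum>j<Suc N. coeff (Q x) j * (p i * A x i * p i ^ j + - p i * B x i * (- p i) ^ j) + coeff R j * ?e x j)) (at x)"
      by (intro has_vector_derivative_sum has_vector_derivative_mult der entry)
    moreover have "\<forall>\<^sub>F s in nhds x. (\<Sum>j<Suc N. coeff (Q s) j * ?e s j) = 0"
      using Q
    proof eventually_elim
      case (elim s)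
      have "\<forall>j\<ge>Suc N. coeff (Q s) j = 0" using elim by (auto simp: annihilator_def)
      from pairing_sum_below[OF this, of "p i" "A s i" "B s i"] show ?case
        using annihilator_coeffs(3)[OF elim i] by simp
    qed
    ultimately have "((\<lambda>s. 0) has_vector_derivative
      (\<Sum>j<Suc N. coeff (Q x) j * (p i * A x i * p i ^ j + - p i * B x i * (- p i) ^ j) + coeff R j * ?e x j)) (at x)"
      by (rule has_vector_derivative_transform_ev)
    then have "(\<Sum>j<Suc N. coeff (Q x) j * (p i * A x i * p i ^ j + - p i * B x i * (- p i) ^ j) + coeff R j * ?e x j) = 0"
      using vector_derivative_unique_at has_vector_derivative_const by blast
    moreover have "\<forall>j\<ge>Suc N. coeff (Q x) j = 0" "\<forall>j\<ge>Suc N. coeff R j = 0"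
      using cQ cR by auto
    ultimately have "pairing (p i) (p i * A x i) (- p i * B x i) (Q x) + pairing (p i) (A x i) (B x i) R = 0"
      by (simp only: pairing_sum_below sum.distrib)
    then show "pairing (p i) (A x i) (B x i) (R + pCons 0 (Q x - Qs)
        - Polynomial.smult (top_coeff N (Q x) 1 - top_coeff N Qs 1) (Q x)) = 0"
      using cQ(3)[OF i] cQs(3)[OF i] by (simp add: pairing_simps) (simp add: pairing_def algebra_simps)
  qed
  moreover have "pCons 0 (Q x - Qs) = - pCons 0 (Qs - Q x)" by simp
  ultimately have "R = pCons 0 (Qs - Q x) + Polynomial.smult (top_coeff N (Q x) 1 - top_coeff N Qs 1) (Q x)"
    by (simp only: add_uminus_conv_diff diff_diff_eq right_minus_eq)
  with der show ?thesis by simp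
qed

section \<open>Determinants of waves\<close>

definition wave :: "complex \<Rightarrow> real \<Rightarrow> real \<Rightarrow> real \<Rightarrow> complex" where
  "wave p x t y = exp (p * of_real x - 4 * p ^ 3 * of_real t + 1 / p * of_real y)"

definition tdet :: "nat \<Rightarrow> (nat \<Rightarrow> complex) \<Rightarrow> (nat \<Rightarrow> complex) \<Rightarrow> (nat \<Rightarrow> complex)
    \<Rightarrow> real \<Rightarrow> real \<Rightarrow> real \<Rightarrow> complex" where
  "tdet N p u v x t y =
     cdet N p (\<lambda>i. u i * wave (p i) x t y) (\<lambda>i. v i * wave (- p i) x t y)"

text \<open>Wherever \<open>tdet\<close> does not vanish, the choice is forced by uniqueness. A
  total function of \<open>x\<close>, \<open>t\<close>, \<open>y\<close> is wanted because its
  coefficients are differentiated.\<close>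

definition tann :: "nat \<Rightarrow> (nat \<Rightarrow> complex) \<Rightarrow> (nat \<Rightarrow> complex) \<Rightarrow> (nat \<Rightarrow> complex)
    \<Rightarrow> real \<Rightarrow> real \<Rightarrow> real \<Rightarrow> complex poly" where
  "tann N p u v x t y = (SOME Q.
     annihilator N p (\<lambda>i. u i * wave (p i) x t y) (\<lambda>i. v i * wave (- p i) x t y) Q)"

lemma wave_deriv:
  "((\<lambda>s. wave p s t y) has_vector_derivative p * wave p x t y) (at x)"
  "((\<lambda>s. wave p x s y) has_vector_derivative - 4 * p ^ 3 * wave p x t y) (at t)"
  "((\<lambda>s. wave p x t s) has_vector_derivative 1 / p * wave p x t y) (at y)"
proof -
  have exp_lin: "((\<lambda>s. exp (f s)) has_vector_derivative c * exp (f x)) (at x)"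
    if "(f has_vector_derivative c) (at x)" for f :: "real \<Rightarrow> complex" and c x
    using field_vector_diff_chain_at[OF that DERIV_exp] by (simp add: o_def)
  show "((\<lambda>s. wave p s t y) has_vector_derivative p * wave p x t y) (at x)"
    unfolding wave_def by (rule exp_lin) (auto intro!: derivative_eq_intros)
  show "((\<lambda>s. wave p x s y) has_vector_derivative - 4 * p ^ 3 * wave p x t y) (at t)"
    unfolding wave_def by (rule exp_lin) (auto intro!: derivative_eq_intros)
  show "((\<lambda>s. wave p x t s) has_vector_derivative 1 / p * wave p x t y) (at y)"
    unfolding wave_def by (rule exp_lin) (auto intro!: derivative_eq_intros)
qed

lemma star_coeffs: "(\<lambda>i. (- v) i * wave (- p i) x t y) = - (\<lambda>i. v i * wave (- p i) x t y)"
  by (simp add: fun_eq_iff)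

lemma tdet_star:
  "tdet N p u (- v) x t y = cdet N p (\<lambda>i. u i * wave (p i) x t y) (- (\<lambda>i. v i * wave (- p i) x t y))"
  by (simp only: tdet_def star_coeffs)

lemma tann:
  assumes "tdet N p u v x t y \<noteq> 0"
  shows "annihilator N p (\<lambda>i. u i * wave (p i) x t y) (\<lambda>i. v i * wave (- p i) x t y) (tann N p u v x t y)"
proof -
  obtain Q where "annihilator N p (\<lambda>i. u i * wave (p i) x t y) (\<lambda>i. v i * wave (- p i) x t y) Q"
    using annihilator_exists[OF assms[unfolded tdet_def]] .
  then show ?thesis unfolding tann_def by (rule someI)
qed

lemma tann_star:
  assumes "tdet N p u (- v) x t y \<noteq> 0"
  shows "annihilator N p (\<lambda>i. u i * wave (p i) x t y) (- (\<lambda>i. v i * wave (- p i) x t y)) (tann N p u (- v) x t y)"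
  using tann[OF assms] by (simp only: star_coeffs)

lemma row_deriv:
  "((\<lambda>s. c * wave p s t y) has_vector_derivative p * (c * wave p x t y)) (at x)"
  "((\<lambda>s. c * wave (- p) s t y) has_vector_derivative - p * (c * wave (- p) x t y)) (at x)"
  "((\<lambda>s. c * wave p x s y) has_vector_derivative - 4 * p ^ 3 * (c * wave p x t y)) (at t)"
  "((\<lambda>s. c * wave (- p) x s y) has_vector_derivative 4 * p ^ 3 * (c * wave (- p) x t y)) (at t)"
  "((\<lambda>s. c * wave p x t s) has_vector_derivative 1 / p * (c * wave p x t y)) (at y)"
  "((\<lambda>s. c * wave (- p) x t s) has_vector_derivative - 1 / p * (c * wave (- p) x t y)) (at y)"
  by (rule has_vector_derivative_eq_rhs[OF has_vector_derivative_mult_right[OF wave_deriv(1)]],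
      simp)
    (rule has_vector_derivative_eq_rhs[OF has_vector_derivative_mult_right[OF wave_deriv(1)]]
      has_vector_derivative_eq_rhs[OF has_vector_derivative_mult_right[OF wave_deriv(2)]]
      has_vector_derivative_eq_rhs[OF has_vector_derivative_mult_right[OF wave_deriv(3)]],
      simp)+

lemma tdet_deriv_x:
  assumes "tdet N p u v x t y \<noteq> 0"
  shows "((\<lambda>s. tdet N p u v s t y) has_vector_derivative
    tdet N p u v x t y * (- top_coeff N (tann N p u v x t y) 1)) (at x)"
  unfolding tdet_def
  by (rule cdet_deriv_x[OF row_deriv(1,2) tann[OF assms]])

lemma tdet_deriv_t:
  assumes "tdet N p u v x t y \<noteq> 0" "tdet N p u (- v) x t y \<noteq> 0"
  shows "((\<lambda>s. tdet N p u v x s y) has_vector_derivative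
    tdet N p u v x t y * (- 4 * trace_t N (tann N p u v x t y) (tann N p u (- v) x t y))) (at t)"
  unfolding tdet_def
  by (rule cdet_deriv_t[OF row_deriv(3,4) tann[OF assms(1)] tann_star[OF assms(2)]])

lemma tann_const:
  assumes "tdet N p u v x t y \<noteq> 0" "tdet N p u (- v) x t y \<noteq> 0" "\<And>i. i < N \<Longrightarrow> p i \<noteq> 0"
  shows "coeff (tann N p u v x t y) 0 \<noteq> 0"
    "coeff (tann N p u (- v) x t y) 0 \<noteq> 0"
    "coeff (tann N p u v x t y) 0 / coeff (tann N p u (- v) x t y) 0
      = (tdet N p u (- v) x t y / tdet N p u v x t y)\<^sup>2"
  unfolding tdet_star unfolding tdet_def
  by (rule annihilator_const_ratio[OF tann[OF assms(1)] tann_star[OF assms(2)] assms(3)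
      assms(1)[unfolded tdet_def] assms(2)[unfolded tdet_star]], assumption)+

lemma tdet_deriv_y:
  assumes "tdet N p u v x t y \<noteq> 0" "tdet N p u (- v) x t y \<noteq> 0" "\<And>i. i < N \<Longrightarrow> p i \<noteq> 0"
  shows "((\<lambda>s. tdet N p u v x t s) has_vector_derivative
    tdet N p u v x t y * (- coeff (tann N p u (- v) x t y) 1 / coeff (tann N p u (- v) x t y) 0)) (at y)"
  unfolding tdet_def
  by (rule cdet_deriv_y[OF row_deriv(5,6) assms(3) tann_star[OF assms(2)] tann_const(2)[OF assms]])

lemma tann_deriv_x:
  assumes "tdet N p u v x t y \<noteq> 0" "tdet N p u (- v) x t y \<noteq> 0"
  defines "Q \<equiv> tann N p u v x t y" and "Qs \<equiv> tann N p u (- v) x t y"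
  shows "((\<lambda>s. coeff (tann N p u v s t y) j) has_vector_derivative
    coeff (pCons 0 (Qs - Q) + Polynomial.smult (top_coeff N Q 1 - top_coeff N Qs 1) Q) j) (at x)"
  unfolding Q_def Qs_def
proof (rule annihilator_deriv_x[OF row_deriv(1,2) _ _ tann_star[OF assms(2)]])
  show "cdet N p (\<lambda>i. u i * wave (p i) x t y) (\<lambda>i. v i * wave (- p i) x t y) \<noteq> 0"
    using assms(1) by (simp add: tdet_def)
  show "\<forall>\<^sub>F s in nhds x. annihilator N p (\<lambda>i. u i * wave (p i) s t y) (\<lambda>i. v i * wave (- p i) s t y)
      (tann N p u v s t y)"
    using has_vector_derivative_eventually_nonzero[OF tdet_deriv_x[OF assms(1)] assms(1)]
    by eventually_elim (rule tann)
qed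

lemma tann_top_deriv_x:
  assumes "tdet N p u v x t y \<noteq> 0" "tdet N p u (- v) x t y \<noteq> 0"
  defines "Q \<equiv> tann N p u v x t y" and "Qs \<equiv> tann N p u (- v) x t y"
  shows "((\<lambda>s. top_coeff N (tann N p u v s t y) 1) has_vector_derivative
    top_coeff N Qs 2 - top_coeff N Q 2 + (top_coeff N Q 1 - top_coeff N Qs 1) * top_coeff N Q 1) (at x)"
proof (cases N)
  case 0
  then show ?thesis by (simp add: top_coeff_def)
next
  case (Suc M)
  then show ?thesis
    using tann_deriv_x[OF assms(1,2), of M, folded Q_def Qs_def]
    by (cases M) (auto simp: top_coeff_def numeral_2_eq_2)
qed

text \<open>The part of the derivative proportional to \<open>Q\<close> drops out of a quotient of
  two coefficients. What remains is a ratio of constant terms, from which the tangent vector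
  arises.\<close>

lemma tann_ratio_deriv_x:
  assumes "tdet N p u v x t y \<noteq> 0" "tdet N p u (- v) x t y \<noteq> 0" "\<And>i. i < N \<Longrightarrow> p i \<noteq> 0"
  shows "((\<lambda>s. coeff (tann N p u v s t y) 1 / coeff (tann N p u v s t y) 0) has_vector_derivative
    coeff (tann N p u (- v) x t y) 0 / coeff (tann N p u v x t y) 0 - 1) (at x)"
proof -
  have alg: "((s0 - q0 + k * q1) * q0 - q1 * (k * q0)) / (q0 * q0) = s0 / q0 - 1"
    if "q0 \<noteq> 0" for s0 q0 q1 k :: complex
    using that by (simp add: field_simps)
  let ?Q = "tann N p u v x t y" and ?Qs = "tann N p u (- v) x t y"
  let ?k = "top_coeff N ?Q 1 - top_coeff N ?Qs 1"
  note d = tann_deriv_x[OF assms(1,2)] and nz = tann_const(1)[OF assms]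
  have "coeff (pCons 0 (?Qs - ?Q) + Polynomial.smult ?k ?Q) 1
      = coeff ?Qs 0 - coeff ?Q 0 + ?k * coeff ?Q 1"
    and "coeff (pCons 0 (?Qs - ?Q) + Polynomial.smult ?k ?Q) 0 = ?k * coeff ?Q 0"
    by simp_all
  with has_vector_derivative_quotient[OF d[of 1] d[of 0] nz] show ?thesis
    by (simp only: alg[OF nz])
qed

text \<open>The two pairings in the bordered annihilator are quotients of determinants of sizes
  \<open>Suc N\<close> and \<open>N\<close>. Thus the multiplier of \<open>Q\<close> is expressed by
  tau functions alone, whose phases are known.\<close>

lemma tdet_bordered:
  fixes pe al be :: complex
  assumes D: "tdet N p u v x t y \<noteq> 0" and Ds: "tdet N p u (- v) x t y \<noteq> 0"
  defines "p' \<equiv> p(N := pe)" and "u' \<equiv> u(N := al)" and "v' \<equiv> v(N := be)"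
  assumes D': "tdet (Suc N) p' u' v' x t y \<noteq> 0"
  shows "tann (Suc N) p' u' v' x t y = pCons 0 (tann N p u (- v) x t y)
    - Polynomial.smult (pe * (tdet (Suc N) p' u' (- v') x t y * tdet N p u v x t y)
        / (tdet (Suc N) p' u' v' x t y * tdet N p u (- v) x t y)) (tann N p u v x t y)"
proof -
  let ?A = "\<lambda>i. u i * wave (p i) x t y" and ?B = "\<lambda>i. v i * wave (- p i) x t y"
  let ?al = "al * wave pe x t y" and ?be = "be * wave (- pe) x t y"
  note Q = tann[OF D] and Qs = tann_star[OF Ds]
  have A': "(\<lambda>i. u' i * wave (p' i) x t y) = ?A(N := ?al)"
    and B': "(\<lambda>i. v' i * wave (- p' i) x t y) = ?B(N := ?be)"
    and Bs': "(\<lambda>i. (- v') i * wave (- p' i) x t y) = (- ?B)(N := - ?be)"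
    by (auto simp: p'_def u'_def v'_def)
  have 1: "tdet (Suc N) p' u' v' x t y = tdet N p u v x t y * pairing pe ?al ?be (tann N p u v x t y)"
    unfolding tdet_def A' B' unfolding p'_def by (rule cdet_bordered[OF Q])
  have 2: "tdet (Suc N) p' u' (- v') x t y
      = tdet N p u (- v) x t y * pairing pe ?al (- ?be) (tann N p u (- v) x t y)"
    unfolding tdet_star[of N] unfolding tdet_def A' Bs' unfolding p'_def by (rule cdet_bordered[OF Qs])
  have h: "pairing pe ?al ?be (tann N p u v x t y) \<noteq> 0" using 1 D' by auto
  have "annihilator (Suc N) p' (\<lambda>i. u' i * wave (p' i) x t y) (\<lambda>i. v' i * wave (- p' i) x t y)
      (pCons 0 (tann N p u (- v) x t y)
      - Polynomial.smult (pe * pairing pe ?al (- ?be) (tann N p u (- v) x t y) / pairing pe ?al ?be (tann N p u v x t y))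
          (tann N p u v x t y))"
    unfolding A' B' unfolding p'_def by (rule annihilator_bordered[OF Q Qs h])
  from annihilator_unique[OF D'[unfolded tdet_def] tann[OF D'] this] show ?thesis
    using D Ds by (simp add: 1 2 mult_ac)
qed

section \<open>Complex conjugation, angles and curves\<close>

text \<open>Solitons have \<open>\<pi> = id\<close>; for breathers \<open>\<pi>\<close> exchanges the rows of each conjugate pair.\<close>

definition conj_sym :: "(nat \<Rightarrow> nat) \<Rightarrow> nat \<Rightarrow> (nat \<Rightarrow> complex) \<Rightarrow> (nat \<Rightarrow> complex) \<Rightarrow> (nat \<Rightarrow> complex) \<Rightarrow> bool" where
  "conj_sym \<pi> N p u v \<longleftrightarrow> \<pi> permutes {0..<N} \<and>
     (\<forall>i<N. cnj (p i) = p (\<pi> i) \<and> cnj (u i) = u (\<pi> i) \<and> cnj (v i) = - v (\<pi> i))"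

lemma signof_square: "signof \<pi> * signof \<pi> = (1 :: complex)"
  by (simp add: sign_def)

lemma cnj_wave: "cnj (wave p x t y) = wave (cnj p) x t y"
  by (simp add: wave_def exp_cnj)

text \<open>Entrywise conjugation gives the rows of \<open>(A, - B)\<close> in the order
  \<open>\<pi>\<close>, and reordering the rows costs the sign of \<open>\<pi>\<close>.\<close>

lemma cnj_cdet:
  assumes \<pi>: "\<pi> permutes {0..<N}"
    and c: "\<And>i. i < N \<Longrightarrow> cnj (p i) = p (\<pi> i)" "\<And>i. i < N \<Longrightarrow> cnj (A i) = A (\<pi> i)"
      "\<And>i. i < N \<Longrightarrow> cnj (B i) = - B (\<pi> i)"
  shows "cnj (cdet N p A B) = signof \<pi> * cdet N p A (- B)"
proof -
  have sg: "cnj (signof \<rho>) = signof \<rho>" for \<rho> :: "nat \<Rightarrow> nat" by (simp add: sign_def)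
  have "cnj (cdet N p A B) = cdet N (\<lambda>i. cnj (p i)) (\<lambda>i. cnj (A i)) (\<lambda>i. cnj (B i))"
    unfolding cdet_permutations by (simp add: sg)
  also have "\<dots> = cdet N (\<lambda>i. p (\<pi> i)) (\<lambda>i. A (\<pi> i)) (\<lambda>i. (- B) (\<pi> i))"
    using c by (intro cdet_cong) auto
  also have "\<dots> = Determinant.det (Matrix.mat N N (\<lambda>(i, j). cmat N p A (- B) $$ (\<pi> i, j)))"
  proof -
    have "\<pi> i < N" if "i < N" for i using permutes_in_image[OF \<pi>, of i] that by simp
    then show ?thesis
      unfolding cdet_def cmat_def by (intro arg_cong[of _ _ Determinant.det] eq_matI) (auto simp: cmat_def)
  qed
  also have "\<dots> = signof \<pi> * cdet N p A (- B)"
    using det_permute_rows[OF cmat_carrier \<pi>, of p A "- B"] by (simp add: det_cmat)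
  finally show ?thesis .
qed

lemma cnj_tdet:
  assumes "conj_sym \<pi> N p u v"
  shows "cnj (tdet N p u v x t y) = signof \<pi> * tdet N p u (- v) x t y"
  unfolding tdet_star unfolding tdet_def
  using assms by (intro cnj_cdet) (auto simp: conj_sym_def cnj_wave)

section \<open>Phases of determinants and derivatives of angles\<close>

lemma potential_value_iff: "potential_value z r \<longleftrightarrow> z \<noteq> 0 \<and> cis (r / 2) = z / cnj z"
proof -
  have eq: "of_real r = 2 / \<i> * w \<longleftrightarrow> w = \<i> * of_real (r / 2)" for w
    by (auto simp: field_simps)
  show ?thesis unfolding potential_value_def eq cis_conv_exp by blast
qed

text \<open>A real factor cancels in \<open>z / cnj z\<close>. Hence the phase of tau is that of the
  determinant, and by the conjugation symmetry a ratio of two functions that can both be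
  differentiated by the trace formulas.\<close>

lemma tdet_potential:
  assumes sym: "conj_sym \<pi> N p u v"
    and pot: "potential_value (of_real \<rho> * tdet N p u v x t y) r"
  shows "tdet N p u v x t y \<noteq> 0" "tdet N p u (- v) x t y \<noteq> 0" "\<rho> \<noteq> 0"
    "cis (r / 2) = signof \<pi> * (tdet N p u v x t y / tdet N p u (- v) x t y)"
proof -
  note c = cnj_tdet[OF sym, of x t y]
  show D: "tdet N p u v x t y \<noteq> 0" and \<rho>: "\<rho> \<noteq> 0"
    using pot by (auto simp: potential_value_iff)
  from D have "cnj (tdet N p u v x t y) \<noteq> 0" by simp
  then show Ds: "tdet N p u (- v) x t y \<noteq> 0" unfolding c by auto
  have "cis (r / 2) = tdet N p u v x t y / (signof \<pi> * tdet N p u (- v) x t y)"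
    using pot \<rho> by (simp add: potential_value_iff c)
  also have "\<dots> = signof \<pi> * (tdet N p u v x t y / tdet N p u (- v) x t y)"
    using Ds by (simp add: sign_def)
  finally show "cis (r / 2) = signof \<pi> * (tdet N p u v x t y / tdet N p u (- v) x t y)" .
qed

text \<open>The vanishing imaginary part matters as much as the derivative: it allows real
  derivatives to be replaced by the complex expressions that compute them.\<close>

lemma has_real_derivative_of_complex:
  assumes "((\<lambda>s. complex_of_real (f s)) has_vector_derivative z) (at x)"
  shows "(f has_real_derivative Re z) (at x)" "Im z = 0"
proof -
  show "(f has_real_derivative Re z) (at x)"
    using bounded_linear.has_vector_derivative[OF bounded_linear_Re assms]
    by (simp add: has_real_derivative_iff_has_vector_derivative)
  have "((\<lambda>s. 0::real) has_vector_derivative Im z) (at x)"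
    using bounded_linear.has_vector_derivative[OF bounded_linear_Im assms] by simp
  then show "Im z = 0"
    using vector_derivative_unique_at has_vector_derivative_const by blast
qed

text \<open>Continuity selects the branch. Near \<open>x\<close> the angle moves by less than
  \<open>2 * pi\<close>, so half its increment lies in the range of the principal logarithm and
  \<open>f s = f x + 2 / \<i> * Ln (g s / g x)\<close>, which is differentiable.\<close>

lemma angle_has_derivative:
  assumes cont: "isCont f x" and ev: "\<forall>\<^sub>F s in nhds x. cis (f s / 2) = g s"
    and g: "(g has_vector_derivative g x * w) (at x)"
  shows "(f has_real_derivative Re (2 / \<i> * w)) (at x)" "Im (2 / \<i> * w) = 0"
proof -
  have gx: "g x = cis (f x / 2)" using eventually_nhds_x_imp_x[OF ev] by simp
  then have nz: "g x \<noteq> 0" by simp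
  have 1: "((\<lambda>s. g s / g x) has_vector_derivative w) (at x)"
    using has_vector_derivative_divide[OF g, of "g x"] nz by simp
  have "(Ln has_field_derivative 1) (at (g x / g x))"
    using nz by (auto intro!: derivative_eq_intros)
  from field_vector_diff_chain_at[OF 1 this]
  have Ln: "((\<lambda>s. Ln (g s / g x)) has_vector_derivative w) (at x)" by (simp add: o_def)
  have "((\<lambda>s. of_real (f x) + 2 / \<i> * Ln (g s / g x)) has_vector_derivative 2 / \<i> * w) (at x)"
    by (rule has_vector_derivative_eq_rhs[OF has_vector_derivative_add[OF
        has_vector_derivative_const has_vector_derivative_mult_right[OF Ln]]]) simp
  moreover have "(f \<longlongrightarrow> f x) (nhds x)"
    using cont by (simp add: continuous_at tendsto_at_iff_tendsto_nhds)
  then have "\<forall>\<^sub>F s in nhds x. dist (f s) (f x) < 2 * pi"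
    by (rule tendstoD) simp
  with ev have "\<forall>\<^sub>F s in nhds x. of_real (f x) + 2 / \<i> * Ln (g s / g x) = of_real (f s)"
  proof eventually_elim
    case (elim s)
    have "g s / g x = cis (f s / 2) / cis (f x / 2)" by (simp only: elim(1) gx)
    also have "\<dots> = cis ((f s - f x) / 2)" by (simp only: cis_divide diff_divide_distrib)
    also have "\<dots> = exp (\<i> * of_real ((f s - f x) / 2))" by (rule cis_conv_exp)
    finally have "g s / g x = exp (\<i> * of_real ((f s - f x) / 2))" .
    moreover have "\<bar>(f s - f x) / 2\<bar> < pi" using elim(2) by (simp add: dist_real_def)
    ultimately have "Ln (g s / g x) = \<i> * of_real ((f s - f x) / 2)"
      by (simp only:) (rule Ln_exp, auto)
    moreover have "2 / \<i> * (\<i> * of_real (z / 2)) = complex_of_real z" for z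
      by (simp add: field_simps)
    ultimately show ?case by (simp only:) simp
  qed
  ultimately have "((\<lambda>s. complex_of_real (f s)) has_vector_derivative 2 / \<i> * w) (at x)"
    by (rule has_vector_derivative_transform_ev)
  from has_real_derivative_of_complex[OF this]
  show "(f has_real_derivative Re (2 / \<i> * w)) (at x)" "Im (2 / \<i> * w) = 0" by auto
qed

lemma has_vector_derivative_quotient_log:
  fixes f g :: "real \<Rightarrow> 'a :: real_normed_field"
  assumes "(f has_vector_derivative f x * a) (at x)" "(g has_vector_derivative g x * b) (at x)" "g x \<noteq> 0"
  shows "((\<lambda>s. f s / g s) has_vector_derivative f x / g x * (a - b)) (at x)"
  by (rule has_vector_derivative_eq_rhs[OF has_vector_derivative_quotient[OF assms]])
    (use assms(3) in \<open>simp add: field_simps\<close>)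

text \<open>Minus the logarithmic derivative in \<open>x\<close> of the determinant divided by its
  starred version; the angle satisfies \<theta>_x \<open>= 2 * \<i> * kappa\<close>.\<close>

definition kappa :: "nat \<Rightarrow> (nat \<Rightarrow> complex) \<Rightarrow> (nat \<Rightarrow> complex) \<Rightarrow> (nat \<Rightarrow> complex)
    \<Rightarrow> real \<Rightarrow> real \<Rightarrow> real \<Rightarrow> complex" where
  "kappa N p u v x t y = top_coeff N (tann N p u v x t y) 1 - top_coeff N (tann N p u (- v) x t y) 1"

lemma kappa_deriv_x:
  assumes "tdet N p u v x t y \<noteq> 0" "tdet N p u (- v) x t y \<noteq> 0"
  shows "((\<lambda>s. kappa N p u v s t y) has_vector_derivative
    2 * (top_coeff N (tann N p u (- v) x t y) 2 - top_coeff N (tann N p u v x t y) 2)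
    + kappa N p u v x t y * (top_coeff N (tann N p u v x t y) 1 + top_coeff N (tann N p u (- v) x t y) 1)) (at x)"
proof -
  have "tdet N p u (- (- v)) x t y \<noteq> 0" using assms(1) unfolding uminus_uminus_fun .
  from has_vector_derivative_diff[OF tann_top_deriv_x[OF assms] tann_top_deriv_x[OF assms(2) this]]
  show ?thesis
    unfolding kappa_def uminus_uminus_fun
    by (rule has_vector_derivative_eq_rhs) (simp add: algebra_simps)
qed

lemma tdet_angle_x:
  assumes sym: "conj_sym \<pi> N p u v" and cont: "isCont f x"
    and pot: "\<forall>\<^sub>F s in nhds x. potential_value (of_real (\<rho> s) * tdet N p u v s t y) (f s)"
  shows "(f has_real_derivative Re (2 * \<i> * kappa N p u v x t y)) (at x)"
    "Im (2 * \<i> * kappa N p u v x t y) = 0"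
proof -
  let ?D = "\<lambda>s. tdet N p u v s t y" and ?Ds = "\<lambda>s. tdet N p u (- v) s t y"
  let ?g = "\<lambda>s. signof \<pi> * (?D s / ?Ds s)"
  have potx: "potential_value (of_real (\<rho> x) * ?D x) (f x)"
    using pot by (rule eventually_nhds_x_imp_x)
  note nz = tdet_potential(1,2)[OF sym potx]
  have ev: "\<forall>\<^sub>F s in nhds x. cis (f s / 2) = ?g s"
    using pot by eventually_elim (rule tdet_potential(4)[OF sym])
  have alg: "c * (d * (- a - - b)) = c * d * - (a - b)" for a b c d :: complex
    by (simp add: algebra_simps)
  have "(?g has_vector_derivative ?g x * (- kappa N p u v x t y)) (at x)"
    by (rule has_vector_derivative_eq_rhs[OF has_vector_derivative_mult_right[OF
        has_vector_derivative_quotient_log[OF tdet_deriv_x[OF nz(1)] tdet_deriv_x[OF nz(2)] nz(2)]]])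
      (unfold kappa_def, rule alg)
  from angle_has_derivative[OF cont ev this]
  show "(f has_real_derivative Re (2 * \<i> * kappa N p u v x t y)) (at x)"
    "Im (2 * \<i> * kappa N p u v x t y) = 0" by simp_all
qed

lemma tdet_angle_t:
  assumes sym: "conj_sym \<pi> N p u v" and cont: "isCont f t"
    and pot: "\<forall>\<^sub>F s in nhds t. potential_value (of_real (\<rho> s) * tdet N p u v x s y) (f s)"
  defines "Q \<equiv> tann N p u v x t y" and "Qs \<equiv> tann N p u (- v) x t y"
  shows "(f has_real_derivative Re (8 * \<i> * (trace_t N Q Qs - trace_t N Qs Q))) (at t)"
    "Im (8 * \<i> * (trace_t N Q Qs - trace_t N Qs Q)) = 0"
proof -
  let ?D = "\<lambda>s. tdet N p u v x s y" and ?Ds = "\<lambda>s. tdet N p u (- v) x s y"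
  let ?g = "\<lambda>s. signof \<pi> * (?D s / ?Ds s)"
  have potx: "potential_value (of_real (\<rho> t) * ?D t) (f t)"
    using pot by (rule eventually_nhds_x_imp_x)
  note nz = tdet_potential(1,2)[OF sym potx]
  have ev: "\<forall>\<^sub>F s in nhds t. cis (f s / 2) = ?g s"
    using pot by eventually_elim (rule tdet_potential(4)[OF sym])
  have d1: "(?D has_vector_derivative ?D t * (- 4 * trace_t N Q Qs)) (at t)"
    unfolding Q_def Qs_def by (rule tdet_deriv_t[OF nz])
  have d2: "(?Ds has_vector_derivative ?Ds t * (- 4 * trace_t N Qs Q)) (at t)"
    using tdet_deriv_t[OF nz(2)] nz(1) unfolding Q_def Qs_def uminus_uminus_fun .
  have alg: "c * (d * (- 4 * a - - 4 * b)) = c * d * (- 4 * (a - b))" for a b c d :: complex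
    by (simp add: algebra_simps)
  have "(?g has_vector_derivative ?g t * (- 4 * (trace_t N Q Qs - trace_t N Qs Q))) (at t)"
    by (rule has_vector_derivative_eq_rhs[OF has_vector_derivative_mult_right[OF
        has_vector_derivative_quotient_log[OF d1 d2 nz(2)]]])
      (rule alg)
  from angle_has_derivative[OF cont ev this]
  show "(f has_real_derivative Re (8 * \<i> * (trace_t N Q Qs - trace_t N Qs Q))) (at t)"
    "Im (8 * \<i> * (trace_t N Q Qs - trace_t N Qs Q)) = 0" by simp_all
qed

section \<open>The plane curve in complex notation\<close>

definition vec2 :: "complex \<Rightarrow> real^2" where
  "vec2 z = vector [Re z, Im z]"

lemma vec2_add: "vec2 (z + w) = vec2 z + vec2 w"
  and vec2_diff: "vec2 (z - w) = vec2 z - vec2 w"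
  and vec2_scaleR: "vec2 (of_real c * z) = c *\<^sub>R vec2 z"
  by (simp_all add: vec2_def Finite_Cartesian_Product.vec_eq_iff forall_2)

lemma bounded_linear_vec2: "bounded_linear vec2"
  unfolding linear_conv_bounded_linear[symmetric]
  by (rule linearI) (simp_all add: vec2_add vec2_scaleR scaleR_conv_of_real)

lemma rotation_vec2: "rotation \<phi> *v vec2 z = vec2 (cis \<phi> * z)"
  by (simp add: vec2_def rotation_def Finite_Cartesian_Product.vec_eq_iff forall_2 matrix_vector_mult_def sum_2)

lemma reflection_vec2: "reflection *v vec2 z = vec2 (cnj z)"
  by (simp add: vec2_def reflection_def Finite_Cartesian_Product.vec_eq_iff forall_2 matrix_vector_mult_def sum_2)

text \<open>The expression of \<open>gamma\<close> for an arbitrary function of \<open>y\<close>, so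
  that it also applies to bordered determinants and to conjugates of tau.\<close>

definition curve_point :: "(real \<Rightarrow> complex) \<Rightarrow> real \<Rightarrow> real^2" where
  "curve_point g y = vector
     [Re (- (1 / 2) * log_deriv (\<lambda>s. g s * cnj (g s)) y),
      Re (1 / (2 * \<i>) * log_deriv (\<lambda>s. g s / cnj (g s)) y)]"

text \<open>If \<open>w\<close> is the logarithmic derivative of \<open>g\<close>, those of
  \<open>g * cnj g\<close> and \<open>g / cnj g\<close> are \<open>w + cnj w\<close> and
  \<open>w - cnj w\<close>. The two components are therefore \<open>- Re w\<close> and
  \<open>Im w\<close>.\<close>

lemma curve_point_eq:
  assumes g: "(g has_vector_derivative g y * w) (at y)" and nz: "g y \<noteq> 0"
  shows "curve_point g y = vec2 (- cnj w)"
proof -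
  have gc: "((\<lambda>s. cnj (g s)) has_vector_derivative cnj (g y * w)) (at y)"
    by (rule has_vector_derivative_cnj[OF g])
  have "((\<lambda>s. g s * cnj (g s)) has_vector_derivative g y * cnj (g y * w) + g y * w * cnj (g y)) (at y)"
    by (rule has_vector_derivative_mult[OF g gc])
  then have 1: "log_deriv (\<lambda>s. g s * cnj (g s)) y = w + cnj w"
    using nz by (subst log_deriv_eq) (auto simp: field_simps)
  have "((\<lambda>s. g s / cnj (g s)) has_vector_derivative
      (g y * w * cnj (g y) - g y * cnj (g y * w)) / (cnj (g y) * cnj (g y))) (at y)"
    by (rule has_vector_derivative_quotient[OF g gc]) (use nz in simp)
  then have 2: "log_deriv (\<lambda>s. g s / cnj (g s)) y = w - cnj w"
    using nz by (subst log_deriv_eq) (auto simp: field_simps)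
  show ?thesis
    unfolding curve_point_def 1 2 by (simp add: vec2_def complex_eq_iff)
qed

lemma exp_tdet_deriv_y:
  assumes "tdet N p u v x t y \<noteq> 0" "tdet N p u (- v) x t y \<noteq> 0" "\<And>i. i < N \<Longrightarrow> p i \<noteq> 0"
  defines "Qs \<equiv> tann N p u (- v) x t y"
  shows "((\<lambda>s. of_real (r * exp (- c * s)) * tdet N p u v x t s) has_vector_derivative
    of_real (r * exp (- c * y)) * tdet N p u v x t y * (- of_real c - coeff Qs 1 / coeff Qs 0)) (at y)"
proof -
  have e: "((\<lambda>s. complex_of_real (r * exp (- c * s))) has_vector_derivative
      complex_of_real (r * exp (- c * y)) * of_real (- c)) (at y)"
    by (rule has_vector_derivative_eq_rhs[OF has_vector_derivative_of_real])
      (auto intro!: derivative_eq_intros simp flip: has_real_derivative_iff_has_vector_derivative)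
  show ?thesis
    by (rule has_vector_derivative_eq_rhs[OF has_vector_derivative_mult[OF e tdet_deriv_y[OF assms(1-3)]]])
      (simp_all add: Qs_def algebra_simps)
qed

lemma curve_point_tdet:
  assumes sym: "conj_sym \<pi> N p u v" and p: "\<And>i. i < N \<Longrightarrow> p i \<noteq> 0"
    and pot: "potential_value (of_real (r * exp (- c * y)) * tdet N p u v x t y) \<theta>"
  defines "Qs \<equiv> tann N p u (- v) x t y"
  shows "curve_point (\<lambda>s. of_real (r * exp (- c * s)) * tdet N p u v x t s) y
    = vec2 (of_real c + cnj (coeff Qs 1 / coeff Qs 0))"
proof -
  note nz = tdet_potential(1,2)[OF sym pot]
  have "of_real (r * exp (- c * y)) * tdet N p u v x t y \<noteq> 0"
    using pot by (simp add: potential_value_iff)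
  from curve_point_eq[OF exp_tdet_deriv_y[OF nz p] this] show ?thesis
    by (simp add: Qs_def add.commute)
qed

lemma curve_point_cnj_tdet:
  assumes sym: "conj_sym \<pi> N p u v" and p: "\<And>i. i < N \<Longrightarrow> p i \<noteq> 0"
    and pot: "potential_value (of_real (r * exp (- c * y)) * tdet N p u v x t y) \<theta>"
  shows "curve_point (\<lambda>s. of_real (r * exp (- c * s)) * tdet N p u v x t s) y
    = reflection *v curve_point (\<lambda>s. cnj (of_real (r * exp (- c * s)) * tdet N p u v x t s)) y"
proof -
  let ?g = "\<lambda>s. of_real (r * exp (- c * s)) * tdet N p u v x t s"
  obtain w where w: "(?g has_vector_derivative ?g y * w) (at y)"
    using exp_tdet_deriv_y[OF tdet_potential(1,2)[OF sym pot] p] by blast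
  have "((\<lambda>s. cnj (?g s)) has_vector_derivative cnj (?g y) * cnj w) (at y)"
    using has_vector_derivative_cnj[OF w] by simp
  moreover have nz: "?g y \<noteq> 0" using pot by (simp add: potential_value_iff)
  moreover from nz have "cnj (?g y) \<noteq> 0" by (simp only: complex_cnj_zero_iff not_False_eq_True)
  ultimately have "curve_point (\<lambda>s. cnj (?g s)) y = vec2 (- cnj (cnj w))"
    by (intro curve_point_eq)
  with curve_point_eq[OF w nz] show ?thesis by (simp add: reflection_vec2)
qed

lemma tdet_potential_inverse:
  assumes sym: "conj_sym \<pi> N p u v"
    and pot: "potential_value (of_real \<rho> * tdet N p u v x t y) r"
  shows "tdet N p u (- v) x t y / tdet N p u v x t y = signof \<pi> * cis (- r / 2)"
proof -
  note nz = tdet_potential(1,2)[OF sym pot]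
  have "cis (- r / 2) = inverse (cis (r / 2))" by simp
  also have "\<dots> = inverse (signof \<pi>) * (tdet N p u (- v) x t y / tdet N p u v x t y)"
    unfolding tdet_potential(4)[OF sym pot] using nz by (simp add: field_simps)
  also have "inverse (signof \<pi>) = (signof \<pi> :: complex)" by (simp add: sign_def)
  finally have "signof \<pi> * cis (- r / 2)
      = signof \<pi> * signof \<pi> * (tdet N p u (- v) x t y / tdet N p u v x t y)"
    by (simp only: mult.assoc)
  then show ?thesis by (simp only: signof_square mult_1)
qed

text \<open>The ratio of constant terms is the square of a ratio of determinants; squaring removes
  the sign of \<open>\<pi>\<close> and turns the half angle into the full one.\<close>

lemma tann_const_cis:
  assumes sym: "conj_sym \<pi> N p u v" and p: "\<And>i. i < N \<Longrightarrow> p i \<noteq> 0"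
    and pot: "potential_value (of_real \<rho> * tdet N p u v x t y) r"
  shows "coeff (tann N p u v x t y) 0 / coeff (tann N p u (- v) x t y) 0 = cis (- r)"
proof -
  note nz = tdet_potential(1,2)[OF sym pot]
  have "coeff (tann N p u v x t y) 0 / coeff (tann N p u (- v) x t y) 0
      = (signof \<pi> * cis (- r / 2))\<^sup>2"
    by (rule trans[OF tann_const(3)[OF nz p]
          arg_cong[of _ _ "\<lambda>z. z\<^sup>2", OF tdet_potential_inverse[OF sym pot]]])
  also have "\<dots> = (signof \<pi> * signof \<pi>) * (cis (- r / 2) * cis (- r / 2))"
    by (simp add: power2_eq_square mult_ac)
  also have "\<dots> = cis (- r)" unfolding signof_square cis_mult by simp
  finally show ?thesis .
qed

text \<open>The tangent is the unit vector at angle \<theta>. The term \<open>x\<close> coming from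
  the factor \<open>exp (- x * y)\<close> of tau contributes 1, which cancels the -1 in the
  derivative of the coefficient ratio and leaves a pure phase.\<close>

lemma curve_point_deriv_x:
  assumes sym: "conj_sym \<pi> N p u v" and p: "\<And>i. i < N \<Longrightarrow> p i \<noteq> 0"
    and pot: "\<forall>\<^sub>F s in nhds x. potential_value (of_real (r s * exp (- (s + S) * y)) * tdet N p u v s t y) (f s)"
  shows "((\<lambda>s. curve_point (\<lambda>y. of_real (r s * exp (- (s + S) * y)) * tdet N p u v s t y) y)
    has_vector_derivative vec2 (cis (f x))) (at x)"
proof -
  let ?Q = "\<lambda>s. tann N p u v s t y" and ?Qs = "\<lambda>s. tann N p u (- v) s t y"
  have potx: "potential_value (of_real (r x * exp (- (x + S) * y)) * tdet N p u v x t y) (f x)"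
    using pot by (rule eventually_nhds_x_imp_x)
  note nz = tdet_potential(1,2)[OF sym potx]
  have nzs: "tdet N p u (- (- v)) x t y \<noteq> 0" using nz(1) unfolding uminus_uminus_fun .
  have ev: "\<forall>\<^sub>F s in nhds x. vec2 (of_real (s + S) + cnj (coeff (?Qs s) 1 / coeff (?Qs s) 0))
      = curve_point (\<lambda>y. of_real (r s * exp (- (s + S) * y)) * tdet N p u v s t y) y"
    using pot by eventually_elim (rule curve_point_tdet[OF sym p, symmetric])
  have "((\<lambda>s. coeff (?Qs s) 1 / coeff (?Qs s) 0) has_vector_derivative
      coeff (?Q x) 0 / coeff (?Qs x) 0 - 1) (at x)"
    using tann_ratio_deriv_x[OF nz(2) nzs p] unfolding uminus_uminus_fun .
  note has_vector_derivative_cnj[OF this]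
  moreover have "((\<lambda>s. complex_of_real (s + S)) has_vector_derivative 1) (at x)"
    by (auto intro!: derivative_eq_intros)
  ultimately have "((\<lambda>s. of_real (s + S) + cnj (coeff (?Qs s) 1 / coeff (?Qs s) 0)) has_vector_derivative
      1 + cnj (coeff (?Q x) 0 / coeff (?Qs x) 0 - 1)) (at x)"
    by (intro has_vector_derivative_add)
  from bounded_linear.has_vector_derivative[OF bounded_linear_vec2 this]
  have "((\<lambda>s. vec2 (of_real (s + S) + cnj (coeff (?Qs s) 1 / coeff (?Qs s) 0))) has_vector_derivative
      vec2 (1 + cnj (coeff (?Q x) 0 / coeff (?Qs x) 0 - 1))) (at x)" .
  moreover have "1 + cnj (coeff (?Q x) 0 / coeff (?Qs x) 0 - 1) = cis (f x)"
  proof -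
    have "coeff (?Q x) 0 / coeff (?Qs x) 0 = cis (- f x)"
      by (rule tann_const_cis[OF sym p potx])
    then show ?thesis by (simp add: cis_cnj)
  qed
  ultimately show ?thesis
    by (intro has_vector_derivative_transform_ev[OF _ ev]) (simp only:)
qed

lemma vec2_uminus: "vec2 (- z) = - vec2 z"
  using vec2_scaleR[of "- 1" z] by simp

lemma signof_signof: "signof \<pi> * (signof \<pi> * z) = (z :: complex)"
  unfolding mult.assoc[symmetric] signof_square by simp

section \<open>The Darboux transformation\<close>

text \<open>One real parameter with a real and an imaginary coefficient is adjoined. Adding a
  soliton takes the coefficients from the parameters; shifts of \<open>k\<close> and
  \<open>l\<close> use \<open>al = 1\<close>, \<open>be = 0\<close>.\<close>

locale darboux =
  fixes \<pi> :: "nat \<Rightarrow> nat" and N :: nat and p u v :: "nat \<Rightarrow> complex" and pe :: real and al be :: complex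
  assumes sym: "conj_sym \<pi> N p u v" and p_nz: "i < N \<Longrightarrow> p i \<noteq> 0"
    and pe_nz: "pe \<noteq> 0" and al: "cnj al = al" and be: "cnj be = - be"
begin

abbreviation "p' \<equiv> p(N := of_real pe)"
abbreviation "u' \<equiv> u(N := al)"
abbreviation "v' \<equiv> v(N := be)"

text \<open>The permutation fixes the new index, so both sizes have the same \<open>\<pi>\<close>
  and the same sign. In ratios of tau functions of the two sizes the signs therefore cancel.\<close>

lemma sym': "conj_sym \<pi> (Suc N) p' u' v'"
proof -
  have \<pi>: "\<pi> permutes {0..<N}" using sym by (simp add: conj_sym_def)
  then have "\<pi> permutes {0..<Suc N}" by (rule permutes_subset) auto
  moreover have "\<pi> N = N" using permutes_not_in[OF \<pi>, of N] by simp
  moreover have "\<pi> i < N" if "i < N" for i using permutes_in_image[OF \<pi>, of i] that by simp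
  then have "\<pi> i \<noteq> N" if "i < N" for i using that by (metis less_irrefl)
  ultimately show ?thesis
    using sym al be by (auto simp: conj_sym_def less_Suc_eq)
qed

lemma p'_nz: "i < Suc N \<Longrightarrow> p' i \<noteq> 0"
  using p_nz pe_nz by (auto simp: less_Suc_eq)

lemma star': "(- v)(N := - be) = - v'"
  by auto

context
  fixes x t y \<rho> \<rho>' \<theta> \<theta>'
  assumes pot: "potential_value (of_real \<rho> * tdet N p u v x t y) \<theta>"
    and pot': "potential_value (of_real \<rho>' * tdet (Suc N) p' u' v' x t y) \<theta>'"
begin

lemma ratio_cis:
  "(tdet (Suc N) p' u' (- v') x t y * tdet N p u v x t y)
      / (tdet (Suc N) p' u' v' x t y * tdet N p u (- v) x t y) = cis (- ((\<theta>' - \<theta>) / 2))"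
  "(tdet (Suc N) p' u' v' x t y * tdet N p u (- v) x t y)
      / (tdet (Suc N) p' u' (- v') x t y * tdet N p u v x t y) = cis ((\<theta>' - \<theta>) / 2)"
proof -
  have ac: "(sg * a) * (sg * b) = a * b" if "sg * sg = 1" for sg a b :: complex
  proof -
    have "(sg * a) * (sg * b) = (sg * sg) * (a * b)" by (simp add: mult_ac)
    with that show ?thesis by simp
  qed
  have inv: "tdet N p u v x t y / tdet N p u (- v) x t y = signof \<pi> * cis (\<theta> / 2)"
    unfolding tdet_potential(4)[OF sym pot] signof_signof by (rule refl)
  have inv': "tdet (Suc N) p' u' v' x t y / tdet (Suc N) p' u' (- v') x t y = signof \<pi> * cis (\<theta>' / 2)"
    unfolding tdet_potential(4)[OF sym' pot'] signof_signof by (rule refl)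
  have "(tdet (Suc N) p' u' (- v') x t y / tdet (Suc N) p' u' v' x t y)
      * (tdet N p u v x t y / tdet N p u (- v) x t y) = cis (- \<theta>' / 2) * cis (\<theta> / 2)"
    unfolding inv tdet_potential_inverse[OF sym' pot'] by (rule ac[OF signof_square])
  also have "\<dots> = cis (- ((\<theta>' - \<theta>) / 2))"
    unfolding cis_mult by (rule arg_cong[of _ _ cis]) (simp add: field_simps)
  finally show "(tdet (Suc N) p' u' (- v') x t y * tdet N p u v x t y)
      / (tdet (Suc N) p' u' v' x t y * tdet N p u (- v) x t y) = cis (- ((\<theta>' - \<theta>) / 2))"
    by (simp only: times_divide_times_eq)
  have "(tdet (Suc N) p' u' v' x t y / tdet (Suc N) p' u' (- v') x t y)
      * (tdet N p u (- v) x t y / tdet N p u v x t y) = cis (\<theta>' / 2) * cis (- \<theta> / 2)"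
    unfolding inv' tdet_potential_inverse[OF sym pot] by (rule ac[OF signof_square])
  also have "\<dots> = cis ((\<theta>' - \<theta>) / 2)"
    unfolding cis_mult by (rule arg_cong[of _ _ cis]) (simp add: field_simps)
  finally show "(tdet (Suc N) p' u' v' x t y * tdet N p u (- v) x t y)
      / (tdet (Suc N) p' u' (- v') x t y * tdet N p u v x t y) = cis ((\<theta>' - \<theta>) / 2)"
    by (simp only: times_divide_times_eq)
qed

lemma tann_ext:
  "tann (Suc N) p' u' v' x t y = pCons 0 (tann N p u (- v) x t y)
     - Polynomial.smult (of_real pe * cis (- ((\<theta>' - \<theta>) / 2))) (tann N p u v x t y)"
  "tann (Suc N) p' u' (- v') x t y = pCons 0 (tann N p u v x t y)
     - Polynomial.smult (of_real pe * cis ((\<theta>' - \<theta>) / 2)) (tann N p u (- v) x t y)"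
proof -
  note nz = tdet_potential(1,2)[OF sym pot] and nz' = tdet_potential(1,2)[OF sym' pot']
  show "tann (Suc N) p' u' v' x t y = pCons 0 (tann N p u (- v) x t y)
     - Polynomial.smult (of_real pe * cis (- ((\<theta>' - \<theta>) / 2))) (tann N p u v x t y)"
    using tdet_bordered[OF nz nz'(1)] unfolding times_divide_eq_right[symmetric, of "of_real pe"] ratio_cis .
  have ss: "tdet N p u (- (- v)) x t y \<noteq> 0" using nz(1) unfolding uminus_uminus_fun .
  have s': "tdet (Suc N) p' u' ((- v)(N := - be)) x t y \<noteq> 0" using nz'(2) unfolding star' .
  show "tann (Suc N) p' u' (- v') x t y = pCons 0 (tann N p u v x t y)
     - Polynomial.smult (of_real pe * cis ((\<theta>' - \<theta>) / 2)) (tann N p u (- v) x t y)"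
    using tdet_bordered[OF nz(2) ss s']
    unfolding star' uminus_uminus_fun times_divide_eq_right[symmetric, of "of_real pe"] ratio_cis .
qed

end

text \<open>The curve depends on the quotient of the two lowest coefficients. For
  \<open>z Q - rs Qs\<close> this quotient is the old one minus \<open>(q0 / qs0) / rs\<close>; the
  phases of \<open>q0 / qs0\<close> and \<open>rs\<close> combine to half the sum of the angles, up
  to the final conjugation.\<close>

lemma curve_point_step:
  assumes pot: "potential_value (of_real (r * exp (- c * y)) * tdet N p u v x t y) \<theta>"
    and pot': "potential_value (of_real (r' * exp (- c * y)) * tdet (Suc N) p' u' v' x t y) \<theta>'"
  shows "curve_point (\<lambda>s. of_real (r' * exp (- c * s)) * tdet (Suc N) p' u' v' x t s) y
    = curve_point (\<lambda>s. of_real (r * exp (- c * s)) * tdet N p u v x t s) y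
      + vec2 (of_real (- 1 / pe) * cis ((\<theta>' + \<theta>) / 2))"
proof -
  let ?Q = "tann N p u v x t y" and ?Qs = "tann N p u (- v) x t y"
  let ?rs = "of_real pe * cis ((\<theta>' - \<theta>) / 2)"
  note nz = tdet_potential(1,2)[OF sym pot]
  have alg: "(q0 - r * q1) / (- (r * qs0)) = q1 / qs0 - (q0 / qs0) / r"
    if "r \<noteq> 0" "qs0 \<noteq> 0" for q0 q1 qs0 r :: complex
    using that by (simp add: field_simps)
  have rs: "?rs \<noteq> 0" using pe_nz by simp
  have "coeff (tann (Suc N) p' u' (- v') x t y) 1 / coeff (tann (Suc N) p' u' (- v') x t y) 0
      = (coeff ?Q 0 - ?rs * coeff ?Qs 1) / (- (?rs * coeff ?Qs 0))"
    unfolding tann_ext(2)[OF pot pot'] by simp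
  also have "\<dots> = coeff ?Qs 1 / coeff ?Qs 0 - (coeff ?Q 0 / coeff ?Qs 0) / ?rs"
    by (rule alg[OF rs tann_const(2)[OF nz p_nz]])
  also have "(coeff ?Q 0 / coeff ?Qs 0) / ?rs = of_real (1 / pe) * cis (- ((\<theta>' + \<theta>) / 2))"
  proof -
    have "cis (- \<theta>) / cis ((\<theta>' - \<theta>) / 2) = cis (- ((\<theta>' + \<theta>) / 2))"
      unfolding cis_divide by (rule arg_cong[of _ _ cis]) (simp add: field_simps)
    moreover have "z / (of_real pe * w) = of_real (1 / pe) * (z / w)" for z w :: complex by simp
    moreover have "coeff ?Q 0 / coeff ?Qs 0 = cis (- \<theta>)"
      by (rule tann_const_cis[OF sym p_nz pot])
    ultimately show ?thesis by (simp only:)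
  qed
  finally have e: "coeff (tann (Suc N) p' u' (- v') x t y) 1 / coeff (tann (Suc N) p' u' (- v') x t y) 0
    = coeff ?Qs 1 / coeff ?Qs 0 - of_real (1 / pe) * cis (- ((\<theta>' + \<theta>) / 2))" .
  have "curve_point (\<lambda>s. of_real (r * exp (- c * s)) * tdet N p u v x t s) y
      = vec2 (of_real c + cnj (coeff ?Qs 1 / coeff ?Qs 0))"
    by (rule curve_point_tdet[OF sym p_nz pot])
  moreover have "curve_point (\<lambda>s. of_real (r' * exp (- c * s)) * tdet (Suc N) p' u' v' x t s) y
      = vec2 (of_real c + cnj (coeff (tann (Suc N) p' u' (- v') x t y) 1
          / coeff (tann (Suc N) p' u' (- v') x t y) 0))"
    by (rule curve_point_tdet[OF sym' p'_nz pot'])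
  ultimately show ?thesis
    unfolding e by (simp add: cis_cnj vec2_add vec2_diff vec2_uminus)
qed

end

section \<open>The trace identity for the t-evolution and the equations of type I\<close>

lemma top_coeff_ext:
  "top_coeff (Suc N) (pCons 0 R - Polynomial.smult r Q) (Suc i) = top_coeff N R (Suc i) - r * top_coeff N Q i"
proof -
  consider "i < N" | "i = N" | "N < i" by linarith
  then show ?thesis
  proof cases
    case 1
    then have "N - i = Suc (N - Suc i)" by simp
    with 1 show ?thesis by (simp add: top_coeff_def)
  qed (simp_all add: top_coeff_def)
qed

text \<open>In the antisymmetrized trace the third coefficients enter only as their difference, and
  bordering exchanges their roles. They cancel in the sum over both sizes, and what is left depends
  on \<open>k\<close> and \<open>k'\<close>, that is on \<theta>_x and \<theta>_xx, together with
  \<open>r\<close>, \<open>rs\<close> and \<open>e\<close>.\<close>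

lemma trace_t_bordered:
  fixes r rs :: complex
  assumes "top_coeff N Q 0 = 1" "top_coeff N Qs 0 = 1" and r: "r * rs = e\<^sup>2"
  defines "k \<equiv> top_coeff N Q 1 - top_coeff N Qs 1"
  defines "k' \<equiv> 2 * (top_coeff N Qs 2 - top_coeff N Q 2) + k * (top_coeff N Q 1 + top_coeff N Qs 1)"
  defines "Q' \<equiv> pCons 0 Qs - Polynomial.smult r Q" and "Qs' \<equiv> pCons 0 Q - Polynomial.smult rs Qs"
  shows "2 * (trace_t N Q Qs - trace_t N Qs Q + trace_t (Suc N) Q' Qs' - trace_t (Suc N) Qs' Q')
    = 4 * e\<^sup>2 * k + 2 * e\<^sup>2 * (r - rs) - k\<^sup>2 * (r - rs) - k' * (r + rs)"
proof -
  have t: "top_coeff (Suc N) Q' 1 = top_coeff N Qs 1 - r"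
    "top_coeff (Suc N) Q' 2 = top_coeff N Qs 2 - r * top_coeff N Q 1"
    "top_coeff (Suc N) Q' 3 = top_coeff N Qs 3 - r * top_coeff N Q 2"
    "top_coeff (Suc N) Qs' 1 = top_coeff N Q 1 - rs"
    "top_coeff (Suc N) Qs' 2 = top_coeff N Q 2 - rs * top_coeff N Qs 1"
    "top_coeff (Suc N) Qs' 3 = top_coeff N Q 3 - rs * top_coeff N Qs 2"
    using top_coeff_ext[of N Qs r Q 0] top_coeff_ext[of N Qs r Q 1] top_coeff_ext[of N Qs r Q 2]
      top_coeff_ext[of N Q rs Qs 0] top_coeff_ext[of N Q rs Qs 1] top_coeff_ext[of N Q rs Qs 2]
      assms(1,2)
    by (simp_all add: Q'_def Qs'_def numeral_2_eq_2 numeral_3_eq_3)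
  show ?thesis
    unfolding trace_t_def t k'_def k_def r[symmetric] unfolding power2_eq_square by (simp add: algebra_simps)
qed

lemma isCont_slices:
  fixes \<theta> :: "real \<Rightarrow> real \<Rightarrow> real"
  assumes "open U" "continuous_on U (\<lambda>(x, t). \<theta> x t)" "(x, t) \<in> U"
  shows "isCont (\<lambda>s. \<theta> s t) x" "isCont (\<lambda>s. \<theta> x s) t"
    "\<forall>\<^sub>F s in nhds x. (s, t) \<in> U" "\<forall>\<^sub>F s in nhds t. (x, s) \<in> U"
proof -
  have c: "isCont (\<lambda>(x, t). \<theta> x t) (x, t)"
    using assms by (simp add: continuous_on_eq_continuous_at)
  have p1: "isCont (\<lambda>s. (s, t)) x" and p2: "isCont (\<lambda>s. (x, s)) t"
    by (intro continuous_intros)+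
  show "isCont (\<lambda>s. \<theta> s t) x" using isCont_o2[OF p1, of "\<lambda>(x, t). \<theta> x t"] c by simp
  show "isCont (\<lambda>s. \<theta> x s) t" using isCont_o2[OF p2, of "\<lambda>(x, t). \<theta> x t"] c by simp
  have "((\<lambda>s. (s, t)) \<longlongrightarrow> (x, t)) (nhds x)" "((\<lambda>s. (x, s)) \<longlongrightarrow> (x, t)) (nhds t)"
    by (intro tendsto_Pair tendsto_const filterlim_ident)+
  then show "\<forall>\<^sub>F s in nhds x. (s, t) \<in> U" "\<forall>\<^sub>F s in nhds t. (x, s) \<in> U"
    using assms(1,3) by (auto dest: topological_tendstoD)
qed

lemma of_real_Re_eq: "Im z = 0 \<Longrightarrow> complex_of_real (Re z) = z"
  by (simp add: complex_eq_iff)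

context darboux
begin

text \<open>The real factors \<open>r\<close> and \<open>r'\<close> may depend on \<open>x\<close>
  and \<open>t\<close>: neither the phases nor the logarithmic derivatives in \<open>y\<close> see
  them. With \<theta>_x \<open>= 2 * \<i> * k\<close> and \<theta>_xx \<open>= 2 * \<i> * k'\<close>
  the differential equations are relations between coefficients, in which sine and cosine of
  \<open>\<phi>\<close> enter through the difference and the sum of \<open>R\<close> and
  \<open>Rs\<close>.\<close>

lemma baecklund_I_tdet:
  assumes U: "open U" and cont: "continuous_on U (\<lambda>(x, t). \<theta> x t)" and cont': "continuous_on U (\<lambda>(x, t). \<theta>' x t)"
    and pot: "\<And>x t. (x, t) \<in> U \<Longrightarrow>
      potential_value (of_real (r x t * exp (- (x + S) * y)) * tdet N p u v x t y) (\<theta> x t)"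
    and pot': "\<And>x t. (x, t) \<in> U \<Longrightarrow>
      potential_value (of_real (r' x t * exp (- (x + S) * y)) * tdet (Suc N) p' u' v' x t y) (\<theta>' x t)"
  shows "baecklund_I U (- pe)
    \<theta> (\<lambda>x t. curve_point (\<lambda>s. of_real (r x t * exp (- (x + S) * s)) * tdet N p u v x t s) y)
    \<theta>' (\<lambda>x t. curve_point (\<lambda>s. of_real (r' x t * exp (- (x + S) * s)) * tdet (Suc N) p' u' v' x t s) y)"
  unfolding baecklund_I_def
proof (intro conjI ballI, goal_cases)
  case 1
  show ?case using pe_nz by simp
next
  case (2 z)
  obtain x t where z: "z = (x, t)" by (cases z)
  with 2 have xt: "(x, t) \<in> U" by simp
  note c = isCont_slices[OF U cont xt] and c' = isCont_slices[OF U cont' xt]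
  define k where "k = kappa N p u v x t y"
  define Q where "Q = tann N p u v x t y"
  define Qs where "Qs = tann N p u (- v) x t y"
  define k' where "k' = 2 * (top_coeff N Qs 2 - top_coeff N Q 2) + k * (top_coeff N Q 1 + top_coeff N Qs 1)"
  define \<phi> where "\<phi> = (\<theta>' x t - \<theta> x t) / 2"
  define R where "R = of_real pe * cis (- \<phi>)"
  define Rs where "Rs = of_real pe * cis \<phi>"
  note nz = tdet_potential(1,2)[OF sym pot[OF xt]]
  have Q': "tann (Suc N) p' u' v' x t y = pCons 0 Qs - Polynomial.smult R Q"
    and Qs': "tann (Suc N) p' u' (- v') x t y = pCons 0 Q - Polynomial.smult Rs Qs"
    unfolding Q_def Qs_def R_def Rs_def \<phi>_def by (rule tann_ext[OF pot[OF xt] pot'[OF xt]])+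
  have q0: "top_coeff N Q 0 = 1" "top_coeff N Qs 0 = 1"
    using annihilator_coeffs(1)[OF tann[OF nz(1)]] annihilator_coeffs(1)[OF tann_star[OF nz(2)]]
    by (simp_all add: Q_def Qs_def top_coeff_def)

  have evx: "\<forall>\<^sub>F s in nhds x. potential_value (of_real (r s t * exp (- (s + S) * y)) * tdet N p u v s t y) (\<theta> s t)"
    using c(3) by eventually_elim (rule pot)
  have evx': "\<forall>\<^sub>F s in nhds x.
      potential_value (of_real (r' s t * exp (- (s + S) * y)) * tdet (Suc N) p' u' v' s t y) (\<theta>' s t)"
    using c(3) by eventually_elim (rule pot')
  have evt: "\<forall>\<^sub>F s in nhds t. potential_value (of_real (r x s * exp (- (x + S) * y)) * tdet N p u v x s y) (\<theta> x s)"
    using c(4) by eventually_elim (rule pot)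
  have evt': "\<forall>\<^sub>F s in nhds t.
      potential_value (of_real (r' x s * exp (- (x + S) * y)) * tdet (Suc N) p' u' v' x s y) (\<theta>' x s)"
    using c(4) by eventually_elim (rule pot')

  note dx = tdet_angle_x[OF sym c(1) evx, folded k_def]
  note dx' = tdet_angle_x[OF sym' c'(1) evx']
  \<comment> \<open>Bordering interchanges the two subleading coefficients, so \<open>k\<close>
    changes sign. In the sum of the two angles it cancels and only \<open>Rs - R\<close> is
    left.\<close>
  have k_ext: "kappa (Suc N) p' u' v' x t y = - k - R + Rs"
    using top_coeff_ext[of N Qs R Q 0] top_coeff_ext[of N Q Rs Qs 0] q0
    unfolding kappa_def Q' Qs' k_def by (simp add: Q_def Qs_def)

  \<comment> \<open>The formula for \<theta>_x is needed in a neighbourhood of \<open>x\<close>,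
    since it is differentiated once more.\<close>
  have ev_deriv: "\<forall>\<^sub>F s in nhds x. Re (2 * \<i> * kappa N p u v s t y) = deriv (\<lambda>s. \<theta> s t) s"
    and ev_im: "\<forall>\<^sub>F s in nhds x. complex_of_real (Re (2 * \<i> * kappa N p u v s t y)) = 2 * \<i> * kappa N p u v s t y"
  proof -
    have "\<forall>\<^sub>F s in nhds x. ((\<lambda>s. \<theta> s t) has_real_derivative Re (2 * \<i> * kappa N p u v s t y)) (at s)
        \<and> Im (2 * \<i> * kappa N p u v s t y) = 0"
      using c(3)
    proof eventually_elim
      case (elim s)
      note cs = isCont_slices[OF U cont elim]
      have "\<forall>\<^sub>F s in nhds s. potential_value (of_real (r s t * exp (- (s + S) * y)) * tdet N p u v s t y) (\<theta> s t)"
        using cs(3) by eventually_elim (rule pot)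
      from tdet_angle_x[OF sym cs(1) this] show ?case by simp
    qed
    then show "\<forall>\<^sub>F s in nhds x. Re (2 * \<i> * kappa N p u v s t y) = deriv (\<lambda>s. \<theta> s t) s"
      and "\<forall>\<^sub>F s in nhds x. complex_of_real (Re (2 * \<i> * kappa N p u v s t y)) = 2 * \<i> * kappa N p u v s t y"
      by (eventually_elim, blast intro: DERIV_imp_deriv[symmetric] of_real_Re_eq)+
  qed
  have kd: "((\<lambda>s. 2 * \<i> * kappa N p u v s t y) has_vector_derivative 2 * \<i> * k') (at x)"
    unfolding k'_def k_def Q_def Qs_def by (rule has_vector_derivative_mult_right[OF kappa_deriv_x[OF nz]])
  have "\<forall>\<^sub>F s in nhds x. 2 * \<i> * kappa N p u v s t y = complex_of_real (deriv (\<lambda>s. \<theta> s t) s)"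
    using ev_deriv ev_im by eventually_elim simp
  note dd = has_real_derivative_of_complex[OF has_vector_derivative_transform_ev[OF kd this]]
  have X: "complex_of_real (deriv (\<lambda>s. \<theta> s t) x) = 2 * \<i> * k"
    using DERIV_imp_deriv[OF dx(1)] of_real_Re_eq[OF dx(2)] by simp
  have Y: "complex_of_real (deriv (deriv (\<lambda>s. \<theta> s t)) x) = 2 * \<i> * k'"
    using DERIV_imp_deriv[OF dd(1)] of_real_Re_eq[OF dd(2)] by simp
  have sc: "Rs - R = 2 * \<i> * of_real (pe * sin \<phi>)" "R + Rs = 2 * of_real (pe * cos \<phi>)"
    by (simp_all add: R_def Rs_def complex_eq_iff)
  have RRs: "R * Rs = (of_real pe)\<^sup>2"
  proof -
    have "R * Rs = (of_real pe)\<^sup>2 * (cis (- \<phi>) * cis \<phi>)" by (simp add: R_def Rs_def power2_eq_square)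
    then show ?thesis by (simp add: cis_mult)
  qed

  have x_eq: "((\<lambda>s. (\<theta>' s t + \<theta> s t) / 2) has_real_derivative 2 * - pe * sin \<phi>) (at x)"
  proof -
    have "((\<lambda>s. (\<theta>' s t + \<theta> s t) / 2) has_real_derivative
       (Re (2 * \<i> * kappa (Suc N) p' u' v' x t y) + Re (2 * \<i> * k)) / 2) (at x)"
      by (rule DERIV_cdivide[OF DERIV_add[OF dx'(1) dx(1)]])
    also have "Re (2 * \<i> * kappa (Suc N) p' u' v' x t y) + Re (2 * \<i> * k) = Re (2 * \<i> * (Rs - R))"
      unfolding k_ext by (simp add: algebra_simps)
    also have "Re (2 * \<i> * (Rs - R)) / 2 = 2 * - pe * sin \<phi>"
      unfolding sc by simp
    finally show ?thesis .
  qed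

  have t_eq: "((\<lambda>s. (\<theta>' x s + \<theta> x s) / 2) has_real_derivative
      - (- pe) * ((deriv (\<lambda>s. \<theta> s t) x)\<^sup>2 + 8 * (- pe)\<^sup>2) * sin \<phi>
      + 2 * - pe * deriv (deriv (\<lambda>s. \<theta> s t)) x * cos \<phi> + 4 * (- pe)\<^sup>2 * deriv (\<lambda>s. \<theta> s t) x) (at t)"
  proof -
    let ?T = "trace_t N Q Qs - trace_t N Qs Q"
    let ?T' = "trace_t (Suc N) (pCons 0 Qs - Polynomial.smult R Q) (pCons 0 Q - Polynomial.smult Rs Qs)
      - trace_t (Suc N) (pCons 0 Q - Polynomial.smult Rs Qs) (pCons 0 Qs - Polynomial.smult R Q)"
    note dt = tdet_angle_t[OF sym c(2) evt, folded Q_def Qs_def]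
    note dt' = tdet_angle_t[OF sym' c'(2) evt', unfolded Q' Qs']
    have "((\<lambda>s. (\<theta>' x s + \<theta> x s) / 2) has_real_derivative (Re (8 * \<i> * ?T') + Re (8 * \<i> * ?T)) / 2) (at t)"
      by (rule DERIV_cdivide[OF DERIV_add[OF dt'(1) dt(1)]])
    \<comment> \<open>The two real values are compared after embedding in the complex numbers, where
      the trace identity can be inserted; multiplying it by \<open>2 * \<i>\<close> rebuilds
      \<theta>_x and \<theta>_xx from \<open>k\<close> and \<open>k'\<close>.\<close>
    moreover have "complex_of_real ((Re (8 * \<i> * ?T') + Re (8 * \<i> * ?T)) / 2)
      = complex_of_real (- (- pe) * ((deriv (\<lambda>s. \<theta> s t) x)\<^sup>2 + 8 * (- pe)\<^sup>2) * sin \<phi>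
      + 2 * - pe * deriv (deriv (\<lambda>s. \<theta> s t)) x * cos \<phi> + 4 * (- pe)\<^sup>2 * deriv (\<lambda>s. \<theta> s t) x)"
    proof -
      have alg: "(8 * \<i> * b + 8 * \<i> * a) / 2 = 2 * \<i> * (2 * (a + b))" for a b
        by (simp add: field_simps)
      define e sn cs where "e = complex_of_real pe" and "sn = complex_of_real (sin \<phi>)" and "cs = complex_of_real (cos \<phi>)"
      have "complex_of_real ((Re (8 * \<i> * ?T') + Re (8 * \<i> * ?T)) / 2) = (8 * \<i> * ?T' + 8 * \<i> * ?T) / 2"
        by (simp only: of_real_divide of_real_add of_real_Re_eq[OF dt(2)] of_real_Re_eq[OF dt'(2)] of_real_numeral)
      also have "\<dots> = 2 * \<i> * (2 * (?T + ?T'))" by (rule alg)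
      also have "2 * (?T + ?T') = 4 * e\<^sup>2 * k + 2 * e\<^sup>2 * (R - Rs) - k\<^sup>2 * (R - Rs) - k' * (R + Rs)"
        using trace_t_bordered[OF q0 RRs] unfolding k'_def k_def kappa_def Q_def Qs_def e_def
        by (simp only: add_diff_eq)
      also have "\<dots> = 4 * e\<^sup>2 * k - (2 * e\<^sup>2 - k\<^sup>2) * (Rs - R) - k' * (R + Rs)"
        by (simp add: algebra_simps)
      also have "\<dots> = 4 * e\<^sup>2 * k - (2 * e\<^sup>2 - k\<^sup>2) * (2 * \<i> * (e * sn)) - k' * (2 * (e * cs))"
        unfolding sc by (simp add: e_def sn_def cs_def)
      also have "2 * \<i> * \<dots> = e * ((2 * \<i> * k)\<^sup>2 + 8 * e\<^sup>2) * sn - 2 * e * (2 * \<i> * k') * cs + 4 * e\<^sup>2 * (2 * \<i> * k)"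
        by (simp add: power2_eq_square algebra_simps)
      finally show ?thesis
        unfolding X[symmetric] Y[symmetric] e_def sn_def cs_def by simp
    qed
    ultimately show ?thesis by (simp only: of_real_eq_iff)
  qed

  have gd: "((\<lambda>s. curve_point (\<lambda>y. of_real (r s t * exp (- (s + S) * y)) * tdet N p u v s t y) y)
      has_vector_derivative vec2 (cis (\<theta> x t))) (at x)"
    by (rule curve_point_deriv_x[OF sym p_nz evx])

  have g_eq: "curve_point (\<lambda>s. of_real (r' x t * exp (- (x + S) * s)) * tdet (Suc N) p' u' v' x t s) y
    = curve_point (\<lambda>s. of_real (r x t * exp (- (x + S) * s)) * tdet N p u v x t s) y
      + (1 / - pe) *\<^sub>R (rotation \<phi> *v vec2 (cis (\<theta> x t)))"
  proof -
    have "cis \<phi> * cis (\<theta> x t) = cis ((\<theta>' x t + \<theta> x t) / 2)"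
      unfolding cis_mult \<phi>_def by (rule arg_cong[of _ _ cis]) (simp add: field_simps)
    then show ?thesis
      unfolding curve_point_step[OF pot[OF xt] pot'[OF xt]] rotation_vec2
      by (simp flip: vec2_scaleR)
  qed

  show ?case
    unfolding z prod.case vector_derivative_at[OF gd] \<phi>_def[symmetric]
  proof (intro conjI)
    show "(\<lambda>s. \<theta> s t) differentiable at x"
      using dx(1) real_differentiable_def by blast
    show "deriv (\<lambda>s. \<theta> s t) differentiable at x"
      using dd(1) real_differentiable_def by blast
    show "(\<lambda>s. curve_point (\<lambda>y. of_real (r s t * exp (- (s + S) * y)) * tdet N p u v s t y) y) differentiable at x"
      using gd by (rule differentiableI_vector)
  qed (fact x_eq t_eq g_eq)+
qed

end

section \<open>Lattice shifts\<close>

text \<open>Rotating \<open>Y\<close> by \<open>- \<phi> / 2\<close> gives a number equal to its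
  conjugate. So \<open>Y\<close> is a real multiple of \<open>cis (\<phi> / 2)\<close>, possibly a
  negative one, to which the tangent is insensitive.\<close>

lemma tan_half_angle:
  assumes Y: "cis \<phi> * cnj Y = Y" "Y \<noteq> 0" and c: "cos (\<phi> / 2) \<noteq> 0"
  shows "Re Y \<noteq> 0" "tan (\<phi> / 2) = Im Y / Re Y"
proof -
  define Z where "Z = cis (- (\<phi> / 2)) * Y"
  have "cnj Z = cis (\<phi> / 2) * cnj Y" by (simp add: Z_def cis_cnj)
  also have "cis (\<phi> / 2) = cis (- (\<phi> / 2)) * cis \<phi>" by (simp add: cis_mult)
  also have "cis (- (\<phi> / 2)) * cis \<phi> * cnj Y = Z" using Y(1) by (simp add: Z_def mult.assoc)
  finally have "Im Z = 0" by (simp add: complex_eq_iff)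
  then have eq: "Im Y * cos (\<phi> / 2) = Re Y * sin (\<phi> / 2)"
    by (simp add: Z_def algebra_simps)
  show R: "Re Y \<noteq> 0"
  proof
    assume "Re Y = 0"
    with eq c have "Im Y = 0" by simp
    with \<open>Re Y = 0\<close> Y(2) show False by (simp add: complex_eq_iff)
  qed
  show "tan (\<phi> / 2) = Im Y / Re Y"
    using eq c R by (simp add: tan_def field_simps)
qed

text \<open>The combination \<open>c X - a cnj X\<close> multiplies the real part of
  \<open>X\<close> by \<open>c - a\<close> and the imaginary part by \<open>c + a\<close>. This is
  the origin of the quotient in the tangent equations.\<close>

lemma tan_half_angle_transfer:
  fixes a c g :: real
  assumes Y: "cis \<phi> * cnj Y = Y" "Y \<noteq> 0" "cos (\<phi> / 2) \<noteq> 0"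
    and X: "cis \<psi> * cnj X = X" "X \<noteq> 0" "cos (\<psi> / 2) \<noteq> 0"
    and g: "g \<noteq> 0" and eq: "of_real g * Y = of_real c * X - of_real a * cnj X"
  shows "tan (\<phi> / 2) = (c + a) / (c - a) * tan (\<psi> / 2)"
proof -
  note y = tan_half_angle[OF Y] and x = tan_half_angle[OF X]
  have re: "g * Re Y = (c - a) * Re X" and im: "g * Im Y = (c + a) * Im X"
    using arg_cong[OF eq, of Re] arg_cong[OF eq, of Im] by (simp_all add: algebra_simps)
  have "tan (\<phi> / 2) = (g * Im Y) / (g * Re Y)" using g y by simp
  also have "\<dots> = (c + a) / (c - a) * tan (\<psi> / 2)" unfolding re im x(2) by simp
  finally show ?thesis .
qed

section \<open>Shifts of the discrete variables as borderings\<close>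

definition fwd :: "complex \<Rightarrow> (nat \<Rightarrow> complex) \<Rightarrow> (nat \<Rightarrow> complex) \<Rightarrow> nat \<Rightarrow> complex" where
  "fwd a p u i = u i * inverse (1 - a * p i)"

definition regular :: "nat \<Rightarrow> complex \<Rightarrow> (nat \<Rightarrow> complex) \<Rightarrow> bool" where
  "regular N a p \<longleftrightarrow> (\<forall>i<N. 1 - a * p i \<noteq> 0 \<and> 1 + a * p i \<noteq> 0)"

lemma prod_permutes_real:
  fixes N :: nat
  assumes \<pi>: "\<pi> permutes {0..<N}" and h: "\<And>i. i < N \<Longrightarrow> cnj (h i) = h (\<pi> i)"
  shows "(\<Prod>i<N. h i) \<in> \<real>"
proof -
  have "cnj (\<Prod>i<N. h i) = (\<Prod>i\<in>{0..<N}. h (\<pi> i))"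
    unfolding cnj_prod lessThan_atLeast0 using h by (intro prod.cong) auto
  also have "\<dots> = (\<Prod>i\<in>{0..<N}. h i)" using prod.permute[OF \<pi>, of h] by (simp add: o_def)
  finally show ?thesis by (simp add: Reals_cnj_iff atLeast0LessThan)
qed

text \<open>Extending the fractions makes both denominators
  \<open>1 - a\<^sup>2 * (p i)\<^sup>2\<close>. This factor is even in \<open>p i\<close>, hence
  common to both terms of a row, and only linear factors remain inside the determinant.\<close>

lemma tdet_fwd:
  assumes "regular N a p"
  shows "tdet N p (fwd a p u) (fwd (- a) p v) x t y
    = (\<Prod>i<N. inverse (1 - a\<^sup>2 * (p i)\<^sup>2))
      * cdet N p (\<lambda>i. u i * wave (p i) x t y * (1 + a * p i)) (\<lambda>i. v i * wave (- p i) x t y * (1 - a * p i))"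
proof -
  have f: "1 - a\<^sup>2 * (p i)\<^sup>2 = (1 - a * p i) * (1 + a * p i)" for i
    by (simp add: power2_eq_square algebra_simps)
  have r: "1 - a * p i \<noteq> 0" "1 + a * p i \<noteq> 0" if "i < N" for i
    using assms that by (auto simp: regular_def)
  have inv: "inverse c = inverse (c * d) * d" "inverse d = inverse (c * d) * c"
    if "c \<noteq> 0" "d \<noteq> 0" for c d :: complex
    using that by (simp_all add: field_simps)
  have "inverse (1 - a * p i) = inverse (1 - a\<^sup>2 * (p i)\<^sup>2) * (1 + a * p i)"
    and "inverse (1 + a * p i) = inverse (1 - a\<^sup>2 * (p i)\<^sup>2) * (1 - a * p i)" if "i < N" for i
    unfolding f by (rule inv[OF r(1)[OF that] r(2)[OF that]])+
  then show ?thesis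
    unfolding cdet_scale_rows[symmetric] tdet_def
    by (intro cdet_cong) (simp_all add: fwd_def mult_ac)
qed

lemma conj_sym_fwd:
  assumes "conj_sym \<pi> N p u v"
  shows "conj_sym \<pi> N p (fwd (of_real a) p u) (fwd (- of_real a) p v)"
  using assms by (auto simp: conj_sym_def fwd_def)

text \<open>A shift with parameter \<open>a\<close> is the bordering by the row \<open>(1, w, w\<^sup>2, ...)\<close>, \<open>w = - 1 / a\<close>. The exponential of
  \<open>y\<close> in \<open>wave w\<close> is the one that the shift brings into the prefactor of the tau function.\<close>

lemma tdet_fwd_bordered:
  fixes a :: real
  assumes sym: "conj_sym \<pi> N p u v" and a: "a \<noteq> 0" and reg: "regular N (of_real a) p"
  obtains r :: "real \<Rightarrow> real \<Rightarrow> real" where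
    "\<And>x t y. of_real (exp (- a * y)) * tdet N p (fwd (of_real a) p u) (fwd (- of_real a) p v) x t y
      = of_real (r x t) * tdet (Suc N) (p(N := of_real (- 1 / a))) (u(N := 1)) (v(N := 0)) x t y"
proof -
  let ?K = "\<Prod>i<N. inverse (1 - (of_real a)\<^sup>2 * (p i)\<^sup>2)"
  let ?w = "complex_of_real (- 1 / a)"
  have "?K \<in> \<real>"
    using sym by (intro prod_permutes_real[of \<pi>]) (auto simp: conj_sym_def)
  then obtain K where K: "?K = complex_of_real K" by (auto elim: Reals_cases)
  \<comment> \<open>\<open>K\<close> collects the common denominators, \<open>(- a) ^ N\<close>
    combines the scaling of the rows by \<open>a\<close> with the sign of the bordering, and the
    exponential compensates the part of \<open>wave ?w\<close> that depends on \<open>x\<close> and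
    \<open>t\<close>.\<close>
  define r where "r x t = K * (- a) ^ N * exp (x / a - 4 * t / a ^ 3)" for x t
  have "of_real (exp (- a * y)) * tdet N p (fwd (of_real a) p u) (fwd (- of_real a) p v) x t y
      = of_real (r x t) * tdet (Suc N) (p(N := ?w)) (u(N := 1)) (v(N := 0)) x t y" for x t y
  proof -
    let ?A = "\<lambda>i. u i * wave (p i) x t y" and ?B = "\<lambda>i. v i * wave (- p i) x t y"
    let ?F = "cdet N p (\<lambda>i. ?A i * (p i - ?w)) (\<lambda>i. ?B i * (- p i - ?w))"
    have "cdet N p (\<lambda>i. ?A i * (1 + of_real a * p i)) (\<lambda>i. ?B i * (1 - of_real a * p i))
        = cdet N p (\<lambda>i. of_real a * (?A i * (p i - ?w))) (\<lambda>i. of_real a * (?B i * (- p i - ?w)))"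
      using a by (intro cdet_cong) (simp_all add: field_simps)
    also have "\<dots> = of_real a ^ N * ?F" by (simp add: cdet_scale_rows)
    finally have 1: "tdet N p (fwd (of_real a) p u) (fwd (- of_real a) p v) x t y = of_real K * of_real a ^ N * ?F"
      unfolding tdet_fwd[OF reg] K by simp
    have "tdet (Suc N) (p(N := ?w)) (u(N := 1)) (v(N := 0)) x t y
        = cdet (Suc N) (p(N := ?w)) (\<lambda>i. (if i = N then wave ?w x t y else 1) * (?A(N := 1)) i)
            (\<lambda>i. (if i = N then wave ?w x t y else 1) * (?B(N := 0)) i)"
      unfolding tdet_def by (rule cdet_cong) auto
    also have "\<dots> = wave ?w x t y * ((-1) ^ N * ?F)"
      unfolding cdet_scale_rows cdet_christoffel by simp
    finally have 2: "tdet (Suc N) (p(N := ?w)) (u(N := 1)) (v(N := 0)) x t y = wave ?w x t y * ((-1) ^ N * ?F)" .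
    have "?w * of_real x - 4 * ?w ^ 3 * of_real t + 1 / ?w * of_real y
        = of_real (- x / a + 4 * t / a ^ 3 - a * y)"
      using a by (simp add: power_divide)
    then have w: "wave ?w x t y = of_real (exp (- x / a + 4 * t / a ^ 3 - a * y))"
      by (simp only: wave_def exp_of_real)
    have "exp (- a * y) = exp (x / a - 4 * t / a ^ 3) * exp (- x / a + 4 * t / a ^ 3 - a * y)"
      by (simp flip: exp_add)
    then have e: "complex_of_real (exp (- a * y)) = of_real (exp (x / a - 4 * t / a ^ 3)) * wave ?w x t y"
      unfolding w of_real_mult[symmetric] by (rule arg_cong)
    have s: "complex_of_real ((- a) ^ N) * (-1) ^ N = of_real a ^ N"
      by (simp add: power_mult_distrib[symmetric])
    have "of_real (exp (- a * y)) * tdet N p (fwd (of_real a) p u) (fwd (- of_real a) p v) x t y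
      = of_real K * of_real (exp (x / a - 4 * t / a ^ 3)) * wave ?w x t y * (of_real a ^ N * ?F)"
      unfolding 1 e by (simp only: mult_ac)
    also have "\<dots> = of_real (r x t) * (wave ?w x t y * ((-1) ^ N * ?F))"
      unfolding s[symmetric] r_def of_real_mult by (simp only: mult_ac)
    finally show ?thesis unfolding 2 .
  qed
  then show ?thesis by (rule that)
qed

definition fwd_inv :: "complex \<Rightarrow> (nat \<Rightarrow> complex) \<Rightarrow> (nat \<Rightarrow> complex) \<Rightarrow> nat \<Rightarrow> complex" where
  "fwd_inv d p u i = u i * inverse (1 - d / p i)"

text \<open>Since \<open>1 - d / p = - (d / p) (1 - p / d)\<close>, a shift in \<open>l\<close> is a shift with parameter \<open>1 / d\<close>
  combined with a complex conjugation.\<close>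

lemma tdet_fwd_inv_bordered:
  fixes d :: real
  assumes sym: "conj_sym \<pi> N p u v" and d: "d \<noteq> 0"
    and reg: "\<And>i. i < N \<Longrightarrow> p i \<noteq> 0 \<and> 1 - of_real d / p i \<noteq> 0 \<and> 1 + of_real d / p i \<noteq> 0"
  obtains r :: "real \<Rightarrow> real \<Rightarrow> real" where
    "\<And>x t y. of_real (exp (- (1 / d) * y)) * tdet N p (fwd_inv (of_real d) p u) (fwd_inv (- of_real d) p v) x t y
      = of_real (r x t) * cnj (tdet (Suc N) (p(N := of_real (- d))) (u(N := 1)) (v(N := 0)) x t y)"
proof -
  let ?w = "complex_of_real (- d)"
  let ?h = "\<lambda>i. p i / ((p i)\<^sup>2 - (of_real d)\<^sup>2)"
  let ?K = "\<Prod>i<N. ?h i"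
  interpret darboux \<pi> N p u v "- d" 1 0
    using sym reg d by unfold_locales auto
  have "?K \<in> \<real>"
    using sym by (intro prod_permutes_real[of \<pi>]) (auto simp: conj_sym_def)
  then obtain K where K: "?K = complex_of_real K" by (auto elim: Reals_cases)
  \<comment> \<open>Here the common factor \<open>?h i\<close> is odd in \<open>p i\<close>. The
    resulting minus sign in the second equation turns \<open>v\<close> into \<open>- v\<close>, so
    it is the conjugate determinant that gets bordered.\<close>
  have h: "inverse (1 - of_real d / p i) = ?h i * (p i - ?w)"
    "inverse (1 + of_real d / p i) = - (?h i * (- p i - ?w))" if "i < N" for i
  proof -
    have nz: "p i \<noteq> 0" "p i - of_real d \<noteq> 0" "p i + of_real d \<noteq> 0"
      using reg[OF that] by (auto simp: field_simps)
    have f: "(p i)\<^sup>2 - (of_real d)\<^sup>2 = (p i - of_real d) * (p i + of_real d)"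
      by (simp add: power2_eq_square algebra_simps)
    have q: "1 - of_real d / p i = (p i - of_real d) / p i" "1 + of_real d / p i = (p i + of_real d) / p i"
      using nz by (simp_all add: field_simps)
    have w: "p i - ?w = p i + of_real d" "- p i - ?w = - (p i - of_real d)" by simp_all
    have gen: "inverse (c / z) = z / (c * e) * e" "inverse (e / z) = - (z / (c * e) * (- c))"
      if "z \<noteq> 0" "c \<noteq> 0" "e \<noteq> 0" for z c e :: complex
      using that by simp_all
    show "inverse (1 - of_real d / p i) = ?h i * (p i - ?w)"
      "inverse (1 + of_real d / p i) = - (?h i * (- p i - ?w))"
      unfolding f q w by (rule gen[OF nz])+
  qed
  define sg where "sg = (of_int (sign \<pi>) :: real)"
  define r where "r x t = K * (-1) ^ N * sg * exp (d * x - 4 * d ^ 3 * t)" for x t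
  have "of_real (exp (- (1 / d) * y)) * tdet N p (fwd_inv (of_real d) p u) (fwd_inv (- of_real d) p v) x t y
      = of_real (r x t) * cnj (tdet (Suc N) p' u' v' x t y)" for x t y
  proof -
    let ?A = "\<lambda>i. u i * wave (p i) x t y" and ?B = "- (\<lambda>i. v i * wave (- p i) x t y)"
    let ?F = "cdet N p (\<lambda>i. ?A i * (p i - ?w)) (\<lambda>i. ?B i * (- p i - ?w))"
    have "tdet N p (fwd_inv (of_real d) p u) (fwd_inv (- of_real d) p v) x t y
        = cdet N p (\<lambda>i. ?h i * (?A i * (p i - ?w))) (\<lambda>i. ?h i * (?B i * (- p i - ?w)))"
      unfolding tdet_def using h by (intro cdet_cong) (simp_all add: fwd_inv_def)
    also have "\<dots> = of_real K * ?F" unfolding cdet_scale_rows K ..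
    finally have 1: "tdet N p (fwd_inv (of_real d) p u) (fwd_inv (- of_real d) p v) x t y = of_real K * ?F" .
    have "tdet (Suc N) p' u' (- v') x t y
        = cdet (Suc N) p' (\<lambda>i. (if i = N then wave ?w x t y else 1) * (?A(N := 1)) i)
            (\<lambda>i. (if i = N then wave ?w x t y else 1) * (?B(N := 0)) i)"
      unfolding tdet_def by (rule cdet_cong) auto
    also have "\<dots> = wave ?w x t y * ((-1) ^ N * ?F)"
      unfolding cdet_scale_rows cdet_christoffel by simp
    finally have "cnj (tdet (Suc N) p' u' v' x t y) = of_real sg * (wave ?w x t y * ((-1) ^ N * ?F))"
      unfolding cnj_tdet[OF sym'] by (simp add: sg_def)
    then have 2: "of_real sg * cnj (tdet (Suc N) p' u' v' x t y)
        = of_real (sg * sg) * (wave ?w x t y * ((-1) ^ N * ?F))" by simp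
    have sg2: "sg * sg = 1" by (simp add: sg_def sign_def)
    have "?w * of_real x - 4 * ?w ^ 3 * of_real t + 1 / ?w * of_real y
        = of_real (- d * x + 4 * d ^ 3 * t - 1 / d * y)"
      by simp
    then have w: "wave ?w x t y = of_real (exp (- d * x + 4 * d ^ 3 * t - 1 / d * y))"
      by (simp only: wave_def exp_of_real)
    have "exp (- (1 / d) * y) = exp (d * x - 4 * d ^ 3 * t) * exp (- d * x + 4 * d ^ 3 * t - 1 / d * y)"
      by (simp flip: exp_add)
    then have e: "complex_of_real (exp (- (1 / d) * y)) = of_real (exp (d * x - 4 * d ^ 3 * t)) * wave ?w x t y"
      unfolding w of_real_mult[symmetric] by (rule arg_cong)
    have s: "(-1) ^ N * (-1) ^ N = (1 :: complex)" by (simp add: power_mult_distrib[symmetric])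
    have "of_real (r x t) * cnj (tdet (Suc N) p' u' v' x t y)
        = of_real K * (-1) ^ N * of_real (exp (d * x - 4 * d ^ 3 * t)) * (of_real sg * cnj (tdet (Suc N) p' u' v' x t y))"
      by (simp add: r_def mult_ac)
    also have "\<dots> = ((-1) ^ N * (-1) ^ N) * (of_real (exp (d * x - 4 * d ^ 3 * t)) * wave ?w x t y) * (of_real K * ?F)"
      unfolding 2 sg2 by (simp only: of_real_1 mult_1 mult_ac)
    finally show ?thesis unfolding 1 e s by simp
  qed
  then show ?thesis by (rule that)
qed

text \<open>Modulo \<pi>, a potential value is four times the argument divided evenly:
  \<open>z\<close> has argument \<open>r / 4\<close>. Hence \<open>z * cnj w\<close> carries the
  quarter of the difference \<open>r - s\<close> that appears in the tangent equations.\<close>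

lemma potential_value_quotient:
  assumes z: "potential_value (of_real \<rho> * z) r" and w: "potential_value (of_real \<rho>' * w) s"
  shows "cis ((r - s) / 2) * cnj (z * cnj w) = z * cnj w" "z * cnj w \<noteq> 0"
proof -
  have nz: "\<rho> \<noteq> 0" "z \<noteq> 0" "\<rho>' \<noteq> 0" "w \<noteq> 0"
    using z w by (auto simp: potential_value_iff)
  have z': "cis (r / 2) = z / cnj z" and w': "cis (s / 2) = w / cnj w"
    using z w nz by (simp_all add: potential_value_iff)
  have "cis ((r - s) / 2) = cis (r / 2) / cis (s / 2)" by (simp add: cis_divide diff_divide_distrib)
  also have "\<dots> = z * cnj w / (cnj z * w)" unfolding z' w' using nz by (simp add: field_simps)
  finally show "cis ((r - s) / 2) * cnj (z * cnj w) = z * cnj w" using nz by simp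
  show "z * cnj w \<noteq> 0" using nz by simp
qed

section \<open>Types III and IV as types I and II for the negated angle and the reflected
  curve\<close>

lemma reflection_reflection: "reflection *v (reflection *v w) = w"
  by (simp add: reflection_def Finite_Cartesian_Product.vec_eq_iff forall_2 matrix_vector_mult_def sum_2)

lemma baecklund_III_if_I:
  assumes "baecklund_I U lam \<theta> \<gamma> (\<lambda>x t. - \<theta>' x t) (\<lambda>x t. reflection *v \<gamma>' x t)"
  shows "baecklund_III U lam \<theta> \<gamma> \<theta>' \<gamma>'"
proof -
  have a: "(- \<theta>' x t - \<theta> x t) / 2 = - ((\<theta>' x t + \<theta> x t) / 2)"
    "- (\<theta>' x t + \<theta> x t) / 2 = - ((\<theta>' x t + \<theta> x t) / 2)" for x t
    by (simp_all add: field_simps)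
  have d: "((\<lambda>s. (f s - g s) / 2) has_real_derivative D) (at x)"
    if "((\<lambda>s. (- f s + g s) / 2) has_real_derivative - D) (at x)" for f g :: "real \<Rightarrow> real" and D x
    using DERIV_minus[OF that] by (simp add: minus_divide_left)
  have r: "w = reflection *v v" if "reflection *v w = v" for v w
    using that reflection_reflection[of w] by simp
  show ?thesis
    unfolding baecklund_III_def a
  proof (intro conjI ballI, goal_cases)
    case 1
    show ?case using assms by (simp add: baecklund_I_def)
  next
    case (2 z)
    obtain x t where z: "z = (x, t)" by (cases z)
    note H = bspec[OF conjunct2[OF assms[unfolded baecklund_I_def a]] 2,
        unfolded z prod.case sin_minus cos_minus]
    let ?R = "- lam * ((deriv (\<lambda>s. \<theta> s t) x)\<^sup>2 + 8 * lam\<^sup>2) * sin ((\<theta>' x t + \<theta> x t) / 2)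
        - 2 * lam * deriv (deriv (\<lambda>s. \<theta> s t)) x * cos ((\<theta>' x t + \<theta> x t) / 2)
        - 4 * lam\<^sup>2 * deriv (\<lambda>s. \<theta> s t) x"
    have "((\<lambda>s. (- \<theta>' x s + \<theta> x s) / 2) has_real_derivative - ?R) (at t)"
      by (rule DERIV_cong, use H in blast) (simp add: algebra_simps)
    note tt = d[OF this]
    have "((\<lambda>s. (- \<theta>' s t + \<theta> s t) / 2) has_real_derivative
        - (2 * lam * sin ((\<theta>' x t + \<theta> x t) / 2))) (at x)"
      by (rule DERIV_cong, use H in blast) simp
    note xx = d[OF this]
    show ?case unfolding z prod.case using H xx tt r by blast
  qed
qed

lemma baecklund_IV_if_II:
  assumes "baecklund_II a b D D' lam \<Theta> \<gamma> (\<lambda>n m. - \<Theta>' n m) (\<lambda>n m. reflection *v \<gamma>' n m)"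
  shows "baecklund_IV a b D D' lam \<Theta> \<gamma> \<Theta>' \<gamma>'"
proof -
  have a: "(- \<Theta>' n m - \<Theta> n' m') / 4 = - ((\<Theta>' n m + \<Theta> n' m') / 4)"
    "(- \<Theta>' n m - \<Theta> n' m') / 2 = - (\<Theta>' n m + \<Theta> n' m') / 2" for n m n' m'
    by (simp_all add: field_simps)
  have r: "w = reflection *v v" if "reflection *v w = v" for v w
    using that reflection_reflection[of w] by simp
  show ?thesis
    using assms unfolding baecklund_II_def baecklund_IV_def a tan_minus cos_minus
    by (auto intro!: r)
qed

context darboux
begin

text \<open>\<open>cdet_three_term\<close> with the denominators restored. The old rows contribute
  the same product everywhere, whereas the new row may carry any real factor \<open>g\<close>, so
  that both a row advancing with the lattice and a constant one are covered.\<close>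

lemma tdet_three_term:
  fixes a g :: real
  assumes reg: "regular N (of_real a) p"
    and nz: "tdet N p u v x t y \<noteq> 0" "tdet N p u (- v) x t y \<noteq> 0" "tdet (Suc N) p' u' v' x t y \<noteq> 0"
  defines "u1 \<equiv> fwd (of_real a) p u" and "v1 \<equiv> fwd (- of_real a) p v"
  defines "al1 \<equiv> of_real g * (al * (1 + of_real a * of_real pe))"
    and "be1 \<equiv> of_real g * (be * (1 - of_real a * of_real pe))"
  shows "tdet (Suc N) p' (u1(N := al1)) (v1(N := be1)) x t y * tdet N p u (- v) x t y
    = of_real g * (tdet (Suc N) p' u' v' x t y * tdet N p u1 (- v1) x t y
      + of_real (a * pe) * tdet (Suc N) p' u' (- v') x t y * tdet N p u1 v1 x t y)"
proof -
  let ?a = "complex_of_real a" and ?pe = "complex_of_real pe"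
  let ?A = "\<lambda>i. u i * wave (p i) x t y" and ?B = "\<lambda>i. v i * wave (- p i) x t y"
  let ?al = "al * wave ?pe x t y" and ?be = "be * wave (- ?pe) x t y"
  let ?A1 = "\<lambda>i. ?A i * (1 + ?a * p i)" and ?B1 = "\<lambda>i. ?B i * (1 - ?a * p i)"
  let ?K = "\<Prod>i<N. inverse (1 - ?a\<^sup>2 * (p i)\<^sup>2)"
  have mv1: "- v1 = fwd (- ?a) p (- v)" by (auto simp: v1_def fwd_def)
  have B1: "(\<lambda>i. (- v) i * wave (- p i) x t y * (1 - ?a * p i)) = - ?B1" by auto
  have 1: "tdet N p u1 v1 x t y = ?K * cdet N p ?A1 ?B1"
    unfolding u1_def v1_def by (rule tdet_fwd[OF reg])
  have 2: "tdet N p u1 (- v1) x t y = ?K * cdet N p ?A1 (- ?B1)"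
    using tdet_fwd[OF reg, of u "- v" x t y] unfolding B1 u1_def mv1 .
  have A': "(\<lambda>i. u' i * wave (p' i) x t y) = ?A(N := ?al)"
    and B': "(\<lambda>i. v' i * wave (- p' i) x t y) = ?B(N := ?be)"
    and Bs': "(\<lambda>i. (- v') i * wave (- p' i) x t y) = (- ?B)(N := - ?be)"
    by auto
  let ?c = "\<lambda>i. if i = N then of_real g else inverse (1 - ?a\<^sup>2 * (p i)\<^sup>2)"
  have row: "fwd ?a p w i = inverse (1 - ?a\<^sup>2 * (p i)\<^sup>2) * (w i * (1 + ?a * p i))"
    "fwd (- ?a) p w i = inverse (1 - ?a\<^sup>2 * (p i)\<^sup>2) * (w i * (1 - ?a * p i))" if "i < N" for w i
  proof -
    have f: "1 - ?a\<^sup>2 * (p i)\<^sup>2 = (1 - ?a * p i) * (1 + ?a * p i)"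
      by (simp add: power2_eq_square algebra_simps)
    have nz: "1 - ?a * p i \<noteq> 0" "1 + ?a * p i \<noteq> 0" using reg that by (auto simp: regular_def)
    have gen: "z * inverse c = inverse (c * d) * (z * d)" "z * inverse d = inverse (c * d) * (z * c)"
      if "c \<noteq> 0" "d \<noteq> 0" for z c d :: complex
      using that by (simp_all add: field_simps)
    show "fwd ?a p w i = inverse (1 - ?a\<^sup>2 * (p i)\<^sup>2) * (w i * (1 + ?a * p i))"
      unfolding fwd_def f by (rule gen[OF nz])
    show "fwd (- ?a) p w i = inverse (1 - ?a\<^sup>2 * (p i)\<^sup>2) * (w i * (1 - ?a * p i))"
      unfolding fwd_def f using gen(2)[OF nz] by simp
  qed
  have K: "(\<Prod>i<N. ?c i) * (if N = N then of_real g else z) = of_real g * ?K" for z by simp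
  have "tdet (Suc N) p' (u1(N := al1)) (v1(N := be1)) x t y
      = cdet (Suc N) p' (\<lambda>i. ?c i * (?A1(N := ?al * (1 + ?a * ?pe))) i)
          (\<lambda>i. ?c i * (?B1(N := ?be * (1 - ?a * ?pe))) i)"
    unfolding tdet_def u1_def v1_def
    by (rule cdet_cong) (auto simp: less_Suc_eq row al1_def be1_def)
  also have "\<dots> = of_real g * ?K * cdet (Suc N) p' (?A1(N := ?al * (1 + ?a * ?pe))) (?B1(N := ?be * (1 - ?a * ?pe)))"
    unfolding cdet_scale_rows by (simp only: prod.lessThan_Suc K)
  finally have 3: "tdet (Suc N) p' (u1(N := al1)) (v1(N := be1)) x t y
    = of_real g * ?K * cdet (Suc N) p' (?A1(N := ?al * (1 + ?a * ?pe))) (?B1(N := ?be * (1 - ?a * ?pe)))" .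
  have "cdet (Suc N) p' (?A1(N := ?al * (1 + ?a * ?pe))) (?B1(N := ?be * (1 - ?a * ?pe))) * cdet N p ?A (- ?B)
    = cdet (Suc N) p' (?A(N := ?al)) (?B(N := ?be)) * cdet N p ?A1 (- ?B1)
      + ?a * ?pe * cdet (Suc N) p' (?A(N := ?al)) ((- ?B)(N := - ?be)) * cdet N p ?A1 ?B1"
    using nz unfolding tdet_star[of N] unfolding tdet_def A' B' by (rule cdet_three_term)
  moreover have "tdet N p u (- v) x t y = cdet N p ?A (- ?B)" by (rule tdet_star)
  moreover have "tdet (Suc N) p' u' v' x t y = cdet (Suc N) p' (?A(N := ?al)) (?B(N := ?be))"
    unfolding tdet_def A' B' ..
  moreover have "tdet (Suc N) p' u' (- v') x t y = cdet (Suc N) p' (?A(N := ?al)) ((- ?B)(N := - ?be))"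
    unfolding tdet_def A' Bs' ..
  moreover have "g1 * K * z * ds = g1 * (e * (K * f1) + of_real (a * pe) * es * (K * f))"
    if "z * ds = e * f1 + ?a * ?pe * es * f" for g1 K z ds e f1 es f :: complex
  proof -
    have "g1 * K * z * ds = g1 * K * (z * ds)" by simp
    then show ?thesis unfolding that by (simp add: algebra_simps)
  qed
  ultimately show ?thesis unfolding 1 2 3 by (simp only:)
qed

text \<open>Complex conjugation identifies the two summands of the three-term identity, up to real
  factors, as \<open>X\<close> and \<open>cnj X\<close>, which gives
  \<open>Y = g (X + a pe cnj X)\<close>. Division by \<open>- pe * g\<close> brings this to the form
  required for comparing tangents, with \<open>c = 1 / - pe\<close>.\<close>

lemma tan_step:
  fixes a g :: real
  assumes reg: "regular N (of_real a) p"
  defines "u1 \<equiv> fwd (of_real a) p u" and "v1 \<equiv> fwd (- of_real a) p v"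
  defines "al1 \<equiv> of_real g * (al * (1 + of_real a * of_real pe))"
    and "be1 \<equiv> of_real g * (be * (1 - of_real a * of_real pe))"
  assumes g: "g \<noteq> 0"
    and pot0: "potential_value (of_real \<rho>0 * tdet N p u v x t y) \<theta>0"
    and pot0': "potential_value (of_real \<rho>0' * tdet (Suc N) p' u' v' x t y) \<theta>0'"
    and pot1: "potential_value (of_real \<rho>1 * tdet N p u1 v1 x t y) \<theta>1"
    and pot1': "potential_value (of_real \<rho>1' * tdet (Suc N) p' (u1(N := al1)) (v1(N := be1)) x t y) \<theta>1'"
    and cos: "cos ((\<theta>1' - \<theta>0) / 4) \<noteq> 0" "cos ((\<theta>0' - \<theta>1) / 4) \<noteq> 0"
  shows "tan ((\<theta>1' - \<theta>0) / 4) = (1 / - pe + a) / (1 / - pe - a) * tan ((\<theta>0' - \<theta>1) / 4)"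
proof -
  note nz0 = tdet_potential(1,2)[OF sym pot0] and nz0' = tdet_potential(1)[OF sym' pot0']
  define Y where "Y = tdet (Suc N) p' (u1(N := al1)) (v1(N := be1)) x t y * cnj (tdet N p u v x t y)"
  define X where "X = tdet (Suc N) p' u' v' x t y * cnj (tdet N p u1 v1 x t y)"
  have Y: "cis ((\<theta>1' - \<theta>0) / 2) * cnj Y = Y" "Y \<noteq> 0"
    unfolding Y_def by (rule potential_value_quotient[OF pot1' pot0])+
  have X: "cis ((\<theta>0' - \<theta>1) / 2) * cnj X = X" "X \<noteq> 0"
    unfolding X_def by (rule potential_value_quotient[OF pot0' pot1])+
  have "Y = signof \<pi> * (tdet (Suc N) p' (u1(N := al1)) (v1(N := be1)) x t y * tdet N p u (- v) x t y)"
    unfolding Y_def cnj_tdet[OF sym] by (rule mult.left_commute)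
  also have "\<dots> = of_real g * (tdet (Suc N) p' u' v' x t y * (signof \<pi> * tdet N p u1 (- v1) x t y)
      + of_real (a * pe) * (signof \<pi> * tdet (Suc N) p' u' (- v') x t y) * tdet N p u1 v1 x t y)"
    unfolding tdet_three_term[OF reg nz0 nz0', of g, folded u1_def v1_def, folded al1_def be1_def]
    by (simp add: algebra_simps)
  also have "\<dots> = of_real g * (X + of_real (a * pe) * cnj X)"
  proof -
    have "conj_sym \<pi> N p u1 v1" unfolding u1_def v1_def by (rule conj_sym_fwd[OF sym])
    note c1 = cnj_tdet[OF this, of x t y]
    have "X = tdet (Suc N) p' u' v' x t y * (signof \<pi> * tdet N p u1 (- v1) x t y)"
      unfolding X_def c1 ..
    moreover have "cnj X = (signof \<pi> * tdet (Suc N) p' u' (- v') x t y) * tdet N p u1 v1 x t y"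
      unfolding X_def complex_cnj_mult complex_cnj_cnj cnj_tdet[OF sym'] ..
    ultimately show ?thesis by (simp only: mult.assoc)
  qed
  finally have "Y = of_real g * (X + of_real (a * pe) * cnj X)" .
  then have eq: "of_real (1 / (- pe * g)) * Y = of_real (1 / - pe) * X - of_real a * cnj X"
    using g pe_nz by (simp add: field_simps)
  have g': "1 / (- pe * g) \<noteq> 0" using g pe_nz by simp
  have "cos ((\<theta>1' - \<theta>0) / 2 / 2) \<noteq> 0" "cos ((\<theta>0' - \<theta>1) / 2 / 2) \<noteq> 0" using cos by simp_all
  from tan_half_angle_transfer[OF Y this(1) X this(2) g' eq] show ?thesis by simp
qed

end

lemma tdet_cong:
  assumes "\<And>i. i < N \<Longrightarrow> p i = q i" "\<And>i. i < N \<Longrightarrow> u i = u' i" "\<And>i. i < N \<Longrightarrow> v i = v' i"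
  shows "tdet N p u v x t y = tdet N q u' v' x t y"
  unfolding tdet_def using assms by (intro cdet_cong) auto

text \<open>Every site is an instance of \<open>darboux\<close> with its own coefficients but common
  \<open>\<pi>\<close>, \<open>p\<close> and \<open>pe\<close>. Between neighbouring sites the new
  row may be rescaled by a non-zero real \<open>g\<close>, which multiplies the bordered determinant
  by \<open>g\<close> and leaves \<open>z / cnj z\<close> unchanged.\<close>

lemma baecklund_II_tdet:
  fixes a b :: "int \<Rightarrow> real" and u v :: "int \<Rightarrow> int \<Rightarrow> nat \<Rightarrow> complex"
    and al be :: "int \<Rightarrow> int \<Rightarrow> complex" and c r' :: "int \<Rightarrow> int \<Rightarrow> real" and pe :: real
  assumes sym: "\<And>n m. (n, m) \<in> D \<Longrightarrow> conj_sym \<pi> N p (u n m) (v n m)"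
    and p_nz: "D \<noteq> {} \<Longrightarrow> \<forall>i<N. p i \<noteq> 0" and pe: "pe \<noteq> 0"
    and ext: "\<And>n m. (n, m) \<in> D \<inter> D' \<Longrightarrow> cnj (al n m) = al n m \<and> cnj (be n m) = - be n m"
    and pot: "\<And>n m. (n, m) \<in> D \<Longrightarrow>
      potential_value (of_real (exp (- c n m * y)) * tdet N p (u n m) (v n m) x t y) (\<Theta> n m)"
    and pot': "\<And>n m. (n, m) \<in> D \<inter> D' \<Longrightarrow>
      potential_value (of_real (r' n m * exp (- c n m * y)) * tdet (Suc N) (p(N := of_real pe))
        ((u n m)(N := al n m)) ((v n m)(N := be n m)) x t y) (\<Theta>' n m)"
    and step_n: "\<And>n m. (n, m) \<in> D \<Longrightarrow> (n + 1, m) \<in> D \<Longrightarrow>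
      regular N (of_real (a n)) p \<and> c (n + 1) m = c n m + a n \<and>
      (\<forall>i<N. u (n + 1) m i = fwd (of_real (a n)) p (u n m) i \<and> v (n + 1) m i = fwd (- of_real (a n)) p (v n m) i)"
    and step_m: "\<And>n m. (n, m) \<in> D \<Longrightarrow> (n, m + 1) \<in> D \<Longrightarrow>
      regular N (of_real (b m)) p \<and>
      (\<forall>i<N. u n (m + 1) i = fwd (of_real (b m)) p (u n m) i \<and> v n (m + 1) i = fwd (- of_real (b m)) p (v n m) i)"
    and ext_n: "\<And>n m. (n, m) \<in> D \<inter> D' \<Longrightarrow> (n + 1, m) \<in> D \<inter> D' \<Longrightarrow> 1 / - pe \<noteq> a n \<Longrightarrow>
      \<exists>g::real. g \<noteq> 0 \<and> al (n + 1) m = of_real g * (al n m * (1 + of_real (a n) * of_real pe))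
        \<and> be (n + 1) m = of_real g * (be n m * (1 - of_real (a n) * of_real pe))"
    and ext_m: "\<And>n m. (n, m) \<in> D \<inter> D' \<Longrightarrow> (n, m + 1) \<in> D \<inter> D' \<Longrightarrow> 1 / - pe \<noteq> b m \<Longrightarrow>
      \<exists>g::real. g \<noteq> 0 \<and> al n (m + 1) = of_real g * (al n m * (1 + of_real (b m) * of_real pe))
        \<and> be n (m + 1) = of_real g * (be n m * (1 - of_real (b m) * of_real pe))"
    and \<gamma>: "\<And>n m. (n, m) \<in> D \<Longrightarrow>
      \<gamma> n m = curve_point (\<lambda>s. of_real (exp (- c n m * s)) * tdet N p (u n m) (v n m) x t s) y"
    and \<gamma>': "\<And>n m. (n, m) \<in> D \<inter> D' \<Longrightarrow>
      \<gamma>' n m = curve_point (\<lambda>s. of_real (r' n m * exp (- c n m * s)) * tdet (Suc N) (p(N := of_real pe))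
        ((u n m)(N := al n m)) ((v n m)(N := be n m)) x t s) y"
  shows "baecklund_II a b D D' (- pe) \<Theta> \<gamma> \<Theta>' \<gamma>'"
proof -
  have site: "darboux \<pi> N p (u n m) (v n m) pe (al n m) (be n m)" if "(n, m) \<in> D \<inter> D'" for n m
    using sym[of n m] p_nz pe ext[OF that] that by unfold_locales auto
  have tan: "tan ((\<Theta>' n' m' - \<Theta> n m) / 4) = (1 / - pe + d) / (1 / - pe - d) * tan ((\<Theta>' n m - \<Theta> n' m') / 4)"
    if nm: "(n, m) \<in> D \<inter> D'" "(n', m') \<in> D \<inter> D'" and reg: "regular N (of_real d) p"
      and uv: "\<forall>i<N. u n' m' i = fwd (of_real d) p (u n m) i \<and> v n' m' i = fwd (- of_real d) p (v n m) i"
      and g_ex: "\<exists>g::real. g \<noteq> 0 \<and> al n' m' = of_real g * (al n m * (1 + of_real d * of_real pe))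
        \<and> be n' m' = of_real g * (be n m * (1 - of_real d * of_real pe))"
      and cos: "cos ((\<Theta>' n' m' - \<Theta> n m) / 4) \<noteq> 0" "cos ((\<Theta>' n m - \<Theta> n' m') / 4) \<noteq> 0"
    for n m n' m' and d :: real
  proof -
    obtain g :: real where g: "g \<noteq> 0" and al_eq: "al n' m' = of_real g * (al n m * (1 + of_real d * of_real pe))"
      and be_eq: "be n' m' = of_real g * (be n m * (1 - of_real d * of_real pe))"
      using g_ex by blast
    interpret darboux \<pi> N p "u n m" "v n m" pe "al n m" "be n m" by (rule site[OF nm(1)])
    have t: "tdet N p (u n' m') (v n' m') x t y
        = tdet N p (fwd (of_real d) p (u n m)) (fwd (- of_real d) p (v n m)) x t y"
      using uv by (intro tdet_cong) auto
    have t': "tdet (Suc N) p' ((u n' m')(N := al n' m')) ((v n' m')(N := be n' m')) x t y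
        = tdet (Suc N) p' ((fwd (of_real d) p (u n m))(N := of_real g * (al n m * (1 + of_real d * of_real pe))))
            ((fwd (- of_real d) p (v n m))(N := of_real g * (be n m * (1 - of_real d * of_real pe)))) x t y"
      using uv al_eq be_eq by (intro tdet_cong) (auto simp: less_Suc_eq)
    have D: "(n, m) \<in> D" "(n', m') \<in> D" using nm by auto
    show ?thesis
      by (rule tan_step[OF reg g pot[OF D(1)] pot'[OF nm(1)] pot[OF D(2), unfolded t] pot'[OF nm(2), unfolded t'] cos])
  qed
  have curve: "\<gamma>' n m = \<gamma> n m
      + (1 / - pe) *\<^sub>R (rotation ((\<Theta>' n m - \<Theta> (n + 1) m) / 2) *v ((\<gamma> (n + 1) m - \<gamma> n m) /\<^sub>R a n))"
    if nm: "(n, m) \<in> D \<inter> D'" and n1: "(n + 1, m) \<in> D" and an: "a n \<noteq> 0" for n m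
  proof -
    have D: "(n, m) \<in> D" using nm by simp
    have reg: "regular N (of_real (a n)) p" and c1: "c (n + 1) m = c n m + a n"
      and uv: "\<forall>i<N. u (n + 1) m i = fwd (of_real (a n)) p (u n m) i \<and> v (n + 1) m i = fwd (- of_real (a n)) p (v n m) i"
      using step_n[OF D n1] by auto
    obtain r where r: "\<And>x t y. of_real (exp (- a n * y)) * tdet N p (fwd (of_real (a n)) p (u n m)) (fwd (- of_real (a n)) p (v n m)) x t y
      = of_real (r x t) * tdet (Suc N) (p(N := of_real (- 1 / a n))) ((u n m)(N := 1)) ((v n m)(N := 0)) x t y"
      using tdet_fwd_bordered[OF sym[OF D] an reg] by blast
    have next_eq: "of_real (exp (- c (n + 1) m * s)) * tdet N p (u (n + 1) m) (v (n + 1) m) x t s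
      = of_real (r x t * exp (- c n m * s)) * tdet (Suc N) (p(N := of_real (- 1 / a n))) ((u n m)(N := 1)) ((v n m)(N := 0)) x t s" for s
    proof -
      have "tdet N p (u (n + 1) m) (v (n + 1) m) x t s
          = tdet N p (fwd (of_real (a n)) p (u n m)) (fwd (- of_real (a n)) p (v n m)) x t s"
        using uv by (intro tdet_cong) auto
      moreover have "exp (- c (n + 1) m * s) = exp (- c n m * s) * exp (- a n * s)"
        unfolding c1 by (simp add: algebra_simps flip: exp_add)
      ultimately show ?thesis
        using r[of s x t] by (simp only: of_real_mult mult.assoc) (simp only: mult.left_commute)
    qed
    \<comment> \<open>A step in \<open>n\<close> is itself a bordering, with parameter
      \<open>- 1 / a n\<close>. So \<open>curve_point_step\<close> computes the difference quotient
      of the curve as well as the displacement to the transformed curve; the rotation then adds the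
      two angles.\<close>
    interpret E: darboux \<pi> N p "u n m" "v n m" "- 1 / a n" 1 0
      using sym[OF D] p_nz D an by unfold_locales auto
    interpret darboux \<pi> N p "u n m" "v n m" pe "al n m" "be n m" by (rule site[OF nm])
    have pot0: "potential_value (of_real (1 * exp (- c n m * y)) * tdet N p (u n m) (v n m) x t y) (\<Theta> n m)"
      using pot[OF D] by simp
    have "\<gamma> (n + 1) m = \<gamma> n m + vec2 (of_real (- 1 / (- 1 / a n)) * cis ((\<Theta> (n + 1) m + \<Theta> n m) / 2))"
      unfolding \<gamma>[OF D] \<gamma>[OF n1] next_eq using E.curve_point_step[OF pot0 pot[OF n1, unfolded next_eq]] by simp
    then have "(\<gamma> (n + 1) m - \<gamma> n m) /\<^sub>R a n = vec2 (cis ((\<Theta> (n + 1) m + \<Theta> n m) / 2))"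
      using an by (simp add: vec2_scaleR)
    then have "rotation ((\<Theta>' n m - \<Theta> (n + 1) m) / 2) *v ((\<gamma> (n + 1) m - \<gamma> n m) /\<^sub>R a n)
        = vec2 (cis ((\<Theta>' n m + \<Theta> n m) / 2))"
      by (simp add: rotation_vec2 cis_mult flip: add_divide_distrib)
    moreover have "\<gamma>' n m = \<gamma> n m + vec2 (of_real (- 1 / pe) * cis ((\<Theta>' n m + \<Theta> n m) / 2))"
      unfolding \<gamma>[OF D] \<gamma>'[OF nm] using curve_point_step[OF pot0 pot'[OF nm]] by simp
    ultimately show ?thesis by (simp flip: vec2_scaleR)
  qed
  have nl: "- pe \<noteq> 0" using pe by simp
  show ?thesis
    unfolding baecklund_II_def
  proof (intro conjI allI impI, goal_cases)
    case 1
    show ?case by (rule nl)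
  next
    case (2 n m)
    then have D: "(n, m) \<in> D" "(n + 1, m) \<in> D" and DD: "(n + 1, m) \<in> D \<inter> D'" by auto
    show ?case
      using step_n[OF D] 2 by (intro tan[OF 2(1) DD] ext_n[OF 2(1) DD]) auto
  next
    case (3 n m)
    then have D: "(n, m) \<in> D" "(n, m + 1) \<in> D" and DD: "(n, m + 1) \<in> D \<inter> D'" by auto
    show ?case
      using step_m[OF D] 3 by (intro tan[OF 3(1) DD] ext_m[OF 3(1) DD]) auto
  next
    case (4 n m)
    then show ?case using curve by blast
  qed
qed

section \<open>The tau function\<close>

lemma potential_value_cnj: "potential_value z r \<Longrightarrow> potential_value (cnj z) (- r)"
proof -
  assume "potential_value z r"
  then have z: "z \<noteq> 0" "cis (r / 2) = z / cnj z" by (simp_all add: potential_value_iff)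
  have "cis (- (r / 2)) = inverse (cis (r / 2))" by simp
  also have "\<dots> = cnj z / cnj (cnj z)" unfolding z(2) by simp
  finally show ?thesis using z by (simp add: potential_value_iff)
qed

lemma baecklund_I_cong:
  assumes "baecklund_I U lam \<theta> \<gamma> \<theta>' \<gamma>1" "\<And>x t. (x, t) \<in> U \<Longrightarrow> \<gamma>' x t = \<gamma>1 x t"
  shows "baecklund_I U lam \<theta> \<gamma> \<theta>' \<gamma>'"
  using assms unfolding baecklund_I_def by fastforce

definition row_p :: "tau_params \<Rightarrow> nat \<Rightarrow> complex" where
  "row_p P i = p_par P (Suc i)"

definition row_u :: "tau_params \<Rightarrow> int \<Rightarrow> int \<Rightarrow> int \<Rightarrow> int \<Rightarrow> nat \<Rightarrow> complex" where
  "row_u P n m k l i = alpha_par P (Suc i)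
     * indef_prod (base_n P) (\<lambda>j. inverse (1 - of_real (a_seq P j) * row_p P i)) n
     * indef_prod (base_m P) (\<lambda>j. inverse (1 - of_real (b_seq P j) * row_p P i)) m
     * indef_prod (base_k P) (\<lambda>j. inverse (1 - of_real (c_seq P j) * row_p P i)) k
     * indef_prod (base_l P) (\<lambda>j. inverse (1 - of_real (d_seq P j) / row_p P i)) l"

definition row_v :: "tau_params \<Rightarrow> int \<Rightarrow> int \<Rightarrow> int \<Rightarrow> int \<Rightarrow> nat \<Rightarrow> complex" where
  "row_v P n m k l i = beta_par P (Suc i)
     * indef_prod (base_n P) (\<lambda>j. inverse (1 + of_real (a_seq P j) * row_p P i)) n
     * indef_prod (base_m P) (\<lambda>j. inverse (1 + of_real (b_seq P j) * row_p P i)) m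
     * indef_prod (base_k P) (\<lambda>j. inverse (1 + of_real (c_seq P j) * row_p P i)) k
     * indef_prod (base_l P) (\<lambda>j. inverse (1 + of_real (d_seq P j) / row_p P i)) l"

definition offset :: "tau_params \<Rightarrow> int \<Rightarrow> int \<Rightarrow> int \<Rightarrow> int \<Rightarrow> real" where
  "offset P n m k l = indef_sum (base_n P) (a_seq P) n + indef_sum (base_m P) (b_seq P) m
     + indef_sum (base_k P) (c_seq P) k + indef_sum (base_l P) (\<lambda>j. 1 / d_seq P j) l"

lemma tau_tdet:
  "tau P x t y n m k l N = of_real (exp (- (x + offset P n m k l) * y))
     * tdet N (row_p P) (row_u P n m k l) (row_v P n m k l) x t y"
proof -
  have "f_entry P (Suc i) j x t y n m k l = row_u P n m k l i * wave (row_p P i) x t y * row_p P i ^ j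
      + row_v P n m k l i * wave (- row_p P i) x t y * (- row_p P i) ^ j" for i j
    by (simp add: f_entry_def exp_eta_def exp_mu_def row_u_def row_v_def row_p_def wave_def mult_ac)
  then show ?thesis
    by (simp add: tau_def tdet_def cdet_def cmat_def offset_def add.assoc)
qed

lemma gamma_curve_point: "gamma P x t y n m k l N = curve_point (\<lambda>s. tau P x t s n m k l N) y"
  by (simp add: gamma_def curve_point_def)

lemma offset_step:
  "offset P (n + 1) m k l = offset P n m k l + a_seq P n"
  "offset P n m (k + 1) l = offset P n m k l + c_seq P k"
  "offset P n m k (l + 1) = offset P n m k l + 1 / d_seq P l"
  by (simp_all add: offset_def indef_sum_step)

text \<open>On either side of the base point, one of the two ranges contains the index
  \<open>n\<close> of the step. Definedness of tau at both ends therefore makes the factor of the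
  step invertible.\<close>

lemma index_range_step: "n \<in> index_range n0 n \<union> index_range n0 (n + 1)"
  by (auto simp: index_range_def)

lemma tau_defined_nonzero: "tau_defined P n m k l N \<Longrightarrow> i < N \<Longrightarrow> row_p P i \<noteq> 0"
  by (auto simp: tau_defined_def row_p_def)

lemma tau_defined_regular:
  "tau_defined P n m k l N \<Longrightarrow> tau_defined P (n + 1) m k l N \<Longrightarrow> regular N (of_real (a_seq P n)) (row_p P)"
  "tau_defined P n m k l N \<Longrightarrow> tau_defined P n (m + 1) k l N \<Longrightarrow> regular N (of_real (b_seq P m)) (row_p P)"
  "tau_defined P n m k l N \<Longrightarrow> tau_defined P n m (k + 1) l N \<Longrightarrow> regular N (of_real (c_seq P k)) (row_p P)"
  using index_range_step[of n "base_n P"] index_range_step[of m "base_m P"] index_range_step[of k "base_k P"]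
  by (auto simp: tau_defined_def regular_def row_p_def)

lemma tau_defined_regular_l:
  assumes "tau_defined P n m k l N" "tau_defined P n m k (l + 1) N" "i < N"
  shows "row_p P i \<noteq> 0 \<and> 1 - of_real (d_seq P l) / row_p P i \<noteq> 0 \<and> 1 + of_real (d_seq P l) / row_p P i \<noteq> 0"
  using assms index_range_step[of l "base_l P"] by (auto simp: tau_defined_def row_p_def)

lemma row_step:
  "regular N (of_real (a_seq P n)) (row_p P) \<Longrightarrow> i < N \<Longrightarrow>
    row_u P (n + 1) m k l i = fwd (of_real (a_seq P n)) (row_p P) (row_u P n m k l) i \<and>
    row_v P (n + 1) m k l i = fwd (- of_real (a_seq P n)) (row_p P) (row_v P n m k l) i"
  "regular N (of_real (b_seq P m)) (row_p P) \<Longrightarrow> i < N \<Longrightarrow>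
    row_u P n (m + 1) k l i = fwd (of_real (b_seq P m)) (row_p P) (row_u P n m k l) i \<and>
    row_v P n (m + 1) k l i = fwd (- of_real (b_seq P m)) (row_p P) (row_v P n m k l) i"
  "regular N (of_real (c_seq P k)) (row_p P) \<Longrightarrow> i < N \<Longrightarrow>
    row_u P n m (k + 1) l i = fwd (of_real (c_seq P k)) (row_p P) (row_u P n m k l) i \<and>
    row_v P n m (k + 1) l i = fwd (- of_real (c_seq P k)) (row_p P) (row_v P n m k l) i"
  by (auto simp: row_u_def row_v_def fwd_def regular_def indef_prod_step)

lemma row_step_l:
  assumes "1 - of_real (d_seq P l) / row_p P i \<noteq> 0" "1 + of_real (d_seq P l) / row_p P i \<noteq> 0"
  shows "row_u P n m k (l + 1) i = fwd_inv (of_real (d_seq P l)) (row_p P) (row_u P n m k l) i"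
    "row_v P n m k (l + 1) i = fwd_inv (- of_real (d_seq P l)) (row_p P) (row_v P n m k l) i"
  using assms by (simp_all add: row_u_def row_v_def fwd_inv_def indef_prod_step)

section \<open>Conjugation symmetry of soliton and breather parameters\<close>

lemma cnj_indef_prod: "cnj (indef_prod n0 f n) = indef_prod n0 (\<lambda>j. cnj (f j)) n"
  by (simp add: indef_prod_def)

lemma conj_sym_rows:
  assumes "\<pi> permutes {0..<N}"
    and "\<And>i. i < N \<Longrightarrow> cnj (p_par P (Suc i)) = p_par P (Suc (\<pi> i))"
    and "\<And>i. i < N \<Longrightarrow> cnj (alpha_par P (Suc i)) = alpha_par P (Suc (\<pi> i))"
    and "\<And>i. i < N \<Longrightarrow> cnj (beta_par P (Suc i)) = - beta_par P (Suc (\<pi> i))"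
  shows "conj_sym \<pi> N (row_p P) (row_u P n m k l) (row_v P n m k l)"
  using assms by (simp add: conj_sym_def row_p_def row_u_def row_v_def cnj_indef_prod)

lemma conj_sym_soliton:
  assumes "soliton_params P N"
  shows "conj_sym id N (row_p P) (row_u P n m k l) (row_v P n m k l)"
proof -
  have "cnj (p_par P (Suc i)) = p_par P (Suc i) \<and> cnj (alpha_par P (Suc i)) = alpha_par P (Suc i)
      \<and> cnj (beta_par P (Suc i)) = - beta_par P (Suc i)" if "i < N" for i
  proof -
    have "Suc i \<in> {1..N}" using that by simp
    from bspec[OF assms[unfolded soliton_params_def] this] show ?thesis
      by (auto simp: Reals_cnj_iff)
  qed
  then show ?thesis by (intro conj_sym_rows) (auto simp: permutes_id)
qed

lemma conj_sym_breather:
  assumes "breather_params P N"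
  shows "\<exists>\<pi>. \<forall>n m k l. conj_sym \<pi> N (row_p P) (row_u P n m k l) (row_v P n m k l)"
proof -
  obtain M where N: "N = 2 * M" and B: "\<And>j. j \<in> {1..M} \<Longrightarrow> p_par P (2 * j) = cnj (p_par P (2 * j - 1)) \<and>
      alpha_par P (2 * j) = cnj (alpha_par P (2 * j - 1)) \<and> beta_par P (2 * j) = - cnj (beta_par P (2 * j - 1))"
    using assms by (auto simp: breather_params_def)
  \<comment> \<open>Parameter indices start at 1 and rows at 0, so the pair
    \<open>2 * j - 1\<close>, \<open>2 * j\<close> occupies an even row and the odd row after
    it.\<close>
  define \<pi> where "\<pi> i = (if i < N then if even i then Suc i else i - 1 else i)" for i
  have inv: "\<pi> (\<pi> i) = i" for i
    using N by (auto simp: \<pi>_def elim!: evenE oddE)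
  have "\<pi> permutes {0..<N}"
    unfolding permutes_def
  proof (intro conjI allI impI)
    show "\<pi> i = i" if "i \<notin> {0..<N}" for i using that by (simp add: \<pi>_def)
    show "\<exists>!i. \<pi> i = j" for j using inv by metis
  qed
  moreover have "cnj (p_par P (Suc i)) = p_par P (Suc (\<pi> i)) \<and> cnj (alpha_par P (Suc i)) = alpha_par P (Suc (\<pi> i))
      \<and> cnj (beta_par P (Suc i)) = - beta_par P (Suc (\<pi> i))" if i: "i < N" for i
  proof (cases "even i")
    case True
    then obtain j where j: "i = 2 * j" by blast
    have "Suc j \<in> {1..M}" using i j N by simp
    from B[OF this] show ?thesis using i j by (simp add: \<pi>_def)
  next
    case False
    then obtain j where j: "i = 2 * j + 1" by (blast elim: oddE)
    have "Suc j \<in> {1..M}" using i j N by simp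
    from B[OF this] show ?thesis using i j by (simp add: \<pi>_def)
  qed
  ultimately have "conj_sym \<pi> N (row_p P) (row_u P n m k l) (row_v P n m k l)" for n m k l
    by (intro conj_sym_rows) auto
  then show ?thesis by blast
qed

lemma conj_sym_admissible:
  assumes "admissible_params P N"
  obtains \<pi> where "\<And>n m k l. conj_sym \<pi> N (row_p P) (row_u P n m k l) (row_v P n m k l)"
  using assms conj_sym_soliton conj_sym_breather unfolding admissible_params_def by metis

text \<open>For consecutive sizes the conjugate pair containing the new index consists of two real, equal rows.\<close>

lemma soliton_params_Suc:
  assumes "admissible_params P N" "admissible_params P (Suc N)"
  shows "soliton_params P (Suc N)"
proof (rule ccontr)
  assume "\<not> soliton_params P (Suc N)"
  with assms(2) obtain M where M: "Suc N = 2 * M" and B: "\<forall>j\<in>{1..M}. p_par P (2 * j) = cnj (p_par P (2 * j - 1)) \<and>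
      alpha_par P (2 * j) = cnj (alpha_par P (2 * j - 1)) \<and> beta_par P (2 * j) = - cnj (beta_par P (2 * j - 1))"
    by (auto simp: admissible_params_def breather_params_def)
  from M have "odd N" by presburger
  with assms(1) have sol: "soliton_params P N" by (auto simp: admissible_params_def breather_params_def)
  have M1: "M \<in> {1..M}" and N1: "N \<in> {1..N}" and N2: "2 * M - 1 = N" using M by (cases M; simp; presburger)+
  obtain r :: real where r: "beta_par P N = \<i> * of_real r" and re: "p_par P N \<in> \<real>" "alpha_par P N \<in> \<real>"
    using sol N1 unfolding soliton_params_def by blast
  have new: "p_par P (Suc N) = cnj (p_par P N)" "alpha_par P (Suc N) = cnj (alpha_par P N)"
    "beta_par P (Suc N) = - cnj (beta_par P N)"
    using bspec[OF B M1] unfolding N2 M[symmetric] by auto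
  have "p_par P (Suc N) \<in> \<real> \<and> alpha_par P (Suc N) \<in> \<real> \<and> (\<exists>r::real. beta_par P (Suc N) = \<i> * of_real r)"
    unfolding new using r re by (auto simp: Reals_cnj_iff)
  then have "soliton_params P (Suc N)"
    using sol unfolding soliton_params_def by (auto simp: le_Suc_eq)
  with \<open>\<not> soliton_params P (Suc N)\<close> show False ..
qed

text \<open>The factor 1 gives tau the shape with an explicit real factor that the theorems on
  \<open>tdet\<close> expect.\<close>

lemma tau_tdet_const:
  "tau P x t s n m k l N = of_real (1 * exp (- (x + offset P n m k l) * s))
     * tdet N (row_p P) (row_u P n m k l) (row_v P n m k l) x t s"
  by (simp add: tau_tdet)

lemma tau_shift_k:
  assumes sym: "conj_sym \<pi> N (row_p P) (row_u P n m k l) (row_v P n m k l)" and c: "c_seq P k \<noteq> 0"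
    and def: "tau_defined P n m k l N" "tau_defined P n m (k + 1) l N"
  shows "\<exists>r. \<forall>x t s. tau P x t s n m (k + 1) l N = of_real (r x t * exp (- (x + offset P n m k l) * s))
    * tdet (Suc N) ((row_p P)(N := of_real (- (1 / c_seq P k)))) ((row_u P n m k l)(N := 1))
        ((row_v P n m k l)(N := 0)) x t s"
proof -
  note reg = tau_defined_regular(3)[OF def]
  obtain r where r: "\<And>x t y. of_real (exp (- c_seq P k * y)) * tdet N (row_p P)
        (fwd (of_real (c_seq P k)) (row_p P) (row_u P n m k l)) (fwd (- of_real (c_seq P k)) (row_p P) (row_v P n m k l)) x t y
      = of_real (r x t) * tdet (Suc N) ((row_p P)(N := of_real (- 1 / c_seq P k))) ((row_u P n m k l)(N := 1))
        ((row_v P n m k l)(N := 0)) x t y"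
    using tdet_fwd_bordered[OF sym c reg] by blast
  have "tau P x t s n m (k + 1) l N = of_real (r x t * exp (- (x + offset P n m k l) * s))
    * tdet (Suc N) ((row_p P)(N := of_real (- (1 / c_seq P k)))) ((row_u P n m k l)(N := 1))
        ((row_v P n m k l)(N := 0)) x t s" for x t s
  proof -
    have "tdet N (row_p P) (row_u P n m (k + 1) l) (row_v P n m (k + 1) l) x t s = tdet N (row_p P)
        (fwd (of_real (c_seq P k)) (row_p P) (row_u P n m k l)) (fwd (- of_real (c_seq P k)) (row_p P) (row_v P n m k l)) x t s"
      using row_step(3)[OF reg] by (intro tdet_cong) auto
    moreover have "exp (- (x + offset P n m (k + 1) l) * s)
        = exp (- (x + offset P n m k l) * s) * exp (- c_seq P k * s)"
      unfolding offset_step by (simp add: algebra_simps flip: exp_add)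
    ultimately show ?thesis
      unfolding tau_tdet using r[of s x t]
      by (simp only: of_real_mult mult.assoc minus_divide_left) (simp only: mult.left_commute)
  qed
  then show ?thesis by blast
qed

lemma tau_shift_l:
  assumes sym: "conj_sym \<pi> N (row_p P) (row_u P n m k l) (row_v P n m k l)" and d: "d_seq P l \<noteq> 0"
    and def: "tau_defined P n m k l N" "tau_defined P n m k (l + 1) N"
  shows "\<exists>r. \<forall>x t s. cnj (tau P x t s n m k (l + 1) N) = of_real (r x t * exp (- (x + offset P n m k l) * s))
    * tdet (Suc N) ((row_p P)(N := of_real (- d_seq P l))) ((row_u P n m k l)(N := 1))
        ((row_v P n m k l)(N := 0)) x t s"
proof -
  note reg = tau_defined_regular_l[OF def]
  obtain r where r: "\<And>x t y. of_real (exp (- (1 / d_seq P l) * y)) * tdet N (row_p P)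
        (fwd_inv (of_real (d_seq P l)) (row_p P) (row_u P n m k l))
        (fwd_inv (- of_real (d_seq P l)) (row_p P) (row_v P n m k l)) x t y
      = of_real (r x t) * cnj (tdet (Suc N) ((row_p P)(N := of_real (- d_seq P l))) ((row_u P n m k l)(N := 1))
        ((row_v P n m k l)(N := 0)) x t y)"
    using tdet_fwd_inv_bordered[OF sym d reg] by blast
  have "cnj (tau P x t s n m k (l + 1) N) = of_real (r x t * exp (- (x + offset P n m k l) * s))
    * tdet (Suc N) ((row_p P)(N := of_real (- d_seq P l))) ((row_u P n m k l)(N := 1))
        ((row_v P n m k l)(N := 0)) x t s" (is "_ = _ * ?T") for x t s
  proof -
    have "tdet N (row_p P) (row_u P n m k (l + 1)) (row_v P n m k (l + 1)) x t s = tdet N (row_p P)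
        (fwd_inv (of_real (d_seq P l)) (row_p P) (row_u P n m k l))
        (fwd_inv (- of_real (d_seq P l)) (row_p P) (row_v P n m k l)) x t s"
      by (rule tdet_cong) (use reg row_step_l in blast)+
    moreover have "exp (- (x + offset P n m k (l + 1)) * s)
        = exp (- (x + offset P n m k l) * s) * exp (- (1 / d_seq P l) * s)"
      unfolding offset_step by (simp add: algebra_simps flip: exp_add)
    ultimately have "tau P x t s n m k (l + 1) N = of_real (r x t * exp (- (x + offset P n m k l) * s)) * cnj ?T"
      unfolding tau_tdet using r[of s x t]
      by (simp only: of_real_mult mult.assoc) (simp only: mult.left_commute)
    then show ?thesis by simp
  qed
  then show ?thesis by blast
qed

section \<open>The six transformations of tau\<close>

lemma baecklund_k:
  assumes adm: "admissible_params P N" and c: "c_seq P k \<noteq> 0" and U: "open U"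
    and \<theta>: "angle_function P y n m k l N U \<theta>" and \<theta>': "angle_function P y n m (k + 1) l N U \<theta>'"
  shows "baecklund_I U (1 / c_seq P k)
    \<theta> (\<lambda>x t. gamma P x t y n m k l N) \<theta>' (\<lambda>x t. gamma P x t y n m (k + 1) l N)"
proof -
  obtain \<pi> where sym: "conj_sym \<pi> N (row_p P) (row_u P n m k l) (row_v P n m k l)"
    using conj_sym_admissible[OF adm] by metis
  have def: "tau_defined P n m k l N" "tau_defined P n m (k + 1) l N"
    using \<theta> \<theta>' by (auto simp: angle_function_def)
  obtain r where r: "\<And>x t s. tau P x t s n m (k + 1) l N = of_real (r x t * exp (- (x + offset P n m k l) * s))
    * tdet (Suc N) ((row_p P)(N := of_real (- (1 / c_seq P k)))) ((row_u P n m k l)(N := 1))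
        ((row_v P n m k l)(N := 0)) x t s"
    using tau_shift_k[OF sym c def] by blast
  interpret darboux \<pi> N "row_p P" "row_u P n m k l" "row_v P n m k l" "- (1 / c_seq P k)" 1 0
    using sym tau_defined_nonzero[OF def(1)] c by unfold_locales auto
  have "baecklund_I U (- (- (1 / c_seq P k)))
    \<theta> (\<lambda>x t. gamma P x t y n m k l N) \<theta>' (\<lambda>x t. gamma P x t y n m (k + 1) l N)"
    unfolding gamma_curve_point r unfolding tau_tdet_const
  proof (rule baecklund_I_tdet[OF U])
    show "continuous_on U (\<lambda>(x, t). \<theta> x t)" "continuous_on U (\<lambda>(x, t). \<theta>' x t)"
      using \<theta> \<theta>' by (simp_all add: angle_function_def)
    fix x t assume xt: "(x, t) \<in> U"
    show "potential_value (of_real (1 * exp (- (x + offset P n m k l) * y))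
        * tdet N (row_p P) (row_u P n m k l) (row_v P n m k l) x t y) (\<theta> x t)"
      using \<theta> xt unfolding angle_function_def tau_tdet_const by blast
    show "potential_value (of_real (r x t * exp (- (x + offset P n m k l) * y))
        * tdet (Suc N) p' u' v' x t y) (\<theta>' x t)"
      using \<theta>' xt unfolding angle_function_def r by blast
  qed
  then show ?thesis by simp
qed

lemma darboux_rows:
  assumes adm: "admissible_params P N" "admissible_params P (Suc N)" and nz: "p_par P (Suc N) \<noteq> 0"
    and def: "tau_defined P n m k l N"
  shows "darboux id N (row_p P) (row_u P n m k l) (row_v P n m k l) (Re (p_par P (Suc N)))
    (row_u P n m k l N) (row_v P n m k l N)"
proof
  have sol: "soliton_params P (Suc N)" by (rule soliton_params_Suc[OF adm])
  then have "soliton_params P N" by (simp add: soliton_params_def)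
  then show "conj_sym id N (row_p P) (row_u P n m k l) (row_v P n m k l)" by (rule conj_sym_soliton)
  show "row_p P i \<noteq> 0" if "i < N" for i using tau_defined_nonzero[OF def that] .
  show "Re (p_par P (Suc N)) \<noteq> 0"
    using p_par_Suc_real[OF adm] nz by (auto elim!: Reals_cases)
  show "cnj (row_u P n m k l N) = row_u P n m k l N" "cnj (row_v P n m k l N) = - row_v P n m k l N"
    using conj_sym_soliton[OF sol, of n m k l] by (auto simp: conj_sym_def)
qed

lemma baecklund_N:
  assumes adm: "admissible_params P N" "admissible_params P (Suc N)" and nz: "p_par P (Suc N) \<noteq> 0" and U: "open U"
    and \<theta>: "angle_function P y n m k l N U \<theta>" and \<theta>': "angle_function P y n m k l (Suc N) U \<theta>'"
  shows "baecklund_I U (- Re (p_par P (Suc N)))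
    \<theta> (\<lambda>x t. gamma P x t y n m k l N) \<theta>' (\<lambda>x t. gamma P x t y n m k l (Suc N))"
proof -
  have def: "tau_defined P n m k l N" using \<theta> by (auto simp: angle_function_def)
  have re: "of_real (Re (p_par P (Suc N))) = row_p P N"
    using p_par_Suc_real[OF adm] by (simp add: row_p_def)
  interpret darboux id N "row_p P" "row_u P n m k l" "row_v P n m k l" "Re (p_par P (Suc N))"
    "row_u P n m k l N" "row_v P n m k l N"
    by (rule darboux_rows[OF adm nz def])
  \<comment> \<open>The coefficient functions already contain row \<open>N\<close>. Bordering by
    that row changes nothing, which is the content of \<open>fun_upd_triv\<close>.\<close>
  show ?thesis
    unfolding gamma_curve_point tau_tdet_const
    by (rule baecklund_I_tdet[OF U, unfolded re fun_upd_triv])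
      (use \<theta> \<theta>' in \<open>auto simp: angle_function_def tau_tdet_const simp del: of_real_mult of_real_minus\<close>)
qed

lemma baecklund_l:
  assumes adm: "admissible_params P N" and d: "d_seq P l \<noteq> 0" and U: "open U"
    and \<theta>: "angle_function P y n m k l N U \<theta>" and \<theta>': "angle_function P y n m k (l + 1) N U \<theta>'"
  shows "baecklund_III U (d_seq P l)
    \<theta> (\<lambda>x t. gamma P x t y n m k l N) \<theta>' (\<lambda>x t. gamma P x t y n m k (l + 1) N)"
proof -
  obtain \<pi> where sym: "conj_sym \<pi> N (row_p P) (row_u P n m k l) (row_v P n m k l)"
    using conj_sym_admissible[OF adm] by metis
  have def: "tau_defined P n m k l N" "tau_defined P n m k (l + 1) N"
    using \<theta> \<theta>' by (auto simp: angle_function_def)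
  obtain r where r: "\<And>x t s. cnj (tau P x t s n m k (l + 1) N) = of_real (r x t * exp (- (x + offset P n m k l) * s))
    * tdet (Suc N) ((row_p P)(N := of_real (- d_seq P l))) ((row_u P n m k l)(N := 1))
        ((row_v P n m k l)(N := 0)) x t s"
    using tau_shift_l[OF sym d def] by blast
  interpret darboux \<pi> N "row_p P" "row_u P n m k l" "row_v P n m k l" "- d_seq P l" 1 0
    using sym tau_defined_nonzero[OF def(1)] d by unfold_locales auto
  have pot: "potential_value (of_real (1 * exp (- (x + offset P n m k l) * y))
      * tdet N (row_p P) (row_u P n m k l) (row_v P n m k l) x t y) (\<theta> x t)" if "(x, t) \<in> U" for x t
    using \<theta> that unfolding angle_function_def tau_tdet_const by blast
  have pot': "potential_value (of_real (r x t * exp (- (x + offset P n m k l) * y))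
      * tdet (Suc N) p' u' v' x t y) (- \<theta>' x t)" if "(x, t) \<in> U" for x t
    using \<theta>' that unfolding angle_function_def r[symmetric] by (blast intro: potential_value_cnj)
  have cont': "continuous_on U (\<lambda>(x, t). - \<theta>' x t)"
    using \<theta>' continuous_on_minus[of U "\<lambda>(x, t). \<theta>' x t"] by (simp add: angle_function_def case_prod_unfold)
  have "baecklund_I U (- (- d_seq P l)) \<theta> (\<lambda>x t. gamma P x t y n m k l N) (\<lambda>x t. - \<theta>' x t)
     (\<lambda>x t. curve_point (\<lambda>s. of_real (r x t * exp (- (x + offset P n m k l) * s)) * tdet (Suc N) p' u' v' x t s) y)"
    unfolding gamma_curve_point tau_tdet_const
    using \<theta> by (intro baecklund_I_tdet[OF U _ cont' pot pot']) (simp_all add: angle_function_def)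
  then have "baecklund_I U (- (- d_seq P l)) \<theta> (\<lambda>x t. gamma P x t y n m k l N) (\<lambda>x t. - \<theta>' x t)
     (\<lambda>x t. reflection *v gamma P x t y n m k (l + 1) N)"
  proof (rule baecklund_I_cong)
    fix x t assume xt: "(x, t) \<in> U"
    have "cnj (of_real (r x t * exp (- (x + offset P n m k l) * s)) * tdet (Suc N) p' u' v' x t s)
        = tau P x t s n m k (l + 1) N" for s
      unfolding r[symmetric] by simp
    moreover have "curve_point (\<lambda>s. of_real (r x t * exp (- (x + offset P n m k l) * s)) * tdet (Suc N) p' u' v' x t s) y
        = reflection *v curve_point (\<lambda>s. cnj (of_real (r x t * exp (- (x + offset P n m k l) * s))
            * tdet (Suc N) p' u' v' x t s)) y"
      by (rule curve_point_cnj_tdet[OF sym' p'_nz pot'[OF xt]])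
    ultimately show "reflection *v gamma P x t y n m k (l + 1) N
        = curve_point (\<lambda>s. of_real (r x t * exp (- (x + offset P n m k l) * s)) * tdet (Suc N) p' u' v' x t s) y"
      unfolding gamma_curve_point by (simp only:)
  qed
  then show ?thesis by (intro baecklund_III_if_I) simp
qed

lemma baecklund_II_tau:
  fixes pe :: real
  assumes sym: "\<And>n m. conj_sym \<pi> N (row_p P) (row_u P n m k l) (row_v P n m k l)"
    and \<Theta>: "potential_function P x t y k l N D \<Theta>" and pe: "pe \<noteq> 0"
    and ext: "\<And>n m. (n, m) \<in> D \<inter> D' \<Longrightarrow> cnj (al n m) = al n m \<and> cnj (be n m) = - be n m"
    and W: "\<And>n m. (n, m) \<in> D \<inter> D' \<Longrightarrow> \<exists>r::real.
      potential_value (of_real (r * exp (- (x + offset P n m k l) * y)) * tdet (Suc N) ((row_p P)(N := of_real pe))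
        ((row_u P n m k l)(N := al n m)) ((row_v P n m k l)(N := be n m)) x t y) (\<Theta>' n m) \<and>
      \<gamma>' n m = curve_point (\<lambda>s. of_real (r * exp (- (x + offset P n m k l) * s)) * tdet (Suc N) ((row_p P)(N := of_real pe))
        ((row_u P n m k l)(N := al n m)) ((row_v P n m k l)(N := be n m)) x t s) y"
    and ext_n: "\<And>n m. (n, m) \<in> D \<inter> D' \<Longrightarrow> (n + 1, m) \<in> D \<inter> D' \<Longrightarrow> 1 / - pe \<noteq> a_seq P n \<Longrightarrow>
      \<exists>g::real. g \<noteq> 0 \<and> al (n + 1) m = of_real g * (al n m * (1 + of_real (a_seq P n) * of_real pe))
        \<and> be (n + 1) m = of_real g * (be n m * (1 - of_real (a_seq P n) * of_real pe))"
    and ext_m: "\<And>n m. (n, m) \<in> D \<inter> D' \<Longrightarrow> (n, m + 1) \<in> D \<inter> D' \<Longrightarrow> 1 / - pe \<noteq> b_seq P m \<Longrightarrow>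
      \<exists>g::real. g \<noteq> 0 \<and> al n (m + 1) = of_real g * (al n m * (1 + of_real (b_seq P m) * of_real pe))
        \<and> be n (m + 1) = of_real g * (be n m * (1 - of_real (b_seq P m) * of_real pe))"
  shows "baecklund_II (a_seq P) (b_seq P) D D' (- pe) \<Theta> (\<lambda>n m. gamma P x t y n m k l N) \<Theta>' \<gamma>'"
proof -
  have def: "tau_defined P n m k l N"
    and pot: "potential_value (of_real (exp (- (x + offset P n m k l) * y))
      * tdet N (row_p P) (row_u P n m k l) (row_v P n m k l) x t y) (\<Theta> n m)" if "(n, m) \<in> D" for n m
    using \<Theta> that unfolding potential_function_def tau_tdet by blast+
  \<comment> \<open>The real factor may differ from site to site; it is turned into a function of
    the site by choice, with the membership condition moved inside the existential
    quantifier.\<close>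
  have "\<forall>n m. \<exists>r::real. (n, m) \<in> D \<inter> D' \<longrightarrow>
      potential_value (of_real (r * exp (- (x + offset P n m k l) * y)) * tdet (Suc N) ((row_p P)(N := of_real pe))
        ((row_u P n m k l)(N := al n m)) ((row_v P n m k l)(N := be n m)) x t y) (\<Theta>' n m) \<and>
      \<gamma>' n m = curve_point (\<lambda>s. of_real (r * exp (- (x + offset P n m k l) * s)) * tdet (Suc N) ((row_p P)(N := of_real pe))
        ((row_u P n m k l)(N := al n m)) ((row_v P n m k l)(N := be n m)) x t s) y"
    using W by blast
  then obtain r' :: "int \<Rightarrow> int \<Rightarrow> real" where r': "\<And>n m. (n, m) \<in> D \<inter> D' \<Longrightarrow>
      potential_value (of_real (r' n m * exp (- (x + offset P n m k l) * y)) * tdet (Suc N) ((row_p P)(N := of_real pe))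
        ((row_u P n m k l)(N := al n m)) ((row_v P n m k l)(N := be n m)) x t y) (\<Theta>' n m)"
    "\<And>n m. (n, m) \<in> D \<inter> D' \<Longrightarrow>
      \<gamma>' n m = curve_point (\<lambda>s. of_real (r' n m * exp (- (x + offset P n m k l) * s)) * tdet (Suc N) ((row_p P)(N := of_real pe))
        ((row_u P n m k l)(N := al n m)) ((row_v P n m k l)(N := be n m)) x t s) y"
    unfolding choice_iff by blast
  show ?thesis
  proof (rule baecklund_II_tdet[where c = "\<lambda>n m. x + offset P n m k l", OF sym _ pe ext pot r'(1) _ _ ext_n ext_m _ r'(2)])
    show "\<forall>i<N. row_p P i \<noteq> 0" if "D \<noteq> {}"
      using that def tau_defined_nonzero by fastforce
    show "gamma P x t y n m k l N = curve_point (\<lambda>s. of_real (exp (- (x + offset P n m k l) * s))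
        * tdet N (row_p P) (row_u P n m k l) (row_v P n m k l) x t s) y" for n m
      unfolding gamma_curve_point tau_tdet ..
    show "regular N (of_real (a_seq P n)) (row_p P) \<and> x + offset P (n + 1) m k l = x + offset P n m k l + a_seq P n \<and>
      (\<forall>i<N. row_u P (n + 1) m k l i = fwd (of_real (a_seq P n)) (row_p P) (row_u P n m k l) i \<and>
        row_v P (n + 1) m k l i = fwd (- of_real (a_seq P n)) (row_p P) (row_v P n m k l) i)"
      if "(n, m) \<in> D" "(n + 1, m) \<in> D" for n m
      using tau_defined_regular(1)[OF def[OF that(1)] def[OF that(2)]] row_step(1) by (simp add: offset_step)
    show "regular N (of_real (b_seq P m)) (row_p P) \<and>
      (\<forall>i<N. row_u P n (m + 1) k l i = fwd (of_real (b_seq P m)) (row_p P) (row_u P n m k l) i \<and>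
        row_v P n (m + 1) k l i = fwd (- of_real (b_seq P m)) (row_p P) (row_v P n m k l) i)"
      if "(n, m) \<in> D" "(n, m + 1) \<in> D" for n m
      using tau_defined_regular(2)[OF def[OF that(1)] def[OF that(2)]] row_step(2) by simp
  qed
qed

text \<open>The artificial row keeps the coefficients \<open>(1, 0)\<close> at all sites, while a
  lattice step would multiply the first by \<open>1 + a * pe\<close>. The factor \<open>g\<close>
  undoes this, and \<open>1 / - pe \<noteq> a\<close> makes it finite.\<close>

lemma shift_normalization:
  fixes a pe :: real
  assumes "pe \<noteq> 0" "1 / - pe \<noteq> a"
  shows "\<exists>g::real. g \<noteq> 0 \<and> (1::complex) = of_real g * (1 * (1 + of_real a * of_real pe))
    \<and> (0::complex) = of_real g * (0 * (1 - of_real a * of_real pe))"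
proof -
  have nz: "1 + a * pe \<noteq> 0" using assms by (auto simp: field_simps)
  have "of_real (inverse (1 + a * pe)) * (1 + of_real a * of_real pe) = complex_of_real (inverse (1 + a * pe) * (1 + a * pe))"
    by simp
  also have "\<dots> = 1" using nz by simp
  finally show ?thesis using nz by (intro exI[of _ "inverse (1 + a * pe)"]) simp
qed

lemma baecklund_lattice_k:
  assumes adm: "admissible_params P N" and c: "c_seq P k \<noteq> 0"
    and \<Theta>: "potential_function P x t y k l N D \<Theta>" and \<Theta>': "potential_function P x t y (k + 1) l N D' \<Theta>'"
  shows "baecklund_II (a_seq P) (b_seq P) D D' (1 / c_seq P k)
    \<Theta> (\<lambda>n m. gamma P x t y n m k l N) \<Theta>' (\<lambda>n m. gamma P x t y n m (k + 1) l N)"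
proof -
  obtain \<pi> where sym: "\<And>n m k l. conj_sym \<pi> N (row_p P) (row_u P n m k l) (row_v P n m k l)"
    using conj_sym_admissible[OF adm] by metis
  let ?pe = "- (1 / c_seq P k)"
  have pe: "?pe \<noteq> 0" using c by simp
  have "baecklund_II (a_seq P) (b_seq P) D D' (- ?pe)
    \<Theta> (\<lambda>n m. gamma P x t y n m k l N) \<Theta>' (\<lambda>n m. gamma P x t y n m (k + 1) l N)"
  proof (rule baecklund_II_tau[where al = "\<lambda>_ _. 1" and be = "\<lambda>_ _. 0", OF sym \<Theta> pe])
    fix n m assume nm: "(n, m) \<in> D \<inter> D'"
    then have def: "tau_defined P n m k l N" "tau_defined P n m (k + 1) l N"
      and pot: "potential_value (tau P x t y n m (k + 1) l N) (\<Theta>' n m)"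
      using \<Theta> \<Theta>' by (auto simp: potential_function_def)
    obtain r where r: "\<And>x t s. tau P x t s n m (k + 1) l N = of_real (r x t * exp (- (x + offset P n m k l) * s))
      * tdet (Suc N) ((row_p P)(N := of_real ?pe)) ((row_u P n m k l)(N := 1)) ((row_v P n m k l)(N := 0)) x t s"
      using tau_shift_k[OF sym c def] by blast
    show "\<exists>r::real. potential_value (of_real (r * exp (- (x + offset P n m k l) * y))
        * tdet (Suc N) ((row_p P)(N := of_real ?pe)) ((row_u P n m k l)(N := 1)) ((row_v P n m k l)(N := 0)) x t y) (\<Theta>' n m)
      \<and> gamma P x t y n m (k + 1) l N = curve_point (\<lambda>s. of_real (r * exp (- (x + offset P n m k l) * s))
        * tdet (Suc N) ((row_p P)(N := of_real ?pe)) ((row_u P n m k l)(N := 1)) ((row_v P n m k l)(N := 0)) x t s) y"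
      using pot unfolding gamma_curve_point r by blast
  qed (use shift_normalization[OF pe] in auto)
  then show ?thesis by simp
qed

lemma baecklund_lattice_N:
  assumes adm: "admissible_params P N" "admissible_params P (Suc N)" and nz: "p_par P (Suc N) \<noteq> 0"
    and \<Theta>: "potential_function P x t y k l N D \<Theta>" and \<Theta>': "potential_function P x t y k l (Suc N) D' \<Theta>'"
  shows "baecklund_II (a_seq P) (b_seq P) D D' (- Re (p_par P (Suc N)))
    \<Theta> (\<lambda>n m. gamma P x t y n m k l N) \<Theta>' (\<lambda>n m. gamma P x t y n m k l (Suc N))"
proof -
  have re: "of_real (Re (p_par P (Suc N))) = row_p P N"
    using p_par_Suc_real[OF adm] by (simp add: row_p_def)
  have sol: "soliton_params P (Suc N)" by (rule soliton_params_Suc[OF adm])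
  then have sym: "conj_sym id N (row_p P) (row_u P n m k l) (row_v P n m k l)" for n m
    by (intro conj_sym_soliton) (simp add: soliton_params_def)
  have pe: "Re (p_par P (Suc N)) \<noteq> 0"
    using p_par_Suc_real[OF adm] nz by (auto elim!: Reals_cases)
  \<comment> \<open>The genuine new row advances like all others. Its factor is
    \<open>1 / ((1 - a * q) * (1 + a * q))\<close> with \<open>q\<close> the new parameter, and it
    is real because consecutive sizes force \<open>q\<close> to be real.\<close>
  have normalization: "\<exists>g::real. g \<noteq> 0
      \<and> fwd (of_real a) (row_p P) u N = of_real g * (u N * (1 + of_real a * row_p P N))
      \<and> fwd (- of_real a) (row_p P) v N = of_real g * (v N * (1 - of_real a * row_p P N))"
    if reg: "regular (Suc N) (of_real a) (row_p P)" for a u v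
  proof -
    let ?q = "Re (p_par P (Suc N))" and ?C = "1 - of_real a * row_p P N" and ?D = "1 + of_real a * row_p P N"
    have nz: "?C \<noteq> 0" "?D \<noteq> 0" using reg by (auto simp: regular_def)
    have g: "of_real (inverse ((1 - a * ?q) * (1 + a * ?q))) = inverse (?C * ?D)"
      unfolding re[symmetric] by simp
    have gen: "z * inverse c = inverse (c * d) * (z * d)" "z * inverse d = inverse (c * d) * (z * c)"
      if "c \<noteq> 0" "d \<noteq> 0" for z c d :: complex
      using that by (simp_all add: field_simps)
    have "fwd (of_real a) (row_p P) u N = inverse (?C * ?D) * (u N * ?D)"
      unfolding fwd_def by (rule gen[OF nz])
    moreover have "fwd (- of_real a) (row_p P) v N = inverse (?C * ?D) * (v N * ?C)"
      unfolding fwd_def using gen(2)[OF nz, of "v N"] by simp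
    moreover have "complex_of_real (inverse ((1 - a * ?q) * (1 + a * ?q))) \<noteq> 0"
      unfolding g using nz by simp
    then have "inverse ((1 - a * ?q) * (1 + a * ?q)) \<noteq> 0" by (simp only: of_real_eq_0_iff not_False_eq_True)
    ultimately show ?thesis unfolding g[symmetric] by blast
  qed
  have def': "tau_defined P n m k l (Suc N)" and pot': "potential_value (tau P x t y n m k l (Suc N)) (\<Theta>' n m)"
    if "(n, m) \<in> D'" for n m
    using \<Theta>' that by (auto simp: potential_function_def)
  show ?thesis
  proof (rule baecklund_II_tau[where al = "\<lambda>n m. row_u P n m k l N" and be = "\<lambda>n m. row_v P n m k l N", OF sym \<Theta> pe,
      unfolded re fun_upd_triv])
    fix n m assume nm: "(n, m) \<in> D \<inter> D'"
    show "cnj (row_u P n m k l N) = row_u P n m k l N \<and> cnj (row_v P n m k l N) = - row_v P n m k l N"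
      using conj_sym_soliton[OF sol, of n m k l] by (auto simp: conj_sym_def)
    show "\<exists>r::real. potential_value (of_real (r * exp (- (x + offset P n m k l) * y))
        * tdet (Suc N) (row_p P) (row_u P n m k l) (row_v P n m k l) x t y) (\<Theta>' n m)
      \<and> gamma P x t y n m k l (Suc N) = curve_point (\<lambda>s. of_real (r * exp (- (x + offset P n m k l) * s))
        * tdet (Suc N) (row_p P) (row_u P n m k l) (row_v P n m k l) x t s) y"
      using pot'[of n m] nm unfolding gamma_curve_point tau_tdet_const by blast
  next
    fix n m assume "(n, m) \<in> D \<inter> D'" "(n + 1, m) \<in> D \<inter> D'"
    then have reg: "regular (Suc N) (of_real (a_seq P n)) (row_p P)"
      using tau_defined_regular(1) def' by blast
    show "\<exists>g::real. g \<noteq> 0 \<and> row_u P (n + 1) m k l N = of_real g * (row_u P n m k l N * (1 + of_real (a_seq P n) * row_p P N))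
      \<and> row_v P (n + 1) m k l N = of_real g * (row_v P n m k l N * (1 - of_real (a_seq P n) * row_p P N))"
      using normalization[OF reg] row_step(1)[OF reg lessI] by simp
  next
    fix n m assume "(n, m) \<in> D \<inter> D'" "(n, m + 1) \<in> D \<inter> D'"
    then have reg: "regular (Suc N) (of_real (b_seq P m)) (row_p P)"
      using tau_defined_regular(2) def' by blast
    show "\<exists>g::real. g \<noteq> 0 \<and> row_u P n (m + 1) k l N = of_real g * (row_u P n m k l N * (1 + of_real (b_seq P m) * row_p P N))
      \<and> row_v P n (m + 1) k l N = of_real g * (row_v P n m k l N * (1 - of_real (b_seq P m) * row_p P N))"
      using normalization[OF reg] row_step(2)[OF reg lessI] by simp
  qed
qed

lemma baecklund_lattice_l:
  assumes adm: "admissible_params P N" and d: "d_seq P l \<noteq> 0"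
    and \<Theta>: "potential_function P x t y k l N D \<Theta>" and \<Theta>': "potential_function P x t y k (l + 1) N D' \<Theta>'"
  shows "baecklund_IV (a_seq P) (b_seq P) D D' (d_seq P l)
    \<Theta> (\<lambda>n m. gamma P x t y n m k l N) \<Theta>' (\<lambda>n m. gamma P x t y n m k (l + 1) N)"
proof (rule baecklund_IV_if_II)
  obtain \<pi> where sym: "\<And>n m k l. conj_sym \<pi> N (row_p P) (row_u P n m k l) (row_v P n m k l)"
    using conj_sym_admissible[OF adm] by metis
  let ?pe = "- d_seq P l"
  have pe: "?pe \<noteq> 0" using d by simp
  have "baecklund_II (a_seq P) (b_seq P) D D' (- ?pe)
    \<Theta> (\<lambda>n m. gamma P x t y n m k l N) (\<lambda>n m. - \<Theta>' n m) (\<lambda>n m. reflection *v gamma P x t y n m k (l + 1) N)"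
  proof (rule baecklund_II_tau[where al = "\<lambda>_ _. 1" and be = "\<lambda>_ _. 0", OF sym \<Theta> pe])
    fix n m assume nm: "(n, m) \<in> D \<inter> D'"
    then have def: "tau_defined P n m k l N" "tau_defined P n m k (l + 1) N"
      and pot: "potential_value (tau P x t y n m k (l + 1) N) (\<Theta>' n m)"
      using \<Theta> \<Theta>' by (auto simp: potential_function_def)
    interpret darboux \<pi> N "row_p P" "row_u P n m k l" "row_v P n m k l" ?pe 1 0
      using sym tau_defined_nonzero[OF def(1)] d by unfold_locales auto
    obtain r where r: "\<And>x t s. cnj (tau P x t s n m k (l + 1) N)
      = of_real (r x t * exp (- (x + offset P n m k l) * s)) * tdet (Suc N) p' u' v' x t s"
      using tau_shift_l[OF sym d def] by blast
    have pot': "potential_value (of_real (r x t * exp (- (x + offset P n m k l) * y)) * tdet (Suc N) p' u' v' x t y) (- \<Theta>' n m)"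
      using potential_value_cnj[OF pot] unfolding r .
    have "cnj (of_real (r x t * exp (- (x + offset P n m k l) * s)) * tdet (Suc N) p' u' v' x t s)
        = tau P x t s n m k (l + 1) N" for s
      unfolding r[symmetric] by simp
    moreover have "curve_point (\<lambda>s. of_real (r x t * exp (- (x + offset P n m k l) * s)) * tdet (Suc N) p' u' v' x t s) y
        = reflection *v curve_point (\<lambda>s. cnj (of_real (r x t * exp (- (x + offset P n m k l) * s))
            * tdet (Suc N) p' u' v' x t s)) y"
      by (rule curve_point_cnj_tdet[OF sym' p'_nz pot'])
    ultimately have "reflection *v gamma P x t y n m k (l + 1) N
        = curve_point (\<lambda>s. of_real (r x t * exp (- (x + offset P n m k l) * s)) * tdet (Suc N) p' u' v' x t s) y"
      unfolding gamma_curve_point by (simp only:)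
    with pot' show "\<exists>r::real. potential_value (of_real (r * exp (- (x + offset P n m k l) * y))
        * tdet (Suc N) p' u' v' x t y) (- \<Theta>' n m)
      \<and> reflection *v gamma P x t y n m k (l + 1) N = curve_point (\<lambda>s. of_real (r * exp (- (x + offset P n m k l) * s))
        * tdet (Suc N) p' u' v' x t s) y"
      by blast
  qed (use shift_normalization[OF pe] in auto)
  then show "baecklund_II (a_seq P) (b_seq P) D D' (d_seq P l)
    \<Theta> (\<lambda>n m. gamma P x t y n m k l N) (\<lambda>n m. - \<Theta>' n m) (\<lambda>n m. reflection *v gamma P x t y n m k (l + 1) N)"
    by simp
qed

theorem proposition5p2:
  fixes P :: tau_params
  shows
    "(\<forall>k y n m l N U \<theta> \<theta>'.
        admissible_params P N \<and> c_seq P k \<noteq> 0 \<and> open U \<and>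
        angle_function P y n m k l N U \<theta> \<and> angle_function P y n m (k + 1) l N U \<theta>' \<longrightarrow>
        baecklund_I U (1 / c_seq P k)
          \<theta> (\<lambda>x t. gamma P x t y n m k l N) \<theta>' (\<lambda>x t. gamma P x t y n m (k + 1) l N))
   \<and> (\<forall>k x t y l N D D' \<Theta> \<Theta>'.
        admissible_params P N \<and> c_seq P k \<noteq> 0 \<and>
        potential_function P x t y k l N D \<Theta> \<and> potential_function P x t y (k + 1) l N D' \<Theta>' \<longrightarrow>
        baecklund_II (a_seq P) (b_seq P) D D' (1 / c_seq P k)
          \<Theta> (\<lambda>n m. gamma P x t y n m k l N) \<Theta>' (\<lambda>n m. gamma P x t y n m (k + 1) l N))
   \<and> (\<forall>N y n m k l U \<theta> \<theta>'.
        admissible_params P N \<and> admissible_params P (N + 1) \<and> p_par P (N + 1) \<noteq> 0 \<and> open U \<and>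
        angle_function P y n m k l N U \<theta> \<and> angle_function P y n m k l (N + 1) U \<theta>' \<longrightarrow>
        baecklund_I U (- Re (p_par P (N + 1)))
          \<theta> (\<lambda>x t. gamma P x t y n m k l N) \<theta>' (\<lambda>x t. gamma P x t y n m k l (N + 1)))
   \<and> (\<forall>N x t y k l D D' \<Theta> \<Theta>'.
        admissible_params P N \<and> admissible_params P (N + 1) \<and> p_par P (N + 1) \<noteq> 0 \<and>
        potential_function P x t y k l N D \<Theta> \<and> potential_function P x t y k l (N + 1) D' \<Theta>' \<longrightarrow>
        baecklund_II (a_seq P) (b_seq P) D D' (- Re (p_par P (N + 1)))
          \<Theta> (\<lambda>n m. gamma P x t y n m k l N) \<Theta>' (\<lambda>n m. gamma P x t y n m k l (N + 1)))
   \<and> (\<forall>l y n m k N U \<theta> \<theta>'.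
        admissible_params P N \<and> d_seq P l \<noteq> 0 \<and> open U \<and>
        angle_function P y n m k l N U \<theta> \<and> angle_function P y n m k (l + 1) N U \<theta>' \<longrightarrow>
        baecklund_III U (d_seq P l)
          \<theta> (\<lambda>x t. gamma P x t y n m k l N) \<theta>' (\<lambda>x t. gamma P x t y n m k (l + 1) N))
   \<and> (\<forall>l x t y k N D D' \<Theta> \<Theta>'.
        admissible_params P N \<and> d_seq P l \<noteq> 0 \<and>
        potential_function P x t y k l N D \<Theta> \<and> potential_function P x t y k (l + 1) N D' \<Theta>' \<longrightarrow>
        baecklund_IV (a_seq P) (b_seq P) D D' (d_seq P l)
          \<Theta> (\<lambda>n m. gamma P x t y n m k l N) \<Theta>' (\<lambda>n m. gamma P x t y n m k (l + 1) N))"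
  unfolding Suc_eq_plus1[symmetric]
  by (intro conjI allI impI; elim conjE)
    ((rule baecklund_k baecklund_lattice_k baecklund_N baecklund_lattice_N baecklund_l baecklund_lattice_l; assumption)+)

end
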